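(* Let $H\in(0,1)$, let $b:\mathbb{R}\to\mathbb{R}$ be differentiable with bounded derivative, let $\theta\in\Theta\subset\mathbb{R}$, let $T>0$, and let $X$ be the solution of $X_t=\theta\int_0^t b(X_s)\,ds+B^H_t$, $X_0=0$. Denote, for every $t\in[0,T]$, $$Q_t=Q_t(X)=K_H^{-1}\Big(\int_0^{\cdot}b(X_r)\,dr\Big)(t).$$ Then $Q\in L^2([0,T])$ almost surely, and the maximum likelihood estimator of $\theta$ based on the observation of $(X_s)_{0\le s\le t}$ is given by $$\theta_t=-\frac{\int_0^t Q_s\,dW_s}{\int_0^t Q_s^2\,ds}.$$
   Context: $B^H$ is a fractional Brownian motion with Hurst parameter $H\in(0,1)$ on a probability space $(\Omega,\mathcal F,\mathbf P)$: a centered continuous Gaussian process with $\mathbf E[B^H_tB^H_s]=\frac12(t^{2H}+s^{2H}-|t-s|^{2H})$. It is represented as $B^H_t=\int_0^tK(t,s)\,dW_s$, where $W$ is a Wiener process (standard Brownian motion) under $\mathbf P$; this is the $W$ that appears in the formula for $\theta_t$. $K$ is the usual Volterra kernel: $K\equiv1$ if $H=1/2$; $K(t,s)=c_Hs^{1/2-H}\int_s^t(u-s)^{H-3/2}u^{H-1/2}\,du$ with $c_H=\big(\frac{H(2H-1)}{\mathrm{Beta}(2-2H,H-1/2)}\big)^{1/2}$ if $H>1/2$; $K(t,s)=c_H\big[(t/s)^{H-1/2}(t-s)^{H-1/2}-(H-\frac12)s^{1/2-H}\int_s^tu^{H-3/2}(u-s)^{H-1/2}\,du\big]$ with $c_H=\big(\frac{2H}{(1-2H)\mathrm{Beta}(1-2H,H+1/2)}\big)^{1/2}$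 if $H<1/2$ ($0<s<t$). $K_H$ is the linear isomorphism $(K_Hf)(t)=\int_0^tK(t,s)f(s)\,ds$ from $L^2([0,T])$ onto $I_{0+}^{H+1/2}(L^2([0,T]))$ ($I_{0+}^{\alpha}$ is the Riemann–Liouville fractional integral) and $K_H^{-1}$ is its inverse. Up to a positive constant depending only on $H$, for absolutely continuous $h$, $(K_H^{-1}h)(s)=s^{H-1/2}I_{0+}^{1/2-H}(u^{1/2-H}h'(u))(s)$ if $H<1/2$ and $(K_H^{-1}h)(s)=s^{H-1/2}D_{0+}^{H-1/2}(u^{1/2-H}h'(u))(s)$ if $H>1/2$, $D_{0+}^\alpha$ being the Riemann–Liouville fractional derivative. $P_\theta$ denotes the probability measure induced by $(X_s)_{0\le s\le t}$ when the parameter is $\theta$, with $P_0=\mathbf P$. The maximum likelihood estimator is the maximizer over $\theta$ of the log-likelihood, which is taken in the form $F(\theta)=\log\frac{dP_\theta}{dP_0}=-\theta\int_0^tQ_s\,dW_s-\frac{\theta^2}{2}\int_0^tQ_s^2\,ds$. *)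

theory Defs
  imports "HOL-Probability.Probability"
begin

section \<open>Gaussian processes, Wiener process, fractional Brownian motion\<close>

text \<open>Real processes are functions of a time and a sample point; only times \<open>t \<ge> 0\<close> matter.
  A Gaussian variable may be degenerate (almost surely constant).\<close>

definition gaussian_variable :: "'a measure \<Rightarrow> ('a \<Rightarrow> real) \<Rightarrow> bool" where
  "gaussian_variable M Y \<longleftrightarrow> Y \<in> borel_measurable M \<and>
     ((\<exists>\<mu> \<sigma>. \<sigma> > 0 \<and> distributed M lborel Y (normal_density \<mu> \<sigma>)) \<or> (\<exists>\<mu>. AE \<omega> in M. Y \<omega> = \<mu>))"

definition gaussian_process :: "'a measure \<Rightarrow> (real \<Rightarrow> 'a \<Rightarrow> real) \<Rightarrow> bool" where
  "gaussian_process M Y \<longleftrightarrow>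
     (\<forall>J c. finite J \<and> J \<subseteq> {0..} \<longrightarrow> gaussian_variable M (\<lambda>\<omega>. \<Sum>t\<in>J. c t * Y t \<omega>))"

definition fractional_brownian_motion :: "'a measure \<Rightarrow> real \<Rightarrow> (real \<Rightarrow> 'a \<Rightarrow> real) \<Rightarrow> bool" where
  "fractional_brownian_motion M H B \<longleftrightarrow>
     gaussian_process M B \<and>
     (AE \<omega> in M. continuous_on {0..} (\<lambda>t. B t \<omega>)) \<and>
     (\<forall>t\<ge>0. integral\<^sup>L M (B t) = 0) \<and>
     (\<forall>s\<ge>0. \<forall>t\<ge>0. integral\<^sup>L M (\<lambda>\<omega>. B t \<omega> * B s \<omega>)
        = 1 / 2 * (t powr (2 * H) + s powr (2 * H) - \<bar>t - s\<bar> powr (2 * H)))"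

definition natural_filtration :: "'a measure \<Rightarrow> (real \<Rightarrow> 'a \<Rightarrow> real) \<Rightarrow> real \<Rightarrow> 'a measure" where
  "natural_filtration M W t =
     sigma (space M) {W s -` A \<inter> space M | s A. 0 \<le> s \<and> s \<le> t \<and> A \<in> sets borel}"

definition wiener_process :: "'a measure \<Rightarrow> (real \<Rightarrow> 'a \<Rightarrow> real) \<Rightarrow> bool" where
  "wiener_process M W \<longleftrightarrow>
     (\<forall>t\<ge>0. W t \<in> borel_measurable M) \<and>
     (AE \<omega> in M. W 0 \<omega> = 0) \<and>
     (AE \<omega> in M. continuous_on {0..} (\<lambda>t. W t \<omega>)) \<and>
     (\<forall>s t. 0 \<le> s \<and> s < t \<longrightarrow>
        distributed M lborel (\<lambda>\<omega>. W t \<omega> - W s \<omega>) (normal_density 0 (sqrt (t - s))) \<and>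
        prob_space.indep_set M (sets (natural_filtration M W s))
          {(\<lambda>\<omega>. W t \<omega> - W s \<omega>) -` A \<inter> space M | A. A \<in> sets borel})"


section \<open>The Volterra kernel and the operator it defines\<close>

definition volterra_const :: "real \<Rightarrow> real" where
  "volterra_const H =
     (if H > 1 / 2 then sqrt (H * (2 * H - 1) / Beta (2 - 2 * H) (H - 1 / 2))
      else sqrt (2 * H / ((1 - 2 * H) * Beta (1 - 2 * H) (H + 1 / 2))))"

text \<open>The constant is used only for \<open>H \<noteq> 1 / 2\<close>, and the kernel is extended by \<open>0\<close> outside
  \<open>0 < s < t\<close>.\<close>

definition volterra_kernel :: "real \<Rightarrow> real \<Rightarrow> real \<Rightarrow> real" where
  "volterra_kernel H t s =
     (if \<not> (0 < s \<and> s < t) then 0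
      else if H = 1 / 2 then 1
      else if H > 1 / 2 then
        volterra_const H * s powr (1 / 2 - H)
          * (LBINT u:{s..t}. (u - s) powr (H - 3 / 2) * u powr (H - 1 / 2))
      else
        volterra_const H * ((t / s) powr (H - 1 / 2) * (t - s) powr (H - 1 / 2)
          - (H - 1 / 2) * s powr (1 / 2 - H)
              * (LBINT u:{s..t}. u powr (H - 3 / 2) * (u - s) powr (H - 1 / 2))))"

text \<open>Square-integrable functions on \<open>[0,T]\<close>, as functions rather than as classes.\<close>

definition L2 :: "real \<Rightarrow> (real \<Rightarrow> real) set" where
  "L2 T = {f. set_borel_measurable lborel {0..T} f \<and> set_integrable lborel {0..T} (\<lambda>s. (f s)\<^sup>2)}"

definition K_op :: "real \<Rightarrow> (real \<Rightarrow> real) \<Rightarrow> real \<Rightarrow> real" where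
  "K_op H f t = (LBINT s:{0..t}. volterra_kernel H t s * f s)"

text \<open>The preimage is determined only up to a Lebesgue null set, so the choice picks one
  representative of it; the result is meaningless if there is no preimage in \<open>L2 T\<close>.\<close>

definition K_op_inverse :: "real \<Rightarrow> real \<Rightarrow> (real \<Rightarrow> real) \<Rightarrow> (real \<Rightarrow> real)" where
  "K_op_inverse H T h = (SOME f. f \<in> L2 T \<and> (\<forall>t\<in>{0..T}. K_op H f t = h t))"


section \<open>The Ito integral with respect to a Wiener process\<close>

text \<open>The data \<open>n\<close>, \<open>\<tau>\<close>, \<open>\<xi>\<close> stand for the process that equals \<open>\<xi> i\<close> on
  \<open>(\<tau> i, \<tau> (i + 1)]\<close> for \<open>i < n\<close> and vanishes elsewhere.\<close>

definition simple_adapted ::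
  "'a measure \<Rightarrow> (real \<Rightarrow> 'a \<Rightarrow> real) \<Rightarrow> real \<Rightarrow> nat \<Rightarrow> (nat \<Rightarrow> real) \<Rightarrow> (nat \<Rightarrow> 'a \<Rightarrow> real) \<Rightarrow> bool" where
  "simple_adapted M W t n \<tau> \<xi> \<longleftrightarrow>
     0 \<le> \<tau> 0 \<and> mono_on {..n} \<tau> \<and> \<tau> n \<le> t \<and>
     (\<forall>i<n. \<xi> i \<in> borel_measurable (natural_filtration M W (\<tau> i)) \<and>
            (\<exists>C. \<forall>\<omega>\<in>space M. \<bar>\<xi> i \<omega>\<bar> \<le> C))"

definition simple_process :: "nat \<Rightarrow> (nat \<Rightarrow> real) \<Rightarrow> (nat \<Rightarrow> 'a \<Rightarrow> real) \<Rightarrow> real \<Rightarrow> 'a \<Rightarrow> real" where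
  "simple_process n \<tau> \<xi> s \<omega> = (\<Sum>i<n. \<xi> i \<omega> * indicator {\<tau> i<..\<tau> (Suc i)} s)"

definition simple_integral ::
  "(real \<Rightarrow> 'a \<Rightarrow> real) \<Rightarrow> nat \<Rightarrow> (nat \<Rightarrow> real) \<Rightarrow> (nat \<Rightarrow> 'a \<Rightarrow> real) \<Rightarrow> 'a \<Rightarrow> real" where
  "simple_integral W n \<tau> \<xi> \<omega> = (\<Sum>i<n. \<xi> i \<omega> * (W (\<tau> (Suc i)) \<omega> - W (\<tau> i) \<omega>))"

definition converges_in_probability :: "'a measure \<Rightarrow> (nat \<Rightarrow> 'a \<Rightarrow> real) \<Rightarrow> ('a \<Rightarrow> real) \<Rightarrow> bool" where
  "converges_in_probability M Y Z \<longleftrightarrow>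
     (\<forall>\<epsilon>>0. (\<lambda>k. measure M {\<omega>\<in>space M. \<bar>Y k \<omega> - Z \<omega>\<bar> > \<epsilon>}) \<longlonglongrightarrow> 0)"

text \<open>The variable \<open>I\<close> is a version of the Ito integral of \<open>Q\<close> over \<open>[0,t]\<close>, for integrands whose
  paths are almost surely square integrable.  The squared distances are asked to vanish almost surely
  rather than in probability; passing to a subsequence shows that this is equivalent, and it
  depends on each path of \<open>Q\<close> only through its Lebesgue class.  Null sets need not be added to the
  filtration, because the simple integrands can be altered on null sets.\<close>

definition has_ito_integral ::
  "'a measure \<Rightarrow> (real \<Rightarrow> 'a \<Rightarrow> real) \<Rightarrow> (real \<Rightarrow> 'a \<Rightarrow> real) \<Rightarrow> real \<Rightarrow> ('a \<Rightarrow> real) \<Rightarrow> bool" where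
  "has_ito_integral M W Q t I \<longleftrightarrow>
     I \<in> borel_measurable M \<and>
     (AE \<omega> in M. (\<lambda>s. Q s \<omega>) \<in> L2 t) \<and>
     (\<exists>n \<tau> \<xi>.
        (\<forall>k. simple_adapted M W t (n k) (\<tau> k) (\<xi> k)) \<and>
        (AE \<omega> in M.
           (\<lambda>k. LBINT s:{0..t}. (simple_process (n k) (\<tau> k) (\<xi> k) s \<omega> - Q s \<omega>)\<^sup>2) \<longlonglongrightarrow> 0) \<and>
        converges_in_probability M (\<lambda>k. simple_integral W (n k) (\<tau> k) (\<xi> k)) I)"


section \<open>The model and the likelihood\<close>

definition solves_fractional_sde ::
  "'a measure \<Rightarrow> real \<Rightarrow> (real \<Rightarrow> real) \<Rightarrow> real \<Rightarrow> (real \<Rightarrow> 'a \<Rightarrow> real) \<Rightarrow> (real \<Rightarrow> 'a \<Rightarrow> real) \<Rightarrow> bool" where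
  "solves_fractional_sde M T b \<theta> B X \<longleftrightarrow>
     (\<forall>t\<in>{0..T}. X t \<in> borel_measurable M) \<and>
     (AE \<omega> in M. continuous_on {0..T} (\<lambda>t. X t \<omega>) \<and> X 0 \<omega> = 0 \<and>
        (\<forall>t\<in>{0..T}. X t \<omega> = \<theta> * (LBINT s:{0..t}. b (X s \<omega>)) + B t \<omega>))"

definition integrated_drift :: "(real \<Rightarrow> real) \<Rightarrow> (real \<Rightarrow> 'a \<Rightarrow> real) \<Rightarrow> 'a \<Rightarrow> real \<Rightarrow> real" where
  "integrated_drift b X \<omega> t = (LBINT r:{0..t}. b (X r \<omega>))"

definition Q_process ::
  "real \<Rightarrow> real \<Rightarrow> (real \<Rightarrow> real) \<Rightarrow> (real \<Rightarrow> 'a \<Rightarrow> real) \<Rightarrow> real \<Rightarrow> 'a \<Rightarrow> real" where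
  "Q_process H T b X t \<omega> = K_op_inverse H T (integrated_drift b X \<omega>) t"

text \<open>The log-likelihood is by convention this function of the parameter \<open>\<eta>\<close>, where \<open>I\<close> is the value
  of the Ito integral of \<open>Q\<close> over \<open>[0,t]\<close> and \<open>q\<close> is the path of \<open>Q\<close>.\<close>

definition log_likelihood :: "real \<Rightarrow> (real \<Rightarrow> real) \<Rightarrow> real \<Rightarrow> real \<Rightarrow> real" where
  "log_likelihood I q t \<eta> = - \<eta> * I - \<eta>\<^sup>2 / 2 * (LBINT s:{0..t}. (q s)\<^sup>2)"

definition maximum_likelihood_estimate :: "real set \<Rightarrow> (real \<Rightarrow> real) \<Rightarrow> real \<Rightarrow> bool" where
  "maximum_likelihood_estimate S F \<eta> \<longleftrightarrow> is_arg_max F (\<lambda>\<eta>. \<eta> \<in> S) \<eta>"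

end

theory Submission
  imports Defs "HOL-Real_Asymp.Real_Asymp"
begin

text \<open>The operator \<open>K_H\<close> factors through Abel transforms, which are inverted by the identity
  \<open>I\<^sup>1\<^sup>-\<^sup>a I\<^sup>a = I\<^sup>1\<close>; this gives uniqueness of preimages and, with \<open>g r = b (X r)\<close>, explicit preimages of
  \<open>\<integral>\<^sub>0 g\<close>.  For \<open>H < 1/2\<close> the preimage is a fractional integral of \<open>g\<close>.  For \<open>H > 1/2\<close> it is a Marchaud
  derivative of order \<open>\<alpha> = H - 1/2\<close>, which is square integrable as soon as a weighted Sobolev seminorm of
  \<open>g\<close> is finite; this holds almost surely because \<open>E (B\<^sub>s - B\<^sub>u)\<^sup>2 = \<bar>s - u\<bar> powr (2 * H)\<close> and \<open>b\<close> is Lipschitz.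

  Up to null sets \<open>B\<^sub>t\<close> is measurable with respect to \<open>W\<close> up to time \<open>t\<close>, being an Ito integral, and so is
  \<open>X\<^sub>t\<close>, being the limit of Picard iterates.  Hence \<open>Q\<close> is an \<open>L\<^sup>2\<close> limit of continuous adapted processes,
  and its Ito integral exists.  The log-likelihood is a concave quadratic polynomial in the parameter.  Where
  \<open>\<integral> Q\<^sup>2 = 0\<close> it is linear, and the division by \<open>0\<close> makes the estimator \<open>0\<close>; this is still a maximizer
  since the Ito integral vanishes almost surely there.\<close>

section \<open>Integrals over intervals and triangles\<close>

text \<open>\<open>K_op_inverse\<close> chooses a representative separately for every sample point,
  so \<open>Q\<close> carries no measurability in the sample point; only the Lebesgue class of each
  path is determined. Statements about \<open>Q\<close> are therefore proved for an explicit
  preimage and carried over by uniqueness: \<open>has_ito_integral\<close> compares \<open>Q\<close>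
  with simple processes only through squared L2 distances.

  A second obstacle is that adaptedness is known for one time at a time and up to null sets, without
  joint measurability. Integrals over \<open>{0..s}\<close> are rewritten by u = s v as integrals
  over \<open>{0..1}\<close>, and for continuous paths these are limits of finite sums of values at
  earlier times.

  For H > 1/2 the weight of the Marchaud derivative is not integrable on the diagonal. The identity
  behind the preimage is first proved with a neighbourhood of the diagonal removed; the divergent
  factor then multiplies a difference that vanishes to first order.\<close>

lemma nonneg_has_integral_lborel:
  fixes f :: "real \<Rightarrow> real"
  assumes [measurable]: "f \<in> borel_measurable borel"
    and nonneg: "\<And>x. x \<in> {a..b} \<Longrightarrow> 0 \<le> f x"
    and int: "(f has_integral I) {a..b}"
  shows "set_integrable lborel {a..b} f" and "(LBINT x:{a..b}. f x) = I"
proof -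
  have "f absolutely_integrable_on {a..b}"
    using int nonneg by (intro nonnegative_absolutely_integrable_1) auto
  then show si: "set_integrable lborel {a..b} f"
    unfolding set_integrable_def by (subst (asm) integrable_completion) auto
  show "(LBINT x:{a..b}. f x) = I"
    using set_borel_integral_eq_integral[OF si] int by (simp add: integral_unique)
qed

lemma indicator_scale_Icc:
  fixes c :: real
  assumes "c > 0"
  shows "indicator {t..t + c} (t + c * v) = (indicator {0..1} v :: real)"
proof -
  have "c * v \<le> c \<longleftrightarrow> v \<le> 1"
    using assms by simp
  moreover have "0 \<le> c * v \<longleftrightarrow> 0 \<le> v"
    using assms by (simp add: zero_le_mult_iff)
  ultimately show ?thesis
    by (auto simp: indicator_def)
qed

lemma set_integral_scale:
  fixes f :: "real \<Rightarrow> real"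
  assumes "c > 0"
  shows "(LBINT s:{t..t + c}. f s) = c * (LBINT v:{0..1}. f (t + c * v))"
  unfolding set_lebesgue_integral_def
  by (subst lborel_integral_real_affine[where c = c and t = t])
     (use assms in \<open>simp_all add: indicator_scale_Icc\<close>)

lemma set_integrable_scale:
  fixes f :: "real \<Rightarrow> real"
  assumes "c > 0"
  shows "set_integrable lborel {t..t + c} f \<longleftrightarrow> set_integrable lborel {0..1} (\<lambda>v. f (t + c * v))"
  unfolding set_integrable_def
  by (subst lborel_integrable_real_affine_iff[symmetric, where c = c and t = t])
     (use assms in \<open>simp_all add: indicator_scale_Icc\<close>)

lemma Beta_integral:
  assumes "a > 0" "b > (0::real)"
  shows "set_integrable lborel {0..1} (\<lambda>v. v powr (a - 1) * (1 - v) powr (b - 1))"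
    and "(LBINT v:{0..1}. v powr (a - 1) * (1 - v) powr (b - 1)) = Beta a b"
  by (rule nonneg_has_integral_lborel[OF _ _ has_integral_Beta_real[OF assms]]; auto)+

lemma Beta_integral_scaled:
  assumes "a > 0" "b > (0::real)" "u < x"
  shows "set_integrable lborel {u..x} (\<lambda>s. (s - u) powr (a - 1) * (x - s) powr (b - 1))"
    and "(LBINT s:{u..x}. (s - u) powr (a - 1) * (x - s) powr (b - 1))
           = (x - u) powr (a + b - 1) * Beta a b"
proof -
  define c where "c = x - u"
  have c: "c > 0" and x: "{u..x} = {u..u + c}" using assms by (auto simp: c_def)
  have eq: "(u + c * v - u) powr (a - 1) * (x - (u + c * v)) powr (b - 1)
      = c powr (a + b - 2) * (v powr (a - 1) * (1 - v) powr (b - 1))" if "v \<in> {0..1}" for v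
  proof -
    have "x - (u + c * v) = c * (1 - v)" by (simp add: c_def algebra_simps)
    then show ?thesis
      using that c by (simp add: powr_mult powr_add[symmetric] mult_ac)
  qed
  have "set_integrable lborel {0..1} (\<lambda>v. (u + c * v - u) powr (a - 1) * (x - (u + c * v)) powr (b - 1))
      = set_integrable lborel {0..1} (\<lambda>v. c powr (a + b - 2) * (v powr (a - 1) * (1 - v) powr (b - 1)))"
    by (rule set_integrable_cong) (use eq in auto)
  moreover have "\<dots>" using Beta_integral(1)[OF assms(1,2)] by (rule set_integrable_mult_right)
  ultimately show "set_integrable lborel {u..x} (\<lambda>s. (s - u) powr (a - 1) * (x - s) powr (b - 1))"
    unfolding x by (subst set_integrable_scale[OF c]) simp
  have "(LBINT v:{0..1}. (u + c * v - u) powr (a - 1) * (x - (u + c * v)) powr (b - 1))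
      = (LBINT v:{0..1}. c powr (a + b - 2) * (v powr (a - 1) * (1 - v) powr (b - 1)))"
    by (rule set_lebesgue_integral_cong) (use eq in auto)
  also have "\<dots> = c powr (a + b - 2) * Beta a b"
    using Beta_integral(2)[OF assms(1,2)] by simp
  finally have "(LBINT s:{u..x}. (s - u) powr (a - 1) * (x - s) powr (b - 1))
      = c * c powr (a + b - 2) * Beta a b"
    unfolding x by (subst set_integral_scale[OF c]) simp
  also have "c * c powr (a + b - 2) = c powr (a + b - 1)"
    using c by (subst powr_mult_base) (auto simp: algebra_simps)
  finally show "(LBINT s:{u..x}. (s - u) powr (a - 1) * (x - s) powr (b - 1))
           = (x - u) powr (a + b - 1) * Beta a b" by (simp add: c_def)
qed

lemma powr_integral:
  assumes "p > -1" "u \<le> (x::real)"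
  shows "set_integrable lborel {u..x} (\<lambda>s. (s - u) powr p)"
    and "(LBINT s:{u..x}. (s - u) powr p) = (x - u) powr (p + 1) / (p + 1)"
    and "set_integrable lborel {u..x} (\<lambda>s. (x - s) powr p)"
    and "(LBINT s:{u..x}. (x - s) powr p) = (x - u) powr (p + 1) / (p + 1)"
proof -
  have 0: "((\<lambda>s. s powr p) has_integral ((x - u) powr (p + 1) / (p + 1))) {0..x - u}"
    using has_integral_powr_from_0[of p "x - u"] assms by simp
  have "((\<lambda>s. (s - u) powr p) has_integral ((x - u) powr (p + 1) / (p + 1))) {u..x}"
    using has_integral_affinity[OF 0[folded cbox_interval], of 1 "-u"] assms by (simp add: cbox_interval)
  from nonneg_has_integral_lborel[OF _ _ this]
  show "set_integrable lborel {u..x} (\<lambda>s. (s - u) powr p)"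
    and "(LBINT s:{u..x}. (s - u) powr p) = (x - u) powr (p + 1) / (p + 1)" by auto
  have "((\<lambda>s. (x - s) powr p) has_integral ((x - u) powr (p + 1) / (p + 1))) {u..x}"
    using has_integral_affinity[OF 0[folded cbox_interval], of "-1" x] assms by (simp add: cbox_interval)
  from nonneg_has_integral_lborel[OF _ _ this]
  show "set_integrable lborel {u..x} (\<lambda>s. (x - s) powr p)"
    and "(LBINT s:{u..x}. (x - s) powr p) = (x - u) powr (p + 1) / (p + 1)" by auto
qed

text \<open>All exchanges of the order of integration take place on the triangle 0 \<le> u \<le> s
  \<le> x. As \<open>k\<close> is nonnegative, integrating \<open>k s u * \<bar>f u\<bar>\<close>
  over \<open>s\<close> gives \<open>c u * \<bar>f u\<bar>\<close>, so integrability on the triangle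
  reduces to the one-variable condition \<open>cf\<close>. Only interior \<open>u\<close> are
  constrained, because the integral over \<open>s\<close> may diverge at u = 0.\<close>

lemma triangle_Fubini:
  fixes k :: "real \<Rightarrow> real \<Rightarrow> real" and f c :: "real \<Rightarrow> real"
  assumes [measurable]: "case_prod k \<in> borel_measurable (borel \<Otimes>\<^sub>M borel)" "f \<in> borel_measurable borel"
    and nonneg: "\<And>s u. 0 \<le> k s u"
    and int: "\<And>u. 0 < u \<Longrightarrow> u < x \<Longrightarrow> set_integrable lborel {u..x} (\<lambda>s. k s u)"
    and c: "\<And>u. 0 < u \<Longrightarrow> u < x \<Longrightarrow> (LBINT s:{u..x}. k s u) = c u"
    and cf: "set_integrable lborel {0..x} (\<lambda>u. c u * f u)"
  shows "AE s in lborel. s \<in> {0..x} \<longrightarrow> set_integrable lborel {0..s} (\<lambda>u. k s u * f u)"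
    and "set_integrable lborel {0..x} (\<lambda>s. LBINT u:{0..s}. k s u * f u)"
    and "(LBINT s:{0..x}. (LBINT u:{0..s}. k s u * f u)) = (LBINT u:{0..x}. c u * f u)"
proof -
  define G where "G u s = (if 0 \<le> u \<and> u \<le> s \<and> s \<le> x then k s u * f u else 0)" for u s
  have [measurable]: "case_prod G \<in> borel_measurable (lborel \<Otimes>\<^sub>M lborel)"
    unfolding G_def by measurable
  have AEx: "AE u in lborel. u \<noteq> 0 \<and> u \<noteq> x"
    using AE_lborel_singleton[of 0] AE_lborel_singleton[of x] by eventually_elim auto
  have Gs: "integrable lborel (\<lambda>s. G u s)
      \<and> (\<integral>s. G u s \<partial>lborel) = indicator {0..x} u * (c u * f u)
      \<and> (\<integral>s. norm (G u s) \<partial>lborel) = norm (indicator {0..x} u * (c u * f u))" if "u \<noteq> 0 \<and> u \<noteq> x" for u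
  proof (cases "0 < u \<and> u < x")
    case True
    have G: "G u = (\<lambda>s. indicator {u..x} s *\<^sub>R k s u * f u)"
      using True by (auto simp: G_def fun_eq_iff indicator_def)
    have nG: "(\<lambda>s. norm (G u s)) = (\<lambda>s. indicator {u..x} s *\<^sub>R k s u * \<bar>f u\<bar>)"
      using True nonneg by (auto simp: G_def fun_eq_iff indicator_def abs_mult)
    have i: "integrable lborel (\<lambda>s. indicator {u..x} s *\<^sub>R k s u)"
      using int[of u] True by (simp add: set_integrable_def)
    have ci: "(\<integral>s. indicator {u..x} s *\<^sub>R k s u \<partial>lborel) = c u"
      using c[of u] True by (simp add: set_lebesgue_integral_def)
    have "c u \<ge> 0" unfolding ci[symmetric] using nonneg by (intro integral_nonneg_AE) auto
    then have "(\<integral>s. norm (G u s) \<partial>lborel) = norm (indicator {0..x} u * (c u * f u))"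
      unfolding nG using ci i True by (simp add: abs_mult)
    moreover have "integrable lborel (G u)" unfolding G using i by (rule integrable_mult_left)
    moreover have "(\<integral>s. G u s \<partial>lborel) = indicator {0..x} u * (c u * f u)"
      unfolding G using ci i True by simp
    ultimately show ?thesis by simp
  next
    case False
    then have "G u = (\<lambda>s. 0)" using that by (auto simp: G_def fun_eq_iff)
    moreover have "indicator {0..x} u = (0::real)" using False that by auto
    ultimately show ?thesis by simp
  qed
  have cfi: "integrable lborel (\<lambda>u. indicator {0..x} u * (c u * f u))"
    using cf by (simp add: set_integrable_def)
  have "integrable (lborel \<Otimes>\<^sub>M lborel) (case_prod G)"
  proof (rule lborel_pair.Fubini_integrable)
    show "integrable lborel (\<lambda>u. \<integral>s. norm (case_prod G (u, s)) \<partial>lborel)"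
    proof (subst integrable_cong_AE)
      show "AE u in lborel. (\<integral>s. norm (case_prod G (u, s)) \<partial>lborel) = norm (indicator {0..x} u * (c u * f u))"
        using AEx by eventually_elim (use Gs in auto)
      show "(\<lambda>u. norm (indicator {0..x} u * (c u * f u))) \<in> borel_measurable lborel"
        using cfi by measurable
      show "integrable lborel (\<lambda>u. norm (indicator {0..x} u * (c u * f u)))"
        using cfi by (rule integrable_norm)
    qed measurable
    show "AE u in lborel. integrable lborel (\<lambda>s. case_prod G (u, s))"
      using AEx by eventually_elim (use Gs in auto)
  qed measurable
  note G = this
  have inner: "(\<lambda>u. G u s) = (\<lambda>u. indicator {0..x} s * (indicator {0..s} u *\<^sub>R (k s u * f u)))" for s
    by (auto simp: G_def fun_eq_iff indicator_def)
  have inner_int: "(\<integral>u. G u s \<partial>lborel) = indicator {0..x} s *\<^sub>R (LBINT u:{0..s}. k s u * f u)" for s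
    unfolding inner set_lebesgue_integral_def by simp
  show "AE s in lborel. s \<in> {0..x} \<longrightarrow> set_integrable lborel {0..s} (\<lambda>u. k s u * f u)"
    using lborel_pair.AE_integrable_snd[OF G] by eventually_elim (auto simp: inner set_integrable_def)
  show "set_integrable lborel {0..x} (\<lambda>s. LBINT u:{0..s}. k s u * f u)"
    using lborel_pair.integrable_snd[OF G] unfolding inner_int set_integrable_def .
  have "(LBINT s:{0..x}. (LBINT u:{0..s}. k s u * f u)) = (\<integral>s. (\<integral>u. G u s \<partial>lborel) \<partial>lborel)"
    unfolding inner_int by (simp add: set_lebesgue_integral_def)
  also have "\<dots> = (\<integral>u. (\<integral>s. G u s \<partial>lborel) \<partial>lborel)"
    by (rule lborel_pair.Fubini_integral[OF G])
  also have "\<dots> = (\<integral>u. indicator {0..x} u * (c u * f u) \<partial>lborel)"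
  proof (rule integral_cong_AE)
    show "AE u in lborel. (\<integral>s. G u s \<partial>lborel) = indicator {0..x} u * (c u * f u)"
      using AEx by eventually_elim (use Gs in auto)
  qed (use cfi in measurable)
  finally show "(LBINT s:{0..x}. (LBINT u:{0..s}. k s u * f u)) = (LBINT u:{0..x}. c u * f u)"
    by (simp add: set_lebesgue_integral_def)
qed

text \<open>The positive and the negative part of the function are densities of two finite measures
  with the same distribution function. A finite Borel measure is determined by its distribution
  function, and a density by its measure up to null sets.\<close>

lemma AE_eq_0_if_integrals_eq_0:
  fixes f :: "real \<Rightarrow> real"
  assumes f: "set_integrable lborel {0..T} f"
    and zero: "\<And>x. x \<in> {0..T} \<Longrightarrow> (LBINT s:{0..x}. f s) = 0"
  shows "AE s in lborel. s \<in> {0..T} \<longrightarrow> f s = 0"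
proof -
  define h where "h s = indicator {0..T} s * f s" for s
  have h: "integrable lborel h" using f unfolding h_def set_integrable_def by simp
  then have [measurable]: "h \<in> borel_measurable borel" by simp
  have hz: "(LBINT s:{..x}. h s) = 0" for x
  proof (cases "T < 0")
    case True then show ?thesis by (simp add: h_def set_lebesgue_integral_def)
  next
    case False
    consider "x < 0" | "x \<in> {0..T}" | "x > T" using False by force
    then show ?thesis
    proof cases
      case 1
      have "(\<lambda>s. indicator {..x} s *\<^sub>R h s) = (\<lambda>_. 0)" using 1 by (auto simp: h_def indicator_def fun_eq_iff)
      then show ?thesis by (simp add: set_lebesgue_integral_def)
    next
      case 2
      then have "(\<lambda>s. indicator {..x} s *\<^sub>R h s) = (\<lambda>s. indicator {0..x} s *\<^sub>R f s)"
        by (auto simp: h_def indicator_def fun_eq_iff)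
      then show ?thesis using zero[OF 2] by (simp add: set_lebesgue_integral_def)
    next
      case 3
      then have "(\<lambda>s. indicator {..x} s *\<^sub>R h s) = (\<lambda>s. indicator {0..T} s *\<^sub>R f s)"
        by (auto simp: h_def indicator_def fun_eq_iff)
      then show ?thesis using zero[of T] False by (simp add: set_lebesgue_integral_def)
    qed
  qed
  \<comment> \<open>\<open>ennreal\<close> sends negative reals to 0, so these densities are the
    positive and the negative part of \<open>h\<close>.\<close>
  define M1 where "M1 = density lborel (\<lambda>s. ennreal (h s))"
  define M2 where "M2 = density lborel (\<lambda>s. ennreal (- h s))"
  have ip: "integrable lborel (\<lambda>s. max 0 (h s))" and im: "integrable lborel (\<lambda>s. max 0 (- h s))"
    using h by (auto intro!: integrable_max)
  have e: "ennreal (h s) = ennreal (max 0 (h s))" "ennreal (- h s) = ennreal (max 0 (- h s))" for s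
    by (auto simp: max_def ennreal_neg)
  have M1: "emeasure M1 A = ennreal (LBINT s:A. max 0 (h s))"
    and M2: "emeasure M2 A = ennreal (LBINT s:A. max 0 (- h s))" if [measurable]: "A \<in> sets borel" for A
  proof -
    have *: "(\<integral>\<^sup>+ x. ennreal (g x) * indicator A x \<partial>lborel) = ennreal (LBINT s:A. g s)"
      if "integrable lborel g" "\<And>x. 0 \<le> g x" for g :: "real \<Rightarrow> real"
      using that integrable_mult_indicator[of A lborel g]
      by (subst nn_integral_set_ennreal, subst nn_integral_eq_integral)
         (auto simp: set_lebesgue_integral_def mult.commute)
    show "emeasure M1 A = ennreal (LBINT s:A. max 0 (h s))"
      unfolding M1_def e by (subst emeasure_density) (use *[OF ip] in auto)
    show "emeasure M2 A = ennreal (LBINT s:A. max 0 (- h s))"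
      unfolding M2_def e by (subst emeasure_density) (use *[OF im] in auto)
  qed
  have "M1 = M2"
  proof (rule cdf_unique')
    have [simp]: "sets M1 = sets borel" "sets M2 = sets borel" "space M1 = UNIV" "space M2 = UNIV"
      by (simp_all add: M1_def M2_def)
    show "finite_borel_measure M1" "finite_borel_measure M2"
      unfolding finite_borel_measure_def finite_borel_measure_axioms_def
      by (auto intro!: finite_measureI simp: M1 M2)
    have "(LBINT s:{..x}. max 0 (h s)) - (LBINT s:{..x}. max 0 (- h s)) = (LBINT s:{..x}. h s)" for x
    proof -
      have "(LBINT s:{..x}. max 0 (h s)) - (LBINT s:{..x}. max 0 (- h s))
         = (LBINT s:{..x}. max 0 (h s) - max 0 (- h s))"
        using ip im by (subst set_integral_diff) (auto simp: set_integrable_def intro!: integrable_mult_indicator[where 'b = real, simplified])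
      also have "\<dots> = (LBINT s:{..x}. h s)" by (rule set_lebesgue_integral_cong) (auto simp: max_def)
      finally show ?thesis .
    qed
    with hz have "(LBINT s:{..x}. max 0 (h s)) = (LBINT s:{..x}. max 0 (- h s))" for x
      by (metis eq_iff_diff_eq_0)
    then show "cdf M1 = cdf M2"
      by (simp add: cdf_def fun_eq_iff measure_def M1 M2)
  qed
  then have "AE s in lborel. ennreal (h s) = ennreal (- h s)"
    unfolding M1_def M2_def by (subst (asm) sigma_finite_measure.density_unique_iff[OF sigma_finite_lborel]) auto
  then show ?thesis
  proof eventually_elim
    case (elim s)
    then have "h s = 0" by (cases "h s \<ge> 0") (auto simp: ennreal_neg ennreal_eq_0_iff)
    then show ?case by (auto simp: h_def)
  qed
qed

section \<open>Abel transforms and the Volterra operator\<close>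

lemma powr_integral_from_0:
  assumes "p > -1" "0 \<le> (x::real)"
  shows "set_integrable lborel {0..x} (\<lambda>s. s powr p)"
    and "(LBINT s:{0..x}. s powr p) = x powr (p + 1) / (p + 1)"
  using powr_integral(1,2)[OF assms] by auto

lemma set_integrable_dominated:
  fixes f g :: "real \<Rightarrow> real"
  assumes "set_integrable lborel A f" and [measurable]: "g \<in> borel_measurable borel" "A \<in> sets borel"
    and "\<And>s. s \<in> A \<Longrightarrow> \<bar>g s\<bar> \<le> f s"
  shows "set_integrable lborel A g"
proof (rule set_integrable_bound[OF assms(1)])
  show "set_borel_measurable lborel A g"
    unfolding set_borel_measurable_def by measurable
  show "AE x in lborel. x \<in> A \<longrightarrow> norm (g x) \<le> norm (f x)"
    using assms(4) by (force intro!: AE_I2)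
qed

lemma abs_mult_le_squares: "\<bar>x * y\<bar> \<le> x\<^sup>2 + (y::real)\<^sup>2"
proof -
  have "2 * (\<bar>x\<bar> * \<bar>y\<bar>) \<le> x\<^sup>2 + y\<^sup>2"
    using sum_squares_bound[of "\<bar>x\<bar>" "\<bar>y\<bar>"] by simp
  moreover have "0 \<le> \<bar>x\<bar> * \<bar>y\<bar>" by simp
  ultimately show ?thesis by (simp only: abs_mult)
qed

text \<open>For \<gamma> < 1/2 the power s powr (- \<gamma>) is square integrable at 0, so this is a
  product of two L2 functions; the bound \<bar>x y\<bar> \<le> x^2 + y^2 suffices.\<close>

lemma L2_powr_integrable:
  fixes f :: "real \<Rightarrow> real"
  assumes [measurable]: "f \<in> borel_measurable borel"
    and f2: "set_integrable lborel {0..x} (\<lambda>s. (f s)\<^sup>2)" and "\<gamma> < 1 / 2"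
  shows "set_integrable lborel {0..x} (\<lambda>s. s powr (- \<gamma>) * f s)"
proof (cases "0 \<le> x")
  case True
  have p: "set_integrable lborel {0..x} (\<lambda>s. s powr (- 2 * \<gamma>))"
    using assms True by (intro powr_integral_from_0) auto
  show ?thesis
  proof (rule set_integrable_dominated[OF set_integral_add(1)[OF p f2]])
    fix s
    have "\<bar>s powr - \<gamma> * f s\<bar> \<le> (s powr - \<gamma>)\<^sup>2 + (f s)\<^sup>2"
      by (rule abs_mult_le_squares)
    then show "\<bar>s powr - \<gamma> * f s\<bar> \<le> s powr (- 2 * \<gamma>) + (f s)\<^sup>2"
      by (simp add: power2_eq_square powr_add[symmetric])
  qed simp_all
qed simp

lemma L2_powr_integrable_right:
  fixes f :: "real \<Rightarrow> real"
  assumes [measurable]: "f \<in> borel_measurable borel"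
    and f2: "set_integrable lborel {0..x} (\<lambda>s. (f s)\<^sup>2)" and "\<gamma> < 1 / 2"
  shows "set_integrable lborel {0..x} (\<lambda>s. (x - s) powr (- \<gamma>) * f s)"
proof (cases "0 \<le> x")
  case True
  have p: "set_integrable lborel {0..x} (\<lambda>s. (x - s) powr (- 2 * \<gamma>))"
    using assms True by (intro powr_integral) auto
  show ?thesis
  proof (rule set_integrable_dominated[OF set_integral_add(1)[OF p f2]])
    fix s
    have "\<bar>(x - s) powr - \<gamma> * f s\<bar> \<le> ((x - s) powr - \<gamma>)\<^sup>2 + (f s)\<^sup>2"
      by (rule abs_mult_le_squares)
    then show "\<bar>(x - s) powr - \<gamma> * f s\<bar> \<le> (x - s) powr (- 2 * \<gamma>) + (f s)\<^sup>2"
      by (simp add: power2_eq_square powr_add[symmetric])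
  qed simp_all
qed simp

text \<open>The Riemann-Liouville fractional integral of order \<open>a\<close> without the factor 1
  / Gamma(a); composition rules therefore carry values of \<open>Beta\<close>.\<close>

definition abel :: "real \<Rightarrow> (real \<Rightarrow> real) \<Rightarrow> real \<Rightarrow> real" where
  "abel a f x = (LBINT u:{0..x}. (x - u) powr (a - 1) * f u)"

lemma borel_measurable_abel [measurable]:
  assumes [measurable]: "f \<in> borel_measurable borel"
  shows "abel a f \<in> borel_measurable borel"
proof -
  have "(\<lambda>x. \<integral>u. (if 0 \<le> u \<and> u \<le> x then (x - u) powr (a - 1) * f u else 0) \<partial>lborel) \<in> borel_measurable borel"
    by measurable
  also have "(\<lambda>x. \<integral>u. (if 0 \<le> u \<and> u \<le> x then (x - u) powr (a - 1) * f u else 0) \<partial>lborel) = abel a f"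
    unfolding abel_def set_lebesgue_integral_def fun_eq_iff
    by (intro allI Bochner_Integration.integral_cong) (auto simp: indicator_def)
  finally show ?thesis .
qed

lemma abel_integrable:
  assumes [measurable]: "f \<in> borel_measurable borel" and f: "set_integrable lborel {0..x} f" and "a > 0"
  shows "set_integrable lborel {0..x} (abel a f)"
proof -
  have "set_integrable lborel {0..x} (\<lambda>s. LBINT u:{0..s}. (s - u) powr (a - 1) * f u)"
  proof (rule triangle_Fubini(2))
    fix u assume "0 < u" "u < x"
    then show "set_integrable lborel {u..x} (\<lambda>s. (s - u) powr (a - 1))"
      and "(LBINT s:{u..x}. (s - u) powr (a - 1)) = (x - u) powr a / a"
      using powr_integral(1,2)[of "a - 1" u x] assms by auto
  next
    show "set_integrable lborel {0..x} (\<lambda>u. (x - u) powr a / a * f u)"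
    proof (rule set_integrable_dominated[OF set_integrable_mult_right[OF set_integrable_abs[OF f]]])
      fix u assume u: "u \<in> {0..x}"
      then have "(x - u) powr a \<le> x powr a" using assms by (intro powr_mono2) auto
      then show "\<bar>(x - u) powr a / a * f u\<bar> \<le> x powr a / a * \<bar>f u\<bar>"
        using \<open>a > 0\<close> by (simp add: abs_mult divide_right_mono mult_right_mono)
    qed simp_all
  qed simp_all
  then show ?thesis by (simp add: abel_def[abs_def])
qed

text \<open>For fixed \<open>u\<close> the integral of (s - u) powr (a - 1) * (x - s) powr (- a)
  over \<open>{u..x}\<close> is a Beta integral in which x - u has exponent 0. After exchanging the
  order, only this constant remains in front of \<open>f u\<close>.\<close>

lemma abel_abel:
  assumes [measurable]: "f \<in> borel_measurable borel" and f: "set_integrable lborel {0..x} f"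
    and a: "0 < a" "a < 1"
  shows "set_integrable lborel {0..x} (\<lambda>s. (x - s) powr (- a) * abel a f s)"
    and "abel (1 - a) (abel a f) x = Beta a (1 - a) * (LBINT u:{0..x}. f u)"
proof -
  define k where "k s u = (s - u) powr (a - 1) * (x - s) powr (- a)" for s u
  have 1: "case_prod k \<in> borel_measurable (borel \<Otimes>\<^sub>M borel)"
    unfolding k_def by measurable
  have 3: "0 \<le> k s u" for s u by (simp add: k_def)
  have 4: "set_integrable lborel {u..x} (\<lambda>s. k s u)" "(LBINT s:{u..x}. k s u) = Beta a (1 - a)"
    if "0 < u" "u < x" for u
    using Beta_integral_scaled[of a "1 - a" u x] a that by (auto simp: k_def)
  have 5: "set_integrable lborel {0..x} (\<lambda>u. Beta a (1 - a) * f u)" using f by simp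
  have inner: "(LBINT u:{0..s}. k s u * f u) = (x - s) powr (- a) * abel a f s" for s
    unfolding abel_def set_integral_mult_right[symmetric] k_def by (simp add: mult_ac)
  show "set_integrable lborel {0..x} (\<lambda>s. (x - s) powr (- a) * abel a f s)"
    using triangle_Fubini(2)[OF 1 assms(1) 3 4 5] by (simp add: inner)
  show "abel (1 - a) (abel a f) x = Beta a (1 - a) * (LBINT u:{0..x}. f u)"
    using triangle_Fubini(3)[OF 1 assms(1) 3 4 5] by (simp add: inner abel_def[of "1 - a"])
qed

lemma Beta_pos:
  assumes "a > 0" "b > (0::real)"
  shows "Beta a b > 0"
  using assms by (simp add: Beta_def Gamma_real_pos)

lemma abel_cong_AE:
  assumes [measurable]: "f \<in> borel_measurable borel" "g \<in> borel_measurable borel"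
    and "AE u in lborel. u \<in> {0..x} \<longrightarrow> f u = g u"
  shows "abel a f x = abel a g x"
  unfolding abel_def
  by (rule set_lebesgue_integral_cong_AE) (use assms(3) in auto)

text \<open>Applying the transform of the complementary order 1 - a turns the hypothesis into the
  vanishing of all primitives of \<open>f\<close>.\<close>

lemma AE_eq_0_if_abel_eq_0:
  assumes [measurable]: "f \<in> borel_measurable borel" and f: "set_integrable lborel {0..T} f"
    and a: "0 < a" "a < 1" and zero: "AE s in lborel. s \<in> {0..T} \<longrightarrow> abel a f s = 0"
  shows "AE s in lborel. s \<in> {0..T} \<longrightarrow> f s = 0"
proof (rule AE_eq_0_if_integrals_eq_0[OF f])
  fix x assume x: "x \<in> {0..T}"
  have "abel (1 - a) (abel a f) x = abel (1 - a) (\<lambda>_. 0) x"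
    by (rule abel_cong_AE) (use zero x in auto)
  also have "\<dots> = 0" by (simp add: abel_def)
  finally have "Beta a (1 - a) * (LBINT u:{0..x}. f u) = 0"
    using abel_abel(2)[of f x a] set_integrable_subset[OF f, of "{0..x}"] a x by auto
  then show "(LBINT u:{0..x}. f u) = 0" using Beta_pos[of a "1 - a"] a by auto
qed

section \<open>Factorisation and injectivity of the Volterra operator\<close>

lemma volterra_const_pos:
  assumes "0 < H" "H < 1" "H \<noteq> 1 / 2"
  shows "volterra_const H > 0"
  using assms Beta_pos[of "2 - 2 * H" "H - 1 / 2"] Beta_pos[of "1 - 2 * H" "H + 1 / 2"]
  by (auto simp: volterra_const_def)

text \<open>For H > 1/2 the kernel is itself an integral over \<open>u\<close> between
  \<open>s\<close> and \<open>t\<close>. Exchanging the order splits the operator into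
  multiplication by a power, an Abel transform, another multiplication and a primitive, each of
  which can be undone.\<close>

lemma K_op_gt:
  fixes f :: "real \<Rightarrow> real"
  assumes [measurable]: "f \<in> borel_measurable borel"
    and f2: "set_integrable lborel {0..t} (\<lambda>s. (f s)\<^sup>2)"
    and H: "H = \<alpha> + 1 / 2" "0 < \<alpha>" "\<alpha> < 1 / 2" and t: "0 \<le> t"
  shows "set_integrable lborel {0..t} (\<lambda>s. volterra_kernel H t s * f s)"
    and "K_op H f t = volterra_const H * (LBINT u:{0..t}. u powr \<alpha> * abel \<alpha> (\<lambda>s. s powr (- \<alpha>) * f s) u)"
proof -
  define k where "k u s = (u - s) powr (\<alpha> - 1) * u powr \<alpha>" for u s :: real
  define h where "h s = s powr (- \<alpha>) * f s" for s
  define c where "c s = (LBINT u:{s..t}. k u s)" for s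
  have [measurable]: "case_prod k \<in> borel_measurable (borel \<Otimes>\<^sub>M borel)"
    unfolding k_def by measurable
  have h_meas[measurable]: "h \<in> borel_measurable borel" unfolding h_def by measurable
  have [measurable]: "c \<in> borel_measurable borel"
  proof -
    have "(\<lambda>s. \<integral>u. (if s \<le> u \<and> u \<le> t then (u - s) powr (\<alpha> - 1) * u powr \<alpha> else 0) \<partial>lborel) \<in> borel_measurable borel"
      by measurable
    also have "(\<lambda>s. \<integral>u. (if s \<le> u \<and> u \<le> t then (u - s) powr (\<alpha> - 1) * u powr \<alpha> else 0) \<partial>lborel) = c"
      unfolding c_def set_lebesgue_integral_def fun_eq_iff k_def
      by (intro allI Bochner_Integration.integral_cong) (auto simp: indicator_def)
    finally show ?thesis .
  qed
  have kb: "0 \<le> k u s" "k u s \<le> t powr \<alpha> * (u - s) powr (\<alpha> - 1)" if "u \<in> {s..t}" "0 \<le> s" for u s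
    using that H powr_mono2[of \<alpha> u t] by (auto simp: k_def mult.commute mult_right_mono)
  have ki: "set_integrable lborel {s..t} (\<lambda>u. k u s)" if "0 \<le> s" "s \<le> t" for s
  proof (rule set_integrable_dominated[OF set_integrable_mult_right[OF powr_integral(1)[of "\<alpha> - 1" s t]]])
    fix u assume "u \<in> {s..t}"
    then show "\<bar>k u s\<bar> \<le> t powr \<alpha> * (u - s) powr (\<alpha> - 1)" using kb[of u s] that by simp
  qed (use H that in \<open>auto simp: k_def\<close>)
  have cb: "\<bar>c s\<bar> \<le> t powr \<alpha> * (t powr \<alpha> / \<alpha>)" if "s \<in> {0..t}" for s
  proof -
    have "c s \<ge> 0" unfolding c_def set_lebesgue_integral_def k_def
      by (intro integral_nonneg_AE) (auto simp: indicator_def)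
    moreover have "c s \<le> (LBINT u:{s..t}. t powr \<alpha> * (u - s) powr (\<alpha> - 1))"
      unfolding c_def using that H kb
      by (intro set_integral_mono ki set_integrable_mult_right powr_integral) auto
    moreover have "\<dots> = t powr \<alpha> * ((t - s) powr \<alpha> / \<alpha>)"
      using powr_integral(2)[of "\<alpha> - 1" s t] H that by simp
    moreover have "\<dots> \<le> t powr \<alpha> * (t powr \<alpha> / \<alpha>)"
      using that H by (intro mult_left_mono divide_right_mono powr_mono2) auto
    ultimately show ?thesis by linarith
  qed
  have hi: "set_integrable lborel {0..t} h"
    unfolding h_def using H by (intro L2_powr_integrable f2) auto
  have ch: "set_integrable lborel {0..t} (\<lambda>s. c s * h s)"
  proof (rule set_integrable_dominated[OF set_integrable_mult_right[OF set_integrable_abs[OF hi]]])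
    fix s assume "s \<in> {0..t}"
    from cb[OF this] show "\<bar>c s * h s\<bar> \<le> t powr \<alpha> * (t powr \<alpha> / \<alpha>) * \<bar>h s\<bar>"
      unfolding abs_mult by (rule mult_right_mono) simp
  qed simp_all
  have ker: "volterra_kernel H t s * f s = volterra_const H * (c s * h s)" if "s \<in> {0..t}" for s
  proof -
    \<comment> \<open>Both sides vanish at the endpoints: the kernel by definition,
      \<open>h 0\<close> because \<open>0 powr x = 0\<close>, and \<open>c t\<close> because its
      interval is a point.\<close>
    have "(LBINT u:{t..t}. k u t) = 0" by (simp add: set_integral_at_point k_def)
    then show ?thesis
      using that H by (cases "s = 0 \<or> s = t") (auto simp: volterra_kernel_def c_def h_def k_def mult_ac)
  qed
  have "set_integrable lborel {0..t} (\<lambda>s. volterra_const H * (c s * h s))" using ch by simp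
  then show "set_integrable lborel {0..t} (\<lambda>s. volterra_kernel H t s * f s)"
    by (subst set_integrable_cong[OF refl refl ker]) auto
  have inner: "(LBINT s:{0..u}. k u s * h s) = u powr \<alpha> * abel \<alpha> h u" for u
    unfolding abel_def set_integral_mult_right[symmetric] k_def by (simp add: mult_ac)
  have "K_op H f t = (LBINT s:{0..t}. volterra_const H * (c s * h s))"
    unfolding K_op_def by (rule set_lebesgue_integral_cong) (use ker in auto)
  also have "\<dots> = volterra_const H * (LBINT s:{0..t}. c s * h s)" by simp
  also have "(LBINT s:{0..t}. c s * h s) = (LBINT u:{0..t}. (LBINT s:{0..u}. k u s * h s))"
    by (rule triangle_Fubini(3)[symmetric]) (use ki ch in \<open>auto simp: c_def k_def\<close>)
  also have "\<dots> = (LBINT u:{0..t}. u powr \<alpha> * abel \<alpha> h u)"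
    unfolding inner ..
  finally show "K_op H f t = volterra_const H * (LBINT u:{0..t}. u powr \<alpha> * abel \<alpha> (\<lambda>s. s powr (- \<alpha>) * f s) u)"
    unfolding h_def .
qed

text \<open>For H < 1/2 the kernel is a boundary term plus an integral over \<open>u\<close> between
  \<open>s\<close> and \<open>t\<close>. Both lead to the same Abel transform \<open>J\<close>, the
  second one after exchanging the order, so that \<open>K_op\<close> becomes a first-order
  expression in the primitive of u powr (- \<beta> - 1) * J u.\<close>

lemma K_op_lt:
  fixes f :: "real \<Rightarrow> real"
  assumes [measurable]: "f \<in> borel_measurable borel"
    and f2: "set_integrable lborel {0..t} (\<lambda>s. (f s)\<^sup>2)"
    and H: "H = 1 / 2 - \<beta>" "0 < \<beta>" "\<beta> < 1 / 2" and t: "0 \<le> t"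
  defines "J \<equiv> abel (1 - \<beta>) (\<lambda>s. s powr \<beta> * f s)"
  shows "set_integrable lborel {0..t} (\<lambda>s. volterra_kernel H t s * f s)"
    and "set_integrable lborel {0..t} (\<lambda>u. u powr (- \<beta> - 1) * J u)"
    and "K_op H f t = volterra_const H
           * (t powr (- \<beta>) * J t + \<beta> * (LBINT u:{0..t}. u powr (- \<beta> - 1) * J u))"
proof -
  define k where "k u s = u powr (- \<beta> - 1) * (u - s) powr (- \<beta>)" for u s :: real
  define h where "h s = s powr \<beta> * f s" for s
  define c where "c s = (LBINT u:{s..t}. k u s)" for s
  have k_meas[measurable]: "case_prod k \<in> borel_measurable (borel \<Otimes>\<^sub>M borel)"
    unfolding k_def by measurable
  have h_meas[measurable]: "h \<in> borel_measurable borel" unfolding h_def by measurable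
  have [measurable]: "c \<in> borel_measurable borel"
  proof -
    have "(\<lambda>s. \<integral>u. (if s \<le> u \<and> u \<le> t then k u s else 0) \<partial>lborel) \<in> borel_measurable borel"
      by measurable
    also have "(\<lambda>s. \<integral>u. (if s \<le> u \<and> u \<le> t then k u s else 0) \<partial>lborel) = c"
      unfolding c_def set_lebesgue_integral_def fun_eq_iff
      by (intro allI Bochner_Integration.integral_cong) (auto simp: indicator_def)
    finally show ?thesis .
  qed
  \<comment> \<open>The singularities at u = s and at s = 0 compete. Moving s powr (- 2 * \<beta> -
    \<delta>) out of the kernel leaves (u - s) powr (\<delta> - 1), integrable because \<delta> > 0;
    together with the factor s powr \<beta> of \<open>h\<close> it gives s powr (- (\<beta> +
    \<delta>)), square integrable because \<beta> + \<delta> < 1/2. Any such \<delta> works; this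
    one is half the available room.\<close>
  define \<delta> where "\<delta> = (1 / 2 - \<beta>) / 2"
  have \<delta>: "0 < \<delta>" "\<beta> + \<delta> < 1 / 2" using H by (auto simp: \<delta>_def field_simps)
  have k0: "0 \<le> k u s" for u s by (simp add: k_def)
  have kb: "k u s \<le> s powr (- 2 * \<beta> - \<delta>) * (u - s) powr (\<delta> - 1)" if "u \<in> {s..t}" "0 < s" for u s
  proof (cases "u = s")
    case False
    have "u powr (- \<beta> - 1) = u powr (- 2 * \<beta> - \<delta>) * u powr (\<beta> + \<delta> - 1)"
      by (simp add: powr_add[symmetric])
    also have "\<dots> \<le> s powr (- 2 * \<beta> - \<delta>) * (u - s) powr (\<beta> + \<delta> - 1)"
      using that False H \<delta> by (intro mult_mono powr_mono2') auto
    finally have "k u s \<le> s powr (- 2 * \<beta> - \<delta>) * (u - s) powr (\<beta> + \<delta> - 1) * (u - s) powr (- \<beta>)"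
      unfolding k_def by (intro mult_right_mono) auto
    then show ?thesis by (simp add: mult.assoc powr_add[symmetric])
  qed (simp add: k_def)
  have ki: "set_integrable lborel {s..t} (\<lambda>u. k u s)" if "0 < s" "s \<le> t" for s
  proof (rule set_integrable_dominated[OF set_integrable_mult_right[OF powr_integral(1)[of "\<delta> - 1" s t]]])
    fix u assume "u \<in> {s..t}"
    then show "\<bar>k u s\<bar> \<le> s powr (- 2 * \<beta> - \<delta>) * (u - s) powr (\<delta> - 1)" using kb[of u s] k0[of u s] that by simp
  qed (use \<delta> that in \<open>auto\<close>)
  have cb: "\<bar>c s\<bar> \<le> s powr (- 2 * \<beta> - \<delta>) * (t powr \<delta> / \<delta>)" if "0 < s" "s \<le> t" for s
  proof -
    have "c s \<ge> 0" unfolding c_def set_lebesgue_integral_def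
      by (intro integral_nonneg_AE) (auto simp: k0)
    moreover have "c s \<le> (LBINT u:{s..t}. s powr (- 2 * \<beta> - \<delta>) * (u - s) powr (\<delta> - 1))"
      unfolding c_def using that \<delta> kb
      by (intro set_integral_mono ki set_integrable_mult_right powr_integral) auto
    moreover have "\<dots> = s powr (- 2 * \<beta> - \<delta>) * ((t - s) powr \<delta> / \<delta>)"
      using powr_integral(2)[of "\<delta> - 1" s t] \<delta> that by simp
    moreover have "\<dots> \<le> s powr (- 2 * \<beta> - \<delta>) * (t powr \<delta> / \<delta>)"
      using that \<delta> by (intro mult_left_mono divide_right_mono powr_mono2) auto
    ultimately show ?thesis by linarith
  qed
  have fi: "set_integrable lborel {0..t} (\<lambda>s. s powr - (\<beta> + \<delta>) * f s)"
    by (intro L2_powr_integrable f2 \<delta>) auto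
  have ch: "set_integrable lborel {0..t} (\<lambda>s. c s * h s)"
  proof (rule set_integrable_dominated[OF set_integrable_mult_right[OF set_integrable_abs[OF fi]]])
    fix s assume s: "s \<in> {0..t}"
    show "\<bar>c s * h s\<bar> \<le> t powr \<delta> / \<delta> * \<bar>s powr - (\<beta> + \<delta>) * f s\<bar>"
    proof (cases "s = 0")
      case False
      have "\<bar>c s * h s\<bar> \<le> s powr (- 2 * \<beta> - \<delta>) * (t powr \<delta> / \<delta>) * \<bar>h s\<bar>"
        unfolding abs_mult by (intro mult_right_mono cb) (use s False in auto)
      also have "\<dots> = t powr \<delta> / \<delta> * ((s powr (- 2 * \<beta> - \<delta>) * s powr \<beta>) * \<bar>f s\<bar>)"
        by (simp add: h_def abs_mult)
      also have "s powr (- 2 * \<beta> - \<delta>) * s powr \<beta> = s powr - (\<beta> + \<delta>)"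
        by (simp add: powr_add[symmetric])
      finally show ?thesis by (simp add: abs_mult)
    qed (simp add: h_def)
  qed simp_all
  have h2: "set_integrable lborel {0..t} (\<lambda>s. (h s)\<^sup>2)"
  proof (rule set_integrable_dominated[OF set_integrable_mult_right[OF f2]])
    fix s assume "s \<in> {0..t}"
    then have "(s powr \<beta>)\<^sup>2 \<le> (t powr \<beta>)\<^sup>2" using H by (intro power_mono powr_mono2) auto
    then show "\<bar>(h s)\<^sup>2\<bar> \<le> (t powr \<beta>)\<^sup>2 * (f s)\<^sup>2"
      by (simp add: h_def power_mult_distrib mult_right_mono)
  qed simp_all
  have th: "set_integrable lborel {0..t} (\<lambda>s. (t - s) powr (- \<beta>) * h s)"
    by (intro L2_powr_integrable_right h2 H) auto
  have ker: "volterra_kernel H t s * f s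
      = volterra_const H * (t powr (- \<beta>) * ((t - s) powr (- \<beta>) * h s) + \<beta> * (c s * h s))"
    if "s \<in> {0..t}" for s
  proof (cases "s = 0 \<or> s = t")
    case True
    have "(LBINT u:{t..t}. k u t) = 0" by (simp add: set_integral_at_point k_def)
    with True show ?thesis by (auto simp: volterra_kernel_def h_def c_def)
  next
    case False
    then have "0 < s" "s < t" using that by auto
    moreover have "(t / s) powr (- \<beta>) = t powr (- \<beta>) * s powr \<beta>"
      using \<open>0 < s\<close> \<open>s < t\<close> by (simp add: powr_divide powr_minus field_simps)
    moreover have "H - 1 / 2 = - \<beta>" "1 / 2 - H = \<beta>" "H - 3 / 2 = - \<beta> - 1" "\<not> H > 1 / 2" "H \<noteq> 1 / 2"
      using H by auto
    ultimately show ?thesis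
      unfolding volterra_kernel_def h_def c_def k_def
      by (simp only: if_False if_True not_True_eq_False not_False_eq_True simp_thms) (simp add: algebra_simps)
  qed
  have J: "J = abel (1 - \<beta>) h" by (simp add: J_def h_def[abs_def])
  have "set_integrable lborel {0..t} (\<lambda>s. volterra_const H * (t powr (- \<beta>) * ((t - s) powr (- \<beta>) * h s) + \<beta> * (c s * h s)))"
    by (intro set_integrable_mult_right set_integral_add(1) th ch)
  then show "set_integrable lborel {0..t} (\<lambda>s. volterra_kernel H t s * f s)"
    by (subst set_integrable_cong[OF refl refl ker]) auto
  have inner: "(LBINT s:{0..u}. k u s * h s) = u powr (- \<beta> - 1) * J u" for u
    unfolding J abel_def set_integral_mult_right[symmetric] k_def by (simp add: mult_ac)
  have ki': "set_integrable lborel {s..t} (\<lambda>u. k u s)" "(LBINT u:{s..t}. k u s) = c s" if "0 < s" "s < t" for s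
    using ki[of s] that by (auto simp: c_def)
  show "set_integrable lborel {0..t} (\<lambda>u. u powr (- \<beta> - 1) * J u)"
    using triangle_Fubini(2)[OF k_meas h_meas k0 ki' ch] by (simp add: inner)
  have "K_op H f t = (LBINT s:{0..t}. volterra_const H * (t powr (- \<beta>) * ((t - s) powr (- \<beta>) * h s) + \<beta> * (c s * h s)))"
    unfolding K_op_def by (rule set_lebesgue_integral_cong) (use ker in auto)
  also have "\<dots> = volterra_const H * (t powr (- \<beta>) * (LBINT s:{0..t}. (t - s) powr (- \<beta>) * h s) + \<beta> * (LBINT s:{0..t}. c s * h s))"
    using th ch by (simp add: set_integral_add)
  also have "(LBINT s:{0..t}. (t - s) powr (- \<beta>) * h s) = J t"
    by (simp add: J abel_def)
  also have "(LBINT s:{0..t}. c s * h s) = (LBINT u:{0..t}. u powr (- \<beta> - 1) * J u)"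
    using triangle_Fubini(3)[OF k_meas h_meas k0 ki' ch] by (simp add: inner)
  finally show "K_op H f t = volterra_const H
           * (t powr (- \<beta>) * J t + \<beta> * (LBINT u:{0..t}. u powr (- \<beta> - 1) * J u))" .
qed

text \<open>With \<open>z t = \<integral>\<^sub>0\<^sup>t u powr (- \<beta> - 1) * J u du\<close> the equation reads \<open>t * z' t = - \<beta> * z t\<close>, so
  \<open>t powr \<beta> * z t\<close> is constant.\<close>

lemma homogeneous_solution_eq_0:
  fixes J :: "real \<Rightarrow> real"
  assumes "\<beta> > 0" and p_int: "set_integrable lborel {0..T} (\<lambda>u. u powr (- \<beta> - 1) * J u)"
    and eq: "\<And>t. t \<in> {0..T} \<Longrightarrow> t powr (- \<beta>) * J t + \<beta> * (LBINT u:{0..t}. u powr (- \<beta> - 1) * J u) = 0"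
    and t: "0 < t" "t \<le> T"
  shows "J t = 0"
proof -
  define p where "p u = u powr (- \<beta> - 1) * J u" for u
  define z where "z t = integral {0..t} p" for t
  have p: "p integrable_on {0..T}"
    using set_borel_integral_eq_integral(1)[OF p_int] by (simp add: p_def[abs_def])
  have z_cont: "continuous_on {0..T} z"
    unfolding z_def by (rule indefinite_integral_continuous_1[OF p])
  have z_eq: "(LBINT u:{0..t}. u powr (- \<beta> - 1) * J u) = z t" if "t \<in> {0..T}" for t
    using set_borel_integral_eq_integral(2)[OF set_integrable_subset[OF p_int, of "{0..t}"]] that
    by (simp add: z_def p_def[abs_def])
  have p_eq: "p u = - \<beta> * z u / u" if "u \<in> {0<..T}" for u
  proof -
    have "p u = u powr (- \<beta>) * J u / u"
      using that by (simp add: p_def powr_diff)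
    then show ?thesis using eq[of u] z_eq[of u] that by (simp add: add_eq_0_iff)
  qed
  \<comment> \<open>\<open>p\<close> is only known to be integrable, but by \<open>p_eq\<close> it
    coincides near \<open>u\<close> with a continuous function of \<open>z\<close>; this regularity
    is what makes \<open>z\<close> differentiable with derivative \<open>p u\<close>.\<close>
  have z_deriv: "(z has_real_derivative p u) (at u)" if u: "0 < u" "u < T" for u
  proof -
    have "isCont z u" using z_cont u by (simp add: continuous_on_interior)
    then have "isCont (\<lambda>u. - \<beta> * z u / u) u" using u by (intro continuous_intros) auto
    moreover have "\<forall>\<^sub>F v in nhds u. p v = - \<beta> * z v / v"
      using eventually_nhds_in_open[of "{0<..<T}" u] u by (auto elim!: eventually_mono simp: p_eq)
    ultimately have "isCont p u" by (subst isCont_cong) auto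
    then have "continuous (at u within {0..T}) p" by (rule continuous_at_imp_continuous_at_within)
    then have "(z has_vector_derivative p u) (at u within {0..T})"
      unfolding z_def using u integral_has_vector_derivative_continuous_at[OF p, of u "{}"] by simp
    then show ?thesis
      using u by (simp add: has_real_derivative_iff_has_vector_derivative at_within_interior[of u "{0..T}"])
  qed
  define w where "w u = u powr \<beta> * z u" for u
  have "w t = w 0"
  proof (rule DERIV_isconst2[of 0 T w t])
    show "continuous_on {0..T} w"
      unfolding w_def using \<open>\<beta> > 0\<close> by (intro continuous_intros continuous_on_powr' z_cont) auto
    fix u assume u: "0 < u" "u < T"
    have "(w has_real_derivative (\<beta> * u powr (\<beta> - 1) * z u + p u * u powr \<beta>)) (at u)"
      unfolding w_def using u
      by (auto intro!: derivative_eq_intros z_deriv simp: field_simps powr_diff)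
    also have "\<beta> * u powr (\<beta> - 1) * z u + p u * u powr \<beta> = 0"
    proof -
      have "\<beta> * u powr (\<beta> - 1) * z u + p u * u powr \<beta> = u powr (\<beta> - 1) * (\<beta> * z u + u * p u)"
        using u by (simp add: powr_diff field_simps)
      also have "\<beta> * z u + u * p u = 0" using p_eq[of u] u by simp
      finally show ?thesis by simp
    qed
    finally show "(w has_real_derivative 0) (at u)" .
  qed (use t in auto)
  \<comment> \<open>\<open>w 0 = 0\<close> because \<open>0 powr \<beta> = 0\<close>, whereas
    \<open>t powr \<beta>\<close> is positive.\<close>
  then have "z t = 0" using t by (simp add: w_def)
  then show ?thesis using eq[of t] z_eq[of t] t by simp
qed

lemma K_op_half:
  assumes [measurable]: "f \<in> borel_measurable borel"
  shows "K_op (1 / 2) f t = (LBINT s:{0..t}. f s)"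
    and "set_integrable lborel {0..t} (\<lambda>s. volterra_kernel (1 / 2) t s * f s) = set_integrable lborel {0..t} f"
proof -
  have [measurable]: "volterra_kernel (1 / 2) t \<in> borel_measurable borel"
  proof -
    have "volterra_kernel (1 / 2) t = (\<lambda>s. if 0 < s \<and> s < t then 1 else 0)"
      by (auto simp: volterra_kernel_def fun_eq_iff)
    then show ?thesis by simp
  qed
  have ae: "AE s\<in>{0..t} in lborel. volterra_kernel (1 / 2) t s * f s = f s"
    using AE_lborel_singleton[of 0] AE_lborel_singleton[of t]
    by eventually_elim (auto simp: volterra_kernel_def)
  show "K_op (1 / 2) f t = (LBINT s:{0..t}. f s)"
    unfolding K_op_def by (rule set_lebesgue_integral_cong_AE) (use ae in auto)
  show "set_integrable lborel {0..t} (\<lambda>s. volterra_kernel (1 / 2) t s * f s) = set_integrable lborel {0..t} f"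
    by (rule set_integrable_cong_AE) (use ae in auto)
qed

text \<open>Membership in \<open>L2 T\<close> says nothing outside \<open>{0..T}\<close>. Cutting
  off with the indicator yields a Borel function on the whole line with the same image, to which the
  transform lemmas apply.\<close>

lemma L2_restrict:
  assumes "f \<in> L2 T"
  shows "(\<lambda>s. indicator {0..T} s * f s) \<in> borel_measurable borel"
    and "t \<le> T \<Longrightarrow> set_integrable lborel {0..t} (\<lambda>s. (indicator {0..T} s * f s)\<^sup>2)"
    and "t \<le> T \<Longrightarrow> K_op H (\<lambda>s. indicator {0..T} s * f s) t = K_op H f t"
proof -
  show "(\<lambda>s. indicator {0..T} s * f s) \<in> borel_measurable borel"
    using assms by (simp add: L2_def set_borel_measurable_def)
  show "set_integrable lborel {0..t} (\<lambda>s. (indicator {0..T} s * f s)\<^sup>2)" if "t \<le> T"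
  proof -
    have "set_integrable lborel {0..t} (\<lambda>s. (f s)\<^sup>2)"
      using assms that by (auto simp: L2_def intro: set_integrable_subset)
    then show ?thesis using that by (subst set_integrable_cong[OF refl refl]) auto
  qed
  show "K_op H (\<lambda>s. indicator {0..T} s * f s) t = K_op H f t" if "t \<le> T"
    unfolding K_op_def by (rule set_lebesgue_integral_cong) (use that in auto)
qed

lemma L2I:
  assumes [measurable]: "f \<in> borel_measurable borel" and "set_integrable lborel {0..T} (\<lambda>s. (f s)\<^sup>2)"
  shows "f \<in> L2 T"
  using assms(2) by (simp add: L2_def set_borel_measurable_def)

lemma square_add_le: "(x + y)\<^sup>2 \<le> 2 * x\<^sup>2 + 2 * (y::real)\<^sup>2"
  using sum_squares_bound[of x y] by (simp add: power2_sum)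

lemma square_integrable_diff:
  fixes f g :: "real \<Rightarrow> real"
  assumes [measurable]: "f \<in> borel_measurable borel" "g \<in> borel_measurable borel"
    and "set_integrable lborel {0..T} (\<lambda>s. (f s)\<^sup>2)" "set_integrable lborel {0..T} (\<lambda>s. (g s)\<^sup>2)"
  shows "set_integrable lborel {0..T} (\<lambda>s. (f s - g s)\<^sup>2)"
proof (rule set_integrable_dominated)
  show "set_integrable lborel {0..T} (\<lambda>s. 2 * (f s)\<^sup>2 + 2 * (g s)\<^sup>2)"
    using assms by (intro set_integral_add(1) set_integrable_mult_right)
  show "\<bar>(f s - g s)\<^sup>2\<bar> \<le> 2 * (f s)\<^sup>2 + 2 * (g s)\<^sup>2" for s
    using square_add_le[of "f s" "- g s"] by simp
qed simp_all

lemma set_integrable_of_square: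
  fixes f :: "real \<Rightarrow> real"
  assumes [measurable]: "f \<in> borel_measurable borel" and f2: "set_integrable lborel {0..x} (\<lambda>s. (f s)\<^sup>2)"
  shows "set_integrable lborel {0..x} f"
proof (rule set_integrable_dominated)
  have "set_integrable lborel {0..x} (\<lambda>_. 1 :: real)"
    using integrable_real_indicator[of "{0..x}" lborel] by (simp add: set_integrable_def emeasure_lborel_Icc_eq)
  then show "set_integrable lborel {0..x} (\<lambda>s. 1 + (f s)\<^sup>2)" using f2 by (rule set_integral_add(1))
  show "\<bar>f s\<bar> \<le> 1 + (f s)\<^sup>2" for s using abs_mult_le_squares[of 1 "f s"] by simp
qed simp_all

lemma kernel_integrable:
  assumes "0 < H" "H < 1" "0 \<le> t" and [measurable]: "f \<in> borel_measurable borel"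
    and f2: "set_integrable lborel {0..t} (\<lambda>s. (f s)\<^sup>2)"
  shows "set_integrable lborel {0..t} (\<lambda>s. volterra_kernel H t s * f s)"
proof -
  consider "H < 1 / 2" | "H = 1 / 2" | "H > 1 / 2" by linarith
  then show ?thesis
  proof cases
    case 1
    show ?thesis by (rule K_op_lt(1)[where \<beta> = "1 / 2 - H"]) (use 1 assms in auto)
  next
    case 2
    have "set_integrable lborel {0..t} f"
      by (rule set_integrable_of_square) (use assms in auto)
    then show ?thesis by (simp add: 2 K_op_half)
  next
    case 3
    show ?thesis by (rule K_op_gt(1)[where \<alpha> = "H - 1 / 2"]) (use 3 assms in auto)
  qed
qed

text \<open>The factors of the operator are undone from the outside. The vanishing primitive (for H
  > 1/2) or the homogeneous equation (for H < 1/2) makes the Abel transform of a weighted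
  \<open>f\<close> vanish almost everywhere, and the complementary transform then makes
  \<open>f\<close> vanish. For H = 1/2 the operator is the primitive itself.\<close>

lemma K_op_injective:
  assumes "0 < H" "H < 1" and [measurable]: "f \<in> borel_measurable borel"
    and f2: "set_integrable lborel {0..T} (\<lambda>s. (f s)\<^sup>2)"
    and zero: "\<And>t. t \<in> {0..T} \<Longrightarrow> K_op H f t = 0"
  shows "AE s in lborel. s \<in> {0..T} \<longrightarrow> f s = 0"
proof -
  have f2': "set_integrable lborel {0..t} (\<lambda>s. (f s)\<^sup>2)" if "t \<in> {0..T}" for t
    using set_integrable_subset[OF f2, of "{0..t}"] that by auto
  have nz: "AE s in lborel. s \<noteq> (0::real)" by (rule AE_lborel_singleton)
  consider "H < 1 / 2" | "H = 1 / 2" | "H > 1 / 2" by linarith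
  then show ?thesis
  proof cases
    case 1
    define \<beta> where "\<beta> = 1 / 2 - H"
    have \<beta>: "H = 1 / 2 - \<beta>" "0 < \<beta>" "\<beta> < 1 / 2" using 1 assms by (auto simp: \<beta>_def)
    define J where "J = abel (1 - \<beta>) (\<lambda>s. s powr \<beta> * f s)"
    note K = K_op_lt[OF assms(3) f2' \<beta>, folded J_def]
    have c: "volterra_const H > 0" using volterra_const_pos[of H] 1 assms by auto
    show ?thesis
    proof (cases "0 \<le> T")
      case True
      have Jz: "J t = 0" if "0 < t" "t \<le> T" for t
      proof (rule homogeneous_solution_eq_0[OF \<beta>(2) _ _ that])
        show "set_integrable lborel {0..T} (\<lambda>u. u powr (- \<beta> - 1) * J u)"
          using K(2)[of T] True by auto
        show "t powr (- \<beta>) * J t + \<beta> * (LBINT u:{0..t}. u powr (- \<beta> - 1) * J u) = 0" if "t \<in> {0..T}" for t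
          using K(3)[of t] zero[of t] that c by auto
      qed
      have J0: "AE s in lborel. s \<in> {0..T} \<longrightarrow> J s = 0"
        using nz
      proof eventually_elim
        case (elim s)
        show ?case using Jz[of s] elim by simp
      qed
      have fi: "set_integrable lborel {0..T} (\<lambda>s. s powr - (- \<beta>) * f s)"
        using \<beta> by (intro L2_powr_integrable f2) auto
      have "AE s in lborel. s \<in> {0..T} \<longrightarrow> s powr \<beta> * f s = 0"
      proof (rule AE_eq_0_if_abel_eq_0)
        show "set_integrable lborel {0..T} (\<lambda>s. s powr \<beta> * f s)" using fi by simp
        show "AE s in lborel. s \<in> {0..T} \<longrightarrow> abel (1 - \<beta>) (\<lambda>s. s powr \<beta> * f s) s = 0"
          using J0 unfolding J_def .
      qed (use \<beta> in auto)
      then show ?thesis using nz by eventually_elim auto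
    qed auto
  next
    case 2
    have "set_integrable lborel {0..T} f"
      by (rule set_integrable_of_square) (use f2 in auto)
    then show ?thesis
      by (rule AE_eq_0_if_integrals_eq_0) (use zero 2 in \<open>simp add: K_op_half\<close>)
  next
    case 3
    define \<alpha> where "\<alpha> = H - 1 / 2"
    have \<alpha>: "H = \<alpha> + 1 / 2" "0 < \<alpha>" "\<alpha> < 1 / 2" using 3 assms by (auto simp: \<alpha>_def)
    define h where "h = (\<lambda>s. s powr (- \<alpha>) * f s)"
    have [measurable]: "h \<in> borel_measurable borel" by (simp add: h_def)
    have h: "set_integrable lborel {0..T} h"
      unfolding h_def using \<alpha> by (intro L2_powr_integrable f2) auto
    have c: "volterra_const H > 0" using volterra_const_pos[of H] 3 assms by auto
    have int0: "(LBINT u:{0..t}. u powr \<alpha> * abel \<alpha> h u) = 0" if "t \<in> {0..T}" for t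
      using K_op_gt(2)[OF assms(3) f2'[OF that] \<alpha>] zero[OF that] that c by (simp add: h_def)
    have "set_integrable lborel {0..T} (\<lambda>u. u powr \<alpha> * abel \<alpha> h u)"
    proof (rule set_integrable_dominated)
      show "set_integrable lborel {0..T} (\<lambda>u. T powr \<alpha> * \<bar>abel \<alpha> h u\<bar>)"
        by (intro set_integrable_mult_right set_integrable_abs abel_integrable h \<alpha>) simp
      show "\<bar>u powr \<alpha> * abel \<alpha> h u\<bar> \<le> T powr \<alpha> * \<bar>abel \<alpha> h u\<bar>" if "u \<in> {0..T}" for u
        using that \<alpha> powr_mono2[of \<alpha> u T] by (simp add: abs_mult mult_right_mono)
    qed simp_all
    then have "AE u in lborel. u \<in> {0..T} \<longrightarrow> u powr \<alpha> * abel \<alpha> h u = 0"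
      by (rule AE_eq_0_if_integrals_eq_0) (rule int0)
    then have "AE u in lborel. u \<in> {0..T} \<longrightarrow> abel \<alpha> h u = 0" using nz by eventually_elim auto
    then have "AE s in lborel. s \<in> {0..T} \<longrightarrow> h s = 0"
      by (rule AE_eq_0_if_abel_eq_0[rotated -1]) (use \<alpha> h in \<open>simp_all\<close>)
    then show ?thesis using nz by eventually_elim (auto simp: h_def)
  qed
qed

lemma K_op_unique:
  assumes "0 < H" "H < 1" "f1 \<in> L2 T" "f2 \<in> L2 T"
    and eq: "\<And>t. t \<in> {0..T} \<Longrightarrow> K_op H f1 t = K_op H f2 t"
  shows "AE s in lborel. s \<in> {0..T} \<longrightarrow> f1 s = f2 s"
proof -
  define g1 where "g1 s = indicator {0..T} s * f1 s" for s
  define g2 where "g2 s = indicator {0..T} s * f2 s" for s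
  note r1 = L2_restrict[OF assms(3), folded g1_def] and r2 = L2_restrict[OF assms(4), folded g2_def]
  note [measurable] = r1(1)[folded g1_def[abs_def]] r2(1)[folded g2_def[abs_def]]
  have "AE s in lborel. s \<in> {0..T} \<longrightarrow> g1 s - g2 s = 0"
  proof (rule K_op_injective[OF assms(1,2)])
    show "set_integrable lborel {0..T} (\<lambda>s. (g1 s - g2 s)\<^sup>2)"
      by (intro square_integrable_diff r1(2) r2(2)) auto
    fix t assume t: "t \<in> {0..T}"
    \<comment> \<open>Additivity is not automatic, since a nonintegrable function has integral 0 by
      convention; \<open>kernel_integrable\<close> supplies the integrability.\<close>
    have "K_op H (\<lambda>s. g1 s - g2 s) t = K_op H g1 t - K_op H g2 t"
      unfolding K_op_def right_diff_distrib
      using t r1(2)[of t] r2(2)[of t] assms(1,2)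
      by (intro set_integral_diff(2) kernel_integrable) auto
    then show "K_op H (\<lambda>s. g1 s - g2 s) t = 0"
      using eq[OF t] t r1(3)[of t H] r2(3)[of t H] by simp
  qed simp
  then show ?thesis by eventually_elim (auto simp: g1_def g2_def)
qed

section \<open>Preimages under the Volterra operator\<close>

lemma bounded_set_integrable:
  fixes g :: "real \<Rightarrow> real"
  assumes "g \<in> borel_measurable borel" and "\<And>s. s \<in> {a..b} \<Longrightarrow> \<bar>g s\<bar> \<le> M"
  shows "set_integrable lborel {a..b} g"
proof (rule set_integrable_dominated)
  show "set_integrable lborel {a..b} (\<lambda>_. M)"
    using integrable_real_indicator[of "{a..b}" lborel] by (simp add: set_integrable_def emeasure_lborel_Icc_eq)
qed (use assms in auto)

lemma powr_integral_away_from_0: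
  fixes a b u :: real
  assumes "u < a" "a \<le> b" "p \<noteq> -1"
  shows "set_integrable lborel {a..b} (\<lambda>s. (s - u) powr p)"
    and "(LBINT s:{a..b}. (s - u) powr p) = ((b - u) powr (p + 1) - (a - u) powr (p + 1)) / (p + 1)"
proof -
  have "((\<lambda>s. (s - u) powr p) has_integral ((b - u) powr (p + 1) / (p + 1) - (a - u) powr (p + 1) / (p + 1))) {a..b}"
  proof (rule fundamental_theorem_of_calculus[OF assms(2)])
    fix x assume "x \<in> {a..b}"
    then have "x - u > 0" using assms by simp
    have "((\<lambda>s. s - u) has_real_derivative 1) (at x)" by (auto intro!: derivative_eq_intros)
    from has_field_derivative_at_within[OF DERIV_fun_powr[OF this \<open>x - u > 0\<close>, of "p + 1"], of "{a..b}"]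
    have "((\<lambda>s. (s - u) powr (p + 1)) has_real_derivative (p + 1) * (x - u) powr p) (at x within {a..b})"
      by simp
    from DERIV_cdivide[OF this, of "p + 1"]
    have "((\<lambda>s. (s - u) powr (p + 1) / (p + 1)) has_real_derivative (x - u) powr p) (at x within {a..b})"
      using assms by simp
    then show "((\<lambda>s. (s - u) powr (p + 1) / (p + 1)) has_vector_derivative (x - u) powr p) (at x within {a..b})"
      by (simp add: has_real_derivative_iff_has_vector_derivative)
  qed
  from nonneg_has_integral_lborel[OF _ _ this]
  show "set_integrable lborel {a..b} (\<lambda>s. (s - u) powr p)"
    and "(LBINT s:{a..b}. (s - u) powr p) = ((b - u) powr (p + 1) - (a - u) powr (p + 1)) / (p + 1)"
    by (auto simp: diff_divide_distrib)
qed

text \<open>Substituting u = s v fixes the domain of integration. In this form the transform is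
  visibly measurable or continuous in \<open>s\<close>, and for processes it becomes an integral
  over \<open>{0..1}\<close> of values at times s v \<le> s.\<close>

lemma abel_scale:
  assumes "s > 0"
  shows "abel a (\<lambda>u. u powr p * g u) s
      = s powr (a + p) * (LBINT v:{0..1}. v powr p * (1 - v) powr (a - 1) * g (s * v))"
proof -
  have eq: "(s - s * v) powr (a - 1) * ((s * v) powr p * g (s * v))
      = s powr (a + p - 1) * (v powr p * (1 - v) powr (a - 1) * g (s * v))" if "v \<in> {0..1}" for v
  proof -
    have "s - s * v = s * (1 - v)" by (simp add: algebra_simps)
    moreover have "s powr (a + p - 1) = s powr (a - 1) * s powr p" by (simp add: powr_add[symmetric] algebra_simps)
    ultimately show ?thesis using that assms by (simp add: powr_mult mult_ac)
  qed
  have "abel a (\<lambda>u. u powr p * g u) s = s * (LBINT v:{0..1}. (s - s * v) powr (a - 1) * ((s * v) powr p * g (s * v)))"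
    using set_integral_scale[OF assms, of 0] by (simp add: abel_def)
  also have "(LBINT v:{0..1}. (s - s * v) powr (a - 1) * ((s * v) powr p * g (s * v)))
     = (LBINT v:{0..1}. s powr (a + p - 1) * (v powr p * (1 - v) powr (a - 1) * g (s * v)))"
    by (rule set_lebesgue_integral_cong) (use eq in auto)
  also have "\<dots> = s powr (a + p - 1) * (LBINT v:{0..1}. v powr p * (1 - v) powr (a - 1) * g (s * v))"
    by simp
  also have "s * (s powr (a + p - 1) * x) = s powr (a + p) * x" for x
    using assms by (simp add: powr_diff)
  finally show ?thesis .
qed

lemma borel_measurable_set_integral:
  fixes F :: "'a \<Rightarrow> real \<Rightarrow> real"
  assumes [measurable]: "case_prod F \<in> borel_measurable (M \<Otimes>\<^sub>M borel)" "A \<in> sets borel"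
  shows "(\<lambda>x. LBINT v:A. F x v) \<in> borel_measurable M"
  unfolding set_lebesgue_integral_def by measurable

text \<open>For s > 0 this is s powr (- \<beta>) times the Abel transform of order \<beta> of u powr
  \<beta> * g u, the classical formula for the inverse up to a constant. The substitution u = s v
  removes the apparent singularity at s = 0.\<close>

definition volterra_preimage_lt :: "real \<Rightarrow> (real \<Rightarrow> real) \<Rightarrow> real \<Rightarrow> real" where
  "volterra_preimage_lt \<beta> g s = s powr \<beta> * (LBINT v:{0..1}. v powr \<beta> * (1 - v) powr (\<beta> - 1) * g (s * v))"

text \<open>By \<open>abel_abel\<close> the transform in \<open>K_op_lt\<close> becomes a multiple
  of the primitive of \<phi> u = u powr \<beta> * g u. Exchanging the order in the remaining
  integral produces the primitive of \<open>g\<close> minus a term that cancels the boundary term of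
  \<open>K_op_lt\<close>.\<close>

lemma volterra_preimage_lt:
  assumes H: "H = 1 / 2 - \<beta>" "0 < \<beta>" "\<beta> < 1 / 2" and g_meas[measurable]: "g \<in> borel_measurable borel"
    and gM: "\<And>u. u \<in> {0..T} \<Longrightarrow> \<bar>g u\<bar> \<le> M"
  defines "q \<equiv> volterra_preimage_lt \<beta> g"
  shows "q \<in> borel_measurable borel"
    and "\<And>s. s \<in> {0..T} \<Longrightarrow> \<bar>q s\<bar> \<le> s powr \<beta> * (Beta (\<beta> + 1) \<beta> * M)"
    and "q \<in> L2 T"
    and "\<And>t. t \<in> {0..T} \<Longrightarrow> K_op H q t = volterra_const H * Beta \<beta> (1 - \<beta>) * (LBINT u:{0..t}. g u)"
proof -
  have "(\<lambda>s. LBINT v:{0..1}. v powr \<beta> * (1 - v) powr (\<beta> - 1) * g (s * v)) \<in> borel_measurable borel"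
    by (rule borel_measurable_set_integral) measurable
  then show q_meas[measurable]: "q \<in> borel_measurable borel"
    unfolding q_def volterra_preimage_lt_def[abs_def] by measurable
  have B: "set_integrable lborel {0..1} (\<lambda>v. v powr \<beta> * (1 - v) powr (\<beta> - 1))"
    "(LBINT v:{0..1}. v powr \<beta> * (1 - v) powr (\<beta> - 1)) = Beta (\<beta> + 1) \<beta>"
    using Beta_integral[of "\<beta> + 1" \<beta>] H by auto
  show qb: "\<bar>q s\<bar> \<le> s powr \<beta> * (Beta (\<beta> + 1) \<beta> * M)" if s: "s \<in> {0..T}" for s
  proof -
    have bd: "\<bar>v powr \<beta> * (1 - v) powr (\<beta> - 1) * g (s * v)\<bar> \<le> v powr \<beta> * (1 - v) powr (\<beta> - 1) * M"
      if v: "v \<in> {0..1}" for v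
    proof -
      have "s * v \<le> s * 1" using v s by (intro mult_left_mono) auto
      then have "s * v \<in> {0..T}" using v s by auto
      then show ?thesis using gM[of "s * v"] by (simp add: abs_mult mult_left_mono)
    qed
    have i: "set_integrable lborel {0..1} (\<lambda>v. v powr \<beta> * (1 - v) powr (\<beta> - 1) * g (s * v))"
      by (rule set_integrable_dominated[OF set_integrable_mult_left[OF B(1)] _ _ bd]) simp_all
    have "\<bar>LBINT v:{0..1}. v powr \<beta> * (1 - v) powr (\<beta> - 1) * g (s * v)\<bar>
       \<le> (LBINT v:{0..1}. \<bar>v powr \<beta> * (1 - v) powr (\<beta> - 1) * g (s * v)\<bar>)"
      using set_integral_norm_bound[OF i] by simp
    also have "\<dots> \<le> (LBINT v:{0..1}. v powr \<beta> * (1 - v) powr (\<beta> - 1) * M)"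
      by (rule set_integral_mono[OF set_integrable_abs[OF i] set_integrable_mult_left[OF B(1)] bd])
    also have "\<dots> = Beta (\<beta> + 1) \<beta> * M" using B by simp
    finally show ?thesis
      by (simp add: q_def volterra_preimage_lt_def abs_mult mult_left_mono)
  qed
  have q2: "set_integrable lborel {0..t} (\<lambda>s. (q s)\<^sup>2)" if "t \<le> T" for t
  proof (rule bounded_set_integrable)
    fix s assume s: "s \<in> {0..t}"
    have "0 \<le> M" using gM[of s] s that by auto
    have "\<bar>q s\<bar> \<le> s powr \<beta> * (Beta (\<beta> + 1) \<beta> * M)" using s that by (intro qb) auto
    also have "\<dots> \<le> t powr \<beta> * (Beta (\<beta> + 1) \<beta> * M)"
      using s H \<open>0 \<le> M\<close> Beta_pos[of "\<beta> + 1" \<beta>] by (intro mult_right_mono powr_mono2) auto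
    finally show "\<bar>(q s)\<^sup>2\<bar> \<le> (t powr \<beta> * (Beta (\<beta> + 1) \<beta> * M))\<^sup>2"
      by (simp add: power_mono abs_le_square_iff[symmetric])
  qed simp
  show "q \<in> L2 T" by (rule L2I[OF q_meas q2]) simp
  fix t assume t: "t \<in> {0..T}"
  define \<phi> where "\<phi> u = u powr \<beta> * g u" for u
  have [measurable]: "\<phi> \<in> borel_measurable borel" unfolding \<phi>_def by measurable
  have \<phi>_int: "set_integrable lborel {0..x} \<phi>" if "x \<le> T" for x
  proof (rule bounded_set_integrable)
    fix s assume "s \<in> {0..x}"
    then show "\<bar>\<phi> s\<bar> \<le> x powr \<beta> * M"
      unfolding \<phi>_def abs_mult using that H gM[of s] by (intro mult_mono) (auto intro!: powr_mono2)
  qed simp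
  have g_int: "set_integrable lborel {0..t} g"
    by (rule bounded_set_integrable[where M = M]) (use gM t in auto)
  have J: "abel (1 - \<beta>) (\<lambda>s. s powr \<beta> * q s) u = Beta \<beta> (1 - \<beta>) * (LBINT v:{0..u}. \<phi> v)" if "u \<in> {0..T}" for u
  proof -
    have *: "s powr \<beta> * q s = abel \<beta> \<phi> s" if "s \<noteq> 0" "s \<in> {0..u}" for s
      using abel_scale[of s \<beta> \<beta> g] that
      by (simp add: q_def volterra_preimage_lt_def \<phi>_def[abs_def] mult.assoc[symmetric] powr_add[symmetric])
    have "abel (1 - \<beta>) (\<lambda>s. s powr \<beta> * q s) u = abel (1 - \<beta>) (abel \<beta> \<phi>) u"
      using AE_lborel_singleton[of 0] by (intro abel_cong_AE) (auto elim!: eventually_mono simp: *)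
    also have "\<dots> = Beta \<beta> (1 - \<beta>) * (LBINT v:{0..u}. \<phi> v)"
      using that H by (intro abel_abel \<phi>_int) auto
    finally show ?thesis .
  qed
  \<comment> \<open>\<open>c v\<close> is the integral of u powr (- \<beta> - 1) over
    \<open>{v..t}\<close>, which the exchange of order places in front of
    \<open>\<phi> v\<close>.\<close>
  define c where "c v = (v powr (- \<beta>) - t powr (- \<beta>)) / \<beta>" for v
  have c\<phi>: "c v * \<phi> v = (g v - t powr (- \<beta>) * \<phi> v) / \<beta>" if "v > 0" for v
  proof -
    have "v powr (- \<beta>) * v powr \<beta> = 1" using that by (simp add: powr_add[symmetric])
    moreover have "c v * \<phi> v = ((v powr (- \<beta>) * v powr \<beta>) * g v - t powr (- \<beta>) * \<phi> v) / \<beta>"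
      by (simp add: c_def \<phi>_def algebra_simps)
    ultimately show ?thesis by simp
  qed
  have [measurable]: "c \<in> borel_measurable borel" unfolding c_def by measurable
  have aec: "AE v\<in>{0..t} in lborel. c v * \<phi> v = (g v - t powr (- \<beta>) * \<phi> v) / \<beta>"
    using AE_lborel_singleton[of 0]
  proof eventually_elim
    case (elim v)
    then show ?case using c\<phi>[of v] by simp
  qed
  have "(LBINT u:{0..t}. u powr (- \<beta> - 1) * (LBINT v:{0..u}. \<phi> v))
      = (LBINT u:{0..t}. (LBINT v:{0..u}. u powr (- \<beta> - 1) * \<phi> v))"
    by simp
  also have "\<dots> = (LBINT v:{0..t}. c v * \<phi> v)"
  proof (rule triangle_Fubini(3))
    fix v assume v: "0 < v" "v < t"
    show "set_integrable lborel {v..t} (\<lambda>u. u powr (- \<beta> - 1))"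
      "(LBINT u:{v..t}. u powr (- \<beta> - 1)) = c v"
      using powr_integral_away_from_0[of 0 v t "- \<beta> - 1"] v H by (auto simp: c_def field_simps)
  next
    have "set_integrable lborel {0..t} (\<lambda>v. (g v - t powr (- \<beta>) * \<phi> v) / \<beta>)"
      using t by (intro set_integrable_divide set_integral_diff(1) g_int set_integrable_mult_right \<phi>_int) auto
    also have "?this \<longleftrightarrow> set_integrable lborel {0..t} (\<lambda>v. c v * \<phi> v)"
      using aec by (intro set_integrable_cong_AE) auto
    finally show "set_integrable lborel {0..t} (\<lambda>v. c v * \<phi> v)" .
  qed simp_all
  also have "\<dots> = (LBINT v:{0..t}. (g v - t powr (- \<beta>) * \<phi> v) / \<beta>)"
    using aec by (intro set_lebesgue_integral_cong_AE) auto
  also have "\<dots> = ((LBINT u:{0..t}. g u) - t powr (- \<beta>) * (LBINT u:{0..t}. \<phi> u)) / \<beta>"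
    using t g_int \<phi>_int[of t] by (simp add: set_integral_diff)
  finally have F: "(LBINT u:{0..t}. u powr (- \<beta> - 1) * (LBINT v:{0..u}. \<phi> v)) = \<dots>" .
  have "(LBINT u:{0..t}. u powr (- \<beta> - 1) * abel (1 - \<beta>) (\<lambda>s. s powr \<beta> * q s) u)
    = (LBINT u:{0..t}. Beta \<beta> (1 - \<beta>) * (u powr (- \<beta> - 1) * (LBINT v:{0..u}. \<phi> v)))"
    using J t by (intro set_lebesgue_integral_cong) auto
  also have "\<dots> = Beta \<beta> (1 - \<beta>) * (LBINT u:{0..t}. u powr (- \<beta> - 1) * (LBINT v:{0..u}. \<phi> v))"
    by (rule set_integral_mult_right)
  finally have "K_op H q t = volterra_const H * (t powr (- \<beta>) * (Beta \<beta> (1 - \<beta>) * (LBINT v:{0..t}. \<phi> v))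
      + \<beta> * (Beta \<beta> (1 - \<beta>) * (((LBINT u:{0..t}. g u) - t powr (- \<beta>) * (LBINT u:{0..t}. \<phi> u)) / \<beta>)))"
    using K_op_lt(3)[OF q_meas q2 H, of t] J[OF t] t F by simp
  then show "K_op H q t = volterra_const H * Beta \<beta> (1 - \<beta>) * (LBINT u:{0..t}. g u)"
    using H(2) by (simp add: field_simps)
qed

section \<open>Marchaud derivatives and preimages for H > 1/2\<close>

definition marchaud_weight :: "real \<Rightarrow> real \<Rightarrow> real" where
  "marchaud_weight \<alpha> v = v powr (- \<alpha>) * (1 - v) powr (- \<alpha> - 1)"

lemma borel_measurable_marchaud_weight [measurable]: "marchaud_weight \<alpha> \<in> borel_measurable borel"
  unfolding marchaud_weight_def by measurable

lemma marchaud_weight_nonneg: "0 \<le> marchaud_weight \<alpha> v"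
  by (simp add: marchaud_weight_def)

lemma marchaud_weight_integrable:
  assumes "\<alpha> < 1" "0 \<le> \<rho>" "\<rho> < 1" "0 \<le> \<alpha>"
  shows "set_integrable lborel {0..\<rho>} (marchaud_weight \<alpha>)"
proof (rule set_integrable_dominated)
  show "set_integrable lborel {0..\<rho>} (\<lambda>v. v powr (- \<alpha>) * (1 - \<rho>) powr (- \<alpha> - 1))"
    using assms by (intro set_integrable_mult_left powr_integral_from_0) auto
  show "\<bar>marchaud_weight \<alpha> v\<bar> \<le> v powr (- \<alpha>) * (1 - \<rho>) powr (- \<alpha> - 1)" if "v \<in> {0..\<rho>}" for v
    unfolding marchaud_weight_def using that assms
    by (auto simp: abs_mult intro!: mult_left_mono powr_mono2')
qed simp_all

lemma powr_mult_bounded_integrable: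
  fixes g :: "real \<Rightarrow> real"
  assumes "p > -1" "0 \<le> x" and [measurable]: "g \<in> borel_measurable borel"
    and "\<And>u. u \<in> {0..x} \<Longrightarrow> \<bar>g u\<bar> \<le> M"
  shows "set_integrable lborel {0..x} (\<lambda>u. u powr p * g u)"
proof (rule set_integrable_dominated)
  show "set_integrable lborel {0..x} (\<lambda>u. u powr p * M)"
    using assms by (intro set_integrable_mult_left powr_integral_from_0) auto
  show "\<bar>u powr p * g u\<bar> \<le> u powr p * M" if "u \<in> {0..x}" for u
    using assms(4)[OF that] by (simp add: abs_mult mult_left_mono)
qed simp_all

lemma Beta_mult_bounded_integrable:
  fixes g :: "real \<Rightarrow> real"
  assumes "0 \<le> x" "\<alpha> < 1" and [measurable]: "g \<in> borel_measurable borel"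
    and "\<And>u. u \<in> {0..x} \<Longrightarrow> \<bar>g u\<bar> \<le> M"
  shows "set_integrable lborel {0..x} (\<lambda>u. (x - u) powr (- \<alpha>) * (u powr (- \<alpha>) * g u))"
proof (cases "x = 0")
  case True
  then show ?thesis by (intro bounded_set_integrable[where M = 0]) auto
next
  case False
  show ?thesis
  proof (rule set_integrable_dominated)
    show "set_integrable lborel {0..x} (\<lambda>u. (u powr (- \<alpha>) * (x - u) powr (- \<alpha>)) * M)"
      using Beta_integral_scaled(1)[of "1 - \<alpha>" "1 - \<alpha>" 0 x] assms False
      by (intro set_integrable_mult_left) auto
    show "\<bar>(x - u) powr (- \<alpha>) * (u powr (- \<alpha>) * g u)\<bar> \<le> u powr (- \<alpha>) * (x - u) powr (- \<alpha>) * M"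
      if "u \<in> {0..x}" for u
    proof -
      have "\<bar>(x - u) powr (- \<alpha>) * (u powr (- \<alpha>) * g u)\<bar> = (u powr (- \<alpha>) * (x - u) powr (- \<alpha>)) * \<bar>g u\<bar>"
        by (simp add: abs_mult)
      also have "\<dots> \<le> (u powr (- \<alpha>) * (x - u) powr (- \<alpha>)) * M"
        using assms(4)[OF that] by (intro mult_left_mono) auto
      finally show ?thesis .
    qed
  qed simp_all
qed

text \<open>The weight is the kernel u powr (- \<alpha>) * (s - u) powr (- \<alpha> - 1) at u = s v
  with the powers of \<open>s\<close> taken out. It is not integrable at v = 1, so g s and g (s v)
  can be separated only after cutting at v \<le> \<rho>. In the variable \<open>u\<close> the cut
  reads u \<le> \<rho> s, and exchanging the order leaves an elementary integral over
  \<open>s\<close> from u / \<rho> to \<open>x\<close>.\<close>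

lemma truncated_convolution:
  fixes g :: "real \<Rightarrow> real"
  assumes \<alpha>: "0 < \<alpha>" "\<alpha> < 1 / 2" and \<rho>: "0 < \<rho>" "\<rho> < 1" and x: "0 < x"
    and [measurable]: "g \<in> borel_measurable borel" and gM: "\<And>u. u \<in> {0..x} \<Longrightarrow> \<bar>g u\<bar> \<le> M"
  shows "set_integrable lborel {0..x} (\<lambda>s. s powr (- 2 * \<alpha>) * (LBINT v:{0..\<rho>}. marchaud_weight \<alpha> v * g (s * v)))"
    and "\<alpha> * (LBINT s:{0..x}. s powr (- 2 * \<alpha>) * (LBINT v:{0..\<rho>}. marchaud_weight \<alpha> v * g (s * v)))
      = (1 / \<rho> - 1) powr (- \<alpha>) * (LBINT u:{0..\<rho> * x}. u powr (- 2 * \<alpha>) * g u)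
        - (LBINT u:{0..\<rho> * x}. (x - u) powr (- \<alpha>) * (u powr (- \<alpha>) * g u))"
proof -
  define k where "k s u = (if u \<le> \<rho> * s then (s - u) powr (- \<alpha> - 1) else 0)" for s u :: real
  define \<phi> where "\<phi> u = u powr (- \<alpha>) * g u" for u
  define \<mu> where "\<mu> = (1 / \<rho> - 1) powr (- \<alpha>)"
  \<comment> \<open>The lower limit s = u / \<rho> contributes (u / \<rho> - u) powr (- \<alpha>) =
    \<mu> * u powr (- \<alpha>), the part that diverges as \<rho> tends to 1. For u > \<rho> x the
    range of \<open>s\<close> is empty.\<close>
  define c where "c u = (if u \<le> \<rho> * x then ((u / \<rho> - u) powr (- \<alpha>) - (x - u) powr (- \<alpha>)) / \<alpha> else 0)" for u
  have k_meas: "case_prod k \<in> borel_measurable (borel \<Otimes>\<^sub>M borel)" unfolding k_def by measurable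
  have \<phi>_meas[measurable]: "\<phi> \<in> borel_measurable borel" unfolding \<phi>_def by measurable
  have c_meas[measurable]: "c \<in> borel_measurable borel" unfolding c_def by measurable
  have k0: "0 \<le> k s u" for s u by (simp add: k_def)
  have lx: "0 \<le> \<rho> * x" "\<rho> * x \<le> x" using \<rho> x mult_right_mono[of \<rho> 1 x] by auto
  have kc: "set_integrable lborel {u..x} (\<lambda>s. k s u)" "(LBINT s:{u..x}. k s u) = c u" if u: "0 < u" "u < x" for u
  proof -
    have ul: "u / \<rho> > u" using u \<rho> by (simp add: field_simps)
    have e: "(\<lambda>s. indicator {u..x} s *\<^sub>R k s u) = (\<lambda>s. indicator {u / \<rho>..x} s *\<^sub>R (s - u) powr (- \<alpha> - 1))"
    proof
      fix s
      have "u \<le> \<rho> * s \<longleftrightarrow> u / \<rho> \<le> s" using \<rho> by (simp add: field_simps)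
      then show "indicator {u..x} s *\<^sub>R k s u = indicator {u / \<rho>..x} s *\<^sub>R (s - u) powr (- \<alpha> - 1)"
        using ul by (auto simp: k_def indicator_def)
    qed
    show "set_integrable lborel {u..x} (\<lambda>s. k s u)"
      unfolding set_integrable_def e
    proof (cases "u / \<rho> \<le> x")
      case True
      then show "integrable lborel (\<lambda>s. indicator {u / \<rho>..x} s *\<^sub>R (s - u) powr (- \<alpha> - 1))"
        using powr_integral_away_from_0(1)[OF ul True, of "- \<alpha> - 1"] \<alpha> by (simp add: set_integrable_def)
    qed simp
    show "(LBINT s:{u..x}. k s u) = c u"
    proof (cases "u / \<rho> \<le> x")
      case True
      then have "u \<le> \<rho> * x" using \<rho> by (simp add: field_simps)
      then show ?thesis
        using powr_integral_away_from_0(2)[OF ul True, of "- \<alpha> - 1"] \<alpha>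
        unfolding set_lebesgue_integral_def e by (simp add: c_def field_simps)
    next
      case False
      then have "\<not> u \<le> \<rho> * x" using \<rho> by (simp add: field_simps)
      then show ?thesis
        using False unfolding set_lebesgue_integral_def e by (simp add: c_def)
    qed
  qed
  have Ei: "set_integrable lborel {0..\<rho> * x} (\<lambda>u. u powr (- 2 * \<alpha>) * g u)"
    using \<alpha> lx gM by (intro powr_mult_bounded_integrable[where M = M]) auto
  have Ti: "set_integrable lborel {0..\<rho> * x} (\<lambda>u. (x - u) powr (- \<alpha>) * \<phi> u)"
  proof (rule set_integrable_subset)
    show "set_integrable lborel {0..x} (\<lambda>u. (x - u) powr (- \<alpha>) * \<phi> u)"
      unfolding \<phi>_def by (rule Beta_mult_bounded_integrable[OF _ _ _ gM]) (use x \<alpha> in simp_all)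
    show "{0..\<rho> * x} \<subseteq> {0..x}" using lx by (intro subsetI) auto
  qed simp
  define r where "r u = (\<mu> * (u powr (- 2 * \<alpha>) * g u) - (x - u) powr (- \<alpha>) * \<phi> u) / \<alpha>" for u
  have [measurable]: "r \<in> borel_measurable borel" unfolding r_def by measurable
  have ri: "set_integrable lborel {0..\<rho> * x} r"
    unfolding r_def by (intro set_integrable_divide set_integral_diff(1) set_integrable_mult_right Ei Ti)
  have cr: "AE u in lborel. indicator {0..x} u *\<^sub>R (c u * \<phi> u) = indicator {0..\<rho> * x} u *\<^sub>R r u"
    using AE_lborel_singleton[of 0]
  proof eventually_elim
    case (elim u)
    show ?case
    proof (cases "u \<in> {0..\<rho> * x}")
      case True
      then have "u / \<rho> - u = u * (1 / \<rho> - 1)" by (simp add: algebra_simps)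
      then have "(u / \<rho> - u) powr (- \<alpha>) = u powr (- \<alpha>) * \<mu>"
        using True elim \<rho> by (simp add: powr_mult \<mu>_def)
      moreover have "u powr (- 2 * \<alpha>) = u powr (- \<alpha>) * u powr (- \<alpha>)"
        by (simp add: powr_add[symmetric])
      ultimately have "c u * \<phi> u = r u" using True by (simp add: c_def r_def \<phi>_def algebra_simps)
      then show ?thesis using True lx by (auto simp: indicator_def)
    next
      case False
      then show ?thesis by (auto simp: c_def indicator_def)
    qed
  qed
  have cphi: "set_integrable lborel {0..x} (\<lambda>u. c u * \<phi> u)"
    using ri unfolding set_integrable_def by (subst integrable_cong_AE[OF _ _ cr]) auto
  have cphi_val: "(LBINT u:{0..x}. c u * \<phi> u) = (LBINT u:{0..\<rho> * x}. r u)"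
    unfolding set_lebesgue_integral_def by (rule integral_cong_AE[OF _ _ cr]) auto
  define F where "F s = s powr (- 2 * \<alpha>) * (LBINT v:{0..\<rho>}. marchaud_weight \<alpha> v * g (s * v))" for s
  have [measurable]: "F \<in> borel_measurable borel"
  proof -
    have "(\<lambda>s. LBINT v:{0..\<rho>}. marchaud_weight \<alpha> v * g (s * v)) \<in> borel_measurable borel"
      by (rule borel_measurable_set_integral) measurable
    then show ?thesis unfolding F_def by measurable
  qed
  have inner: "(LBINT u:{0..s}. k s u * \<phi> u) = F s" if s: "s > 0" for s
  proof -
    have *: "indicator {0..1} v *\<^sub>R (k s (s * v) * \<phi> (s * v))
      = indicator {0..\<rho>} v *\<^sub>R (s powr (- 2 * \<alpha> - 1) * (marchaud_weight \<alpha> v * g (s * v)))" for v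
    proof (cases "v \<in> {0..\<rho>}")
      case True
      have "s - s * v = s * (1 - v)" by (simp add: algebra_simps)
      then have "(s - s * v) powr (- \<alpha> - 1) = s powr (- \<alpha> - 1) * (1 - v) powr (- \<alpha> - 1)"
        using s True \<rho> by (simp add: powr_mult)
      moreover have "s powr (- 2 * \<alpha> - 1) = s powr (- \<alpha> - 1) * s powr (- \<alpha>)"
        by (simp add: powr_add[symmetric])
      ultimately show ?thesis
        using True s \<rho> by (simp add: k_def \<phi>_def marchaud_weight_def powr_mult mult_ac)
    next
      case False
      then have "v \<in> {0..1} \<Longrightarrow> k s (s * v) = 0" using s by (simp add: k_def mult.commute)
      then show ?thesis using False by (auto simp: indicator_def)
    qed
    have "(LBINT u:{0..s}. k s u * \<phi> u) = s * (LBINT v:{0..1}. k s (s * v) * \<phi> (s * v))"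
      using set_integral_scale[OF s, of 0] by simp
    also have "(LBINT v:{0..1}. k s (s * v) * \<phi> (s * v))
       = (LBINT v:{0..\<rho>}. s powr (- 2 * \<alpha> - 1) * (marchaud_weight \<alpha> v * g (s * v)))"
      unfolding set_lebesgue_integral_def * ..
    also have "\<dots> = s powr (- 2 * \<alpha> - 1) * (LBINT v:{0..\<rho>}. marchaud_weight \<alpha> v * g (s * v))"
      by (rule set_integral_mult_right)
    also have "s * (s powr (- 2 * \<alpha> - 1) * y) = s powr (- 2 * \<alpha>) * y" for y
      using s by (simp add: powr_diff)
    finally show ?thesis by (simp add: F_def)
  qed
  have innerAE: "AE s\<in>{0..x} in lborel. (LBINT u:{0..s}. k s u * \<phi> u) = F s"
    using AE_lborel_singleton[of 0]
  proof eventually_elim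
    case (elim s)
    then show ?case using inner[of s] by auto
  qed
  have kint_meas: "(\<lambda>s. LBINT u:{0..s}. k s u * \<phi> u) \<in> borel_measurable borel"
  proof -
    have "(\<lambda>s. \<integral>u. (if 0 \<le> u \<and> u \<le> s then k s u * \<phi> u else 0) \<partial>lborel) \<in> borel_measurable borel"
      unfolding k_def by measurable
    also have "(\<lambda>s. \<integral>u. (if 0 \<le> u \<and> u \<le> s then k s u * \<phi> u else 0) \<partial>lborel) = (\<lambda>s. LBINT u:{0..s}. k s u * \<phi> u)"
      unfolding set_lebesgue_integral_def fun_eq_iff
      by (intro allI Bochner_Integration.integral_cong) (auto simp: indicator_def)
    finally show ?thesis .
  qed
  note tri = triangle_Fubini[OF k_meas \<phi>_meas k0 kc cphi]
  show "set_integrable lborel {0..x} (\<lambda>s. s powr (- 2 * \<alpha>) * (LBINT v:{0..\<rho>}. marchaud_weight \<alpha> v * g (s * v)))"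
    unfolding F_def[symmetric] using tri(2) set_integrable_cong_AE[OF _ _ innerAE] kint_meas by simp
  have "(LBINT s:{0..x}. F s) = (LBINT s:{0..x}. LBINT u:{0..s}. k s u * \<phi> u)"
    using innerAE kint_meas by (intro set_lebesgue_integral_cong_AE) auto
  also have "\<dots> = (LBINT u:{0..\<rho> * x}. r u)" using tri(3) cphi_val by simp
  also have "\<dots> = (\<mu> * (LBINT u:{0..\<rho> * x}. u powr (- 2 * \<alpha>) * g u) - (LBINT u:{0..\<rho> * x}. (x - u) powr (- \<alpha>) * \<phi> u)) / \<alpha>"
    unfolding r_def using Ei Ti by (simp add: set_integral_diff)
  finally show "\<alpha> * (LBINT s:{0..x}. s powr (- 2 * \<alpha>) * (LBINT v:{0..\<rho>}. marchaud_weight \<alpha> v * g (s * v)))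
      = (1 / \<rho> - 1) powr (- \<alpha>) * (LBINT u:{0..\<rho> * x}. u powr (- 2 * \<alpha>) * g u)
        - (LBINT u:{0..\<rho> * x}. (x - u) powr (- \<alpha>) * (u powr (- \<alpha>) * g u))"
    unfolding F_def \<mu>_def \<phi>_def using \<alpha> by (simp add: field_simps)
qed

text \<open>The mass \<open>a\<close> of the cut weight comes from
  \<open>truncated_convolution\<close> itself, with g = 1 and x = 1. Inserting it makes the
  divergent factor (1 / \<rho> - 1) powr (- \<alpha>) multiply only a difference of two quantities
  with the same limit.\<close>

lemma truncated_marchaud:
  fixes g :: "real \<Rightarrow> real"
  assumes \<alpha>: "0 < \<alpha>" "\<alpha> < 1 / 2" and \<rho>: "0 < \<rho>" "\<rho> < 1" and x: "0 < x"
    and g_meas[measurable]: "g \<in> borel_measurable borel" and gM: "\<And>u. u \<in> {0..x} \<Longrightarrow> \<bar>g u\<bar> \<le> M"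
  defines "E \<equiv> \<lambda>y. LBINT u:{0..y}. u powr (- 2 * \<alpha>) * g u"
  shows "\<alpha> * (LBINT s:{0..x}. s powr (- 2 * \<alpha>) * (LBINT v:{0..\<rho>}. marchaud_weight \<alpha> v * (g s - g (s * v))))
      = (1 / \<rho> - 1) powr (- \<alpha>) * (\<rho> powr (1 - 2 * \<alpha>) * E x - E (\<rho> * x))
        - (1 - 2 * \<alpha>) * (LBINT u:{0..\<rho>}. (1 - u) powr (- \<alpha>) * u powr (- \<alpha>)) * E x
        + (LBINT u:{0..\<rho> * x}. (x - u) powr (- \<alpha>) * (u powr (- \<alpha>) * g u))"
proof -
  define a where "a = (LBINT v:{0..\<rho>}. marchaud_weight \<alpha> v)"
  define \<mu> where "\<mu> = (1 / \<rho> - 1) powr (- \<alpha>)"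
  define B where "B = (LBINT u:{0..\<rho>}. (1 - u) powr (- \<alpha>) * u powr (- \<alpha>))"
  have w_int: "set_integrable lborel {0..\<rho>} (marchaud_weight \<alpha>)"
    using \<alpha> \<rho> by (intro marchaud_weight_integrable) auto
  have "\<alpha> * (LBINT s:{0..1}. s powr (- 2 * \<alpha>) * a) = \<mu> * (LBINT u:{0..\<rho>}. u powr (- 2 * \<alpha>)) - B"
    using truncated_convolution(2)[OF \<alpha> \<rho>, of 1 "\<lambda>_. 1" 1] by (simp add: a_def \<mu>_def B_def)
  moreover have "(LBINT s:{0..1}. s powr (- 2 * \<alpha>) * a) = a / (1 - 2 * \<alpha>)"
    using powr_integral_from_0[of "- 2 * \<alpha>" 1] \<alpha> by simp
  moreover have "(LBINT u:{0..\<rho>}. u powr (- 2 * \<alpha>)) = \<rho> powr (1 - 2 * \<alpha>) / (1 - 2 * \<alpha>)"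
    using powr_integral_from_0(2)[of "- 2 * \<alpha>" \<rho>] \<alpha> \<rho> by simp
  ultimately have "\<alpha> * (a / (1 - 2 * \<alpha>)) = \<mu> * (\<rho> powr (1 - 2 * \<alpha>) / (1 - 2 * \<alpha>)) - B"
    by simp
  moreover have "\<alpha> * a = \<mu> * y - p * B" if "\<alpha> * (a / p) = \<mu> * (y / p) - B" "p > 0" for p y :: real
    using that by (simp add: field_simps)
  ultimately have a: "\<alpha> * a = \<mu> * \<rho> powr (1 - 2 * \<alpha>) - (1 - 2 * \<alpha>) * B"
    using \<alpha> by simp
  have Ei: "set_integrable lborel {0..x} (\<lambda>u. u powr (- 2 * \<alpha>) * g u)"
    using \<alpha> x gM by (intro powr_mult_bounded_integrable[where M = M]) auto
  note tc = truncated_convolution[OF \<alpha> \<rho> x g_meas gM]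
  have split: "(LBINT v:{0..\<rho>}. marchaud_weight \<alpha> v * (g s - g (s * v)))
     = a * g s - (LBINT v:{0..\<rho>}. marchaud_weight \<alpha> v * g (s * v))" if s: "s \<in> {0..x}" for s
  proof -
    have "set_integrable lborel {0..\<rho>} (\<lambda>v. marchaud_weight \<alpha> v * g (s * v))"
    proof (rule set_integrable_dominated)
      show "set_integrable lborel {0..\<rho>} (\<lambda>v. marchaud_weight \<alpha> v * M)" using w_int by simp
      fix v assume v: "v \<in> {0..\<rho>}"
      have "s * v \<le> s * 1" using v s \<rho> by (intro mult_left_mono) auto
      then have "s * v \<in> {0..x}" using v s by auto
      then show "\<bar>marchaud_weight \<alpha> v * g (s * v)\<bar> \<le> marchaud_weight \<alpha> v * M"
        using gM[of "s * v"] marchaud_weight_nonneg[of \<alpha> v] by (simp add: abs_mult mult_left_mono)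
    qed simp_all
    then show ?thesis
      unfolding right_diff_distrib a_def using w_int by (subst set_integral_diff) auto
  qed
  have "(LBINT s:{0..x}. s powr (- 2 * \<alpha>) * (LBINT v:{0..\<rho>}. marchaud_weight \<alpha> v * (g s - g (s * v))))
    = (LBINT s:{0..x}. a * (s powr (- 2 * \<alpha>) * g s) - s powr (- 2 * \<alpha>) * (LBINT v:{0..\<rho>}. marchaud_weight \<alpha> v * g (s * v)))"
  proof (rule set_lebesgue_integral_cong)
    show "\<forall>s. s \<in> {0..x} \<longrightarrow> s powr (- 2 * \<alpha>) * (LBINT v:{0..\<rho>}. marchaud_weight \<alpha> v * (g s - g (s * v)))
        = a * (s powr (- 2 * \<alpha>) * g s) - s powr (- 2 * \<alpha>) * (LBINT v:{0..\<rho>}. marchaud_weight \<alpha> v * g (s * v))"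
    proof (intro allI impI)
      fix s assume s: "s \<in> {0..x}"
      show "s powr (- 2 * \<alpha>) * (LBINT v:{0..\<rho>}. marchaud_weight \<alpha> v * (g s - g (s * v)))
        = a * (s powr (- 2 * \<alpha>) * g s) - s powr (- 2 * \<alpha>) * (LBINT v:{0..\<rho>}. marchaud_weight \<alpha> v * g (s * v))"
        unfolding split[OF s] by (simp add: algebra_simps)
    qed
  qed simp
  also have "\<dots> = a * E x - (LBINT s:{0..x}. s powr (- 2 * \<alpha>) * (LBINT v:{0..\<rho>}. marchaud_weight \<alpha> v * g (s * v)))"
    unfolding E_def set_integral_mult_right[symmetric]
    by (rule set_integral_diff(2)) (use Ei tc(1) in \<open>simp_all del: mult_minus_left\<close>)
  finally have split': "(LBINT s:{0..x}. s powr (- 2 * \<alpha>) * (LBINT v:{0..\<rho>}. marchaud_weight \<alpha> v * (g s - g (s * v))))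
     = a * E x - (LBINT s:{0..x}. s powr (- 2 * \<alpha>) * (LBINT v:{0..\<rho>}. marchaud_weight \<alpha> v * g (s * v)))" .
  have "\<alpha> * (LBINT s:{0..x}. s powr (- 2 * \<alpha>) * (LBINT v:{0..\<rho>}. marchaud_weight \<alpha> v * (g s - g (s * v))))
     = (\<alpha> * a) * E x - \<alpha> * (LBINT s:{0..x}. s powr (- 2 * \<alpha>) * (LBINT v:{0..\<rho>}. marchaud_weight \<alpha> v * g (s * v)))"
    unfolding split' by (simp add: right_diff_distrib)
  also have "\<dots> = (\<alpha> * a) * E x - (\<mu> * E (\<rho> * x) - (LBINT u:{0..\<rho> * x}. (x - u) powr (- \<alpha>) * (u powr (- \<alpha>) * g u)))"
    using tc(2) by (simp add: \<mu>_def E_def)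
  also have "\<dots> = \<mu> * (\<rho> powr (1 - 2 * \<alpha>) * E x - E (\<rho> * x)) - (1 - 2 * \<alpha>) * B * E x
        + (LBINT u:{0..\<rho> * x}. (x - u) powr (- \<alpha>) * (u powr (- \<alpha>) * g u))"
    unfolding a by (simp add: algebra_simps)
  finally show ?thesis unfolding \<mu>_def B_def .
qed

lemma set_integral_Icc_tendsto:
  fixes f :: "real \<Rightarrow> real"
  assumes f: "set_integrable lborel {0..x} f" and "0 \<le> x"
    and \<rho>: "\<rho> \<longlonglongrightarrow> 1" "\<And>n. 0 \<le> \<rho> n" "\<And>n. \<rho> n \<le> 1"
  shows "(\<lambda>n. LBINT u:{0..\<rho> n * x}. f u) \<longlonglongrightarrow> (LBINT u:{0..x}. f u)"
proof -
  have in_x: "\<rho> n * x \<in> {0..x}" for n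
    using \<rho> \<open>0 \<le> x\<close> mult_right_mono[of "\<rho> n" 1 x] by auto
  have eq: "(LBINT u:{0..y}. f u) = integral {0..y} f" if "y \<in> {0..x}" for y
    using set_borel_integral_eq_integral(2)[OF set_integrable_subset[OF f, of "{0..y}"]] that by auto
  have "continuous_on {0..x} (\<lambda>y. integral {0..y} f)"
    using set_borel_integral_eq_integral(1)[OF f] by (rule indefinite_integral_continuous_1)
  moreover have "(\<lambda>n. \<rho> n * x) \<longlonglongrightarrow> x"
    using tendsto_mult_right[OF \<rho>(1), of x] by simp
  ultimately have "(\<lambda>n. integral {0..\<rho> n * x} f) \<longlonglongrightarrow> integral {0..x} f"
    using in_x \<open>0 \<le> x\<close> by (auto intro: continuous_on_tendsto_compose)
  then show ?thesis using eq in_x \<open>0 \<le> x\<close> by simp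
qed

lemma set_integral_abs_bound:
  fixes f :: "real \<Rightarrow> real"
  shows "\<bar>LBINT v:A. f v\<bar> \<le> (LBINT v:A. \<bar>f v\<bar>)"
proof -
  have "norm (LBINT v:A. f v) \<le> (\<integral>v. norm (indicator A v *\<^sub>R f v) \<partial>lborel)"
    unfolding set_lebesgue_integral_def by (rule integral_norm_bound)
  then show ?thesis by (simp add: set_lebesgue_integral_def abs_mult)
qed

text \<open>The identity says that \<open>D\<^sup>\<alpha>\<close> of \<open>u powr (- \<alpha>) * g u\<close>, in Marchaud form and up to a factor, is an
  \<open>L\<^sup>1\<close> derivative of the fractional integral of order \<open>1 - \<alpha>\<close>.\<close>

lemma marchaud_integral:
  fixes g :: "real \<Rightarrow> real"
  assumes \<alpha>: "0 < \<alpha>" "\<alpha> < 1 / 2" and x: "0 < x"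
    and g_meas[measurable]: "g \<in> borel_measurable borel" and gM: "\<And>u. u \<in> {0..x} \<Longrightarrow> \<bar>g u\<bar> \<le> M"
    and int1: "AE s in lborel. s \<in> {0..x} \<longrightarrow>
        set_integrable lborel {0..1} (\<lambda>v. marchaud_weight \<alpha> v * (g s - g (s * v)))"
    and int2: "set_integrable lborel {0..x}
        (\<lambda>s. s powr (- 2 * \<alpha>) * (LBINT v:{0..1}. \<bar>marchaud_weight \<alpha> v * (g s - g (s * v))\<bar>))"
  shows "\<alpha> * (LBINT s:{0..x}. s powr (- 2 * \<alpha>) * (LBINT v:{0..1}. marchaud_weight \<alpha> v * (g s - g (s * v))))
      = abel (1 - \<alpha>) (\<lambda>u. u powr (- \<alpha>) * g u) x
        - (1 - 2 * \<alpha>) * Beta (1 - \<alpha>) (1 - \<alpha>) * (LBINT s:{0..x}. s powr (- 2 * \<alpha>) * g s)"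
proof -
  \<comment> \<open>The shift by 2 keeps \<rho> strictly between 0 and 1 also at n = 0.\<close>
  define \<rho> where "\<rho> n = 1 - 1 / (real n + 2)" for n :: nat
  have \<rho>: "0 < \<rho> n" "\<rho> n < 1" for n by (auto simp: \<rho>_def field_simps)
  have "(\<lambda>n. 1 - 1 / (real n + 2)) \<longlonglongrightarrow> 1" by real_asymp
  then have \<rho>_lim: "\<rho> \<longlonglongrightarrow> 1" by (simp add: \<rho>_def[abs_def])
  note tend = set_integral_Icc_tendsto[OF _ _ \<rho>_lim less_imp_le[OF \<rho>(1)] less_imp_le[OF \<rho>(2)]]
  define F where "F s v = marchaud_weight \<alpha> v * (g s - g (s * v))" for s v
  define E where "E y = (LBINT u:{0..y}. u powr (- 2 * \<alpha>) * g u)" for y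
  define B where "B = Beta (1 - \<alpha>) (1 - \<alpha>)"
  define L where "L n = (LBINT s:{0..x}. s powr (- 2 * \<alpha>) * (LBINT v:{0..\<rho> n}. F s v))" for n
  have [measurable]: "case_prod F \<in> borel_measurable (borel \<Otimes>\<^sub>M borel)" unfolding F_def by measurable
  have [measurable]: "(\<lambda>s. LBINT v:{0..c}. F s v) \<in> borel_measurable borel" for c
    by (rule borel_measurable_set_integral) measurable
  have L_lim: "L \<longlonglongrightarrow> (LBINT s:{0..x}. s powr (- 2 * \<alpha>) * (LBINT v:{0..1}. F s v))"
    unfolding L_def set_lebesgue_integral_def[of lborel "{0..x}"]
  proof (rule integral_dominated_convergence)
    show "integrable lborel (\<lambda>s. indicator {0..x} s *\<^sub>R (s powr (- 2 * \<alpha>) * (LBINT v:{0..1}. \<bar>F s v\<bar>)))"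
      using int2 by (simp add: set_integrable_def F_def)
    show "AE s in lborel. (\<lambda>n. indicator {0..x} s *\<^sub>R (s powr (- 2 * \<alpha>) * (LBINT v:{0..\<rho> n}. F s v)))
        \<longlonglongrightarrow> indicator {0..x} s *\<^sub>R (s powr (- 2 * \<alpha>) * (LBINT v:{0..1}. F s v))"
      using int1
    proof eventually_elim
      case (elim s)
      show ?case
      proof (cases "s \<in> {0..x}")
        case True
        then have "set_integrable lborel {0..1} (F s)" using elim by (simp add: F_def[abs_def])
        from tend[OF this] have "(\<lambda>n. LBINT v:{0..\<rho> n}. F s v) \<longlonglongrightarrow> (LBINT v:{0..1}. F s v)" by simp
        then show ?thesis by (intro tendsto_intros)
      qed simp
    qed
    show "AE s in lborel. norm (indicator {0..x} s *\<^sub>R (s powr (- 2 * \<alpha>) * (LBINT v:{0..\<rho> n}. F s v)))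
        \<le> indicator {0..x} s *\<^sub>R (s powr (- 2 * \<alpha>) * (LBINT v:{0..1}. \<bar>F s v\<bar>))" for n
      using int1
    proof eventually_elim
      case (elim s)
      show ?case
      proof (cases "s \<in> {0..x}")
        case True
        then have i: "set_integrable lborel {0..1} (\<lambda>v. \<bar>F s v\<bar>)"
          using elim by (intro set_integrable_abs) (simp add: F_def[abs_def])
        have "\<bar>LBINT v:{0..\<rho> n}. F s v\<bar> \<le> (LBINT v:{0..\<rho> n}. \<bar>F s v\<bar>)" by (rule set_integral_abs_bound)
        also have "\<dots> \<le> (LBINT v:{0..1}. \<bar>F s v\<bar>)"
          unfolding set_lebesgue_integral_def
        proof (rule integral_mono)
          show "integrable lborel (\<lambda>v. indicator {0..\<rho> n} v *\<^sub>R \<bar>F s v\<bar>)"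
            using set_integrable_subset[OF i, of "{0..\<rho> n}"] \<rho>[of n] by (simp add: set_integrable_def)
          show "integrable lborel (\<lambda>v. indicator {0..1} v *\<^sub>R \<bar>F s v\<bar>)"
            using i by (simp add: set_integrable_def)
          show "indicator {0..\<rho> n} v *\<^sub>R \<bar>F s v\<bar> \<le> indicator {0..1} v *\<^sub>R \<bar>F s v\<bar>" for v
            using \<rho>[of n] by (auto simp: indicator_def)
        qed
        finally show ?thesis using True by (simp add: abs_mult mult_left_mono)
      qed simp
    qed
  qed measurable
  have E_int: "set_integrable lborel {0..y} (\<lambda>u. u powr (- 2 * \<alpha>) * g u)" if "y \<in> {0..x}" for y
    using \<alpha> that gM by (intro powr_mult_bounded_integrable[where M = M]) auto
  have L_eq: "\<alpha> * L n = (1 / \<rho> n - 1) powr (- \<alpha>) * (\<rho> n powr (1 - 2 * \<alpha>) * E x - E (\<rho> n * x))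
        - (1 - 2 * \<alpha>) * (LBINT u:{0..\<rho> n * 1}. (1 - u) powr (- \<alpha>) * u powr (- \<alpha>)) * E x
        + (LBINT u:{0..\<rho> n * x}. (x - u) powr (- \<alpha>) * (u powr (- \<alpha>) * g u))" for n
    using truncated_marchaud[OF \<alpha> \<rho> x g_meas gM] by (simp add: L_def F_def E_def)
  have B: "set_integrable lborel {0..1} (\<lambda>u. (1 - u) powr (- \<alpha>) * u powr (- \<alpha>))"
    "(LBINT u:{0..1}. (1 - u) powr (- \<alpha>) * u powr (- \<alpha>)) = B"
    using Beta_integral[of "1 - \<alpha>" "1 - \<alpha>"] \<alpha> by (auto simp: mult.commute B_def)
  have "(\<lambda>n. LBINT u:{0..\<rho> n * 1}. (1 - u) powr (- \<alpha>) * u powr (- \<alpha>)) \<longlonglongrightarrow> B"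
    unfolding B(2)[symmetric] by (rule tend[OF B(1)]) simp
  moreover have "(\<lambda>n. LBINT u:{0..\<rho> n * x}. (x - u) powr (- \<alpha>) * (u powr (- \<alpha>) * g u))
      \<longlonglongrightarrow> (LBINT u:{0..x}. (x - u) powr (- \<alpha>) * (u powr (- \<alpha>) * g u))"
    by (rule tend[OF Beta_mult_bounded_integrable[OF _ _ _ gM]]) (use \<alpha> x in simp_all)
  \<comment> \<open>The first factor grows like (1 - \<rho>) powr (- \<alpha>), the second is of
    order 1 - \<rho>, and \<alpha> < 1.\<close>
  moreover have "(\<lambda>n. (1 / \<rho> n - 1) powr (- \<alpha>) * (\<rho> n powr (1 - 2 * \<alpha>) * E x - E (\<rho> n * x))) \<longlonglongrightarrow> 0"
  proof (rule Lim_null_comparison)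
    define C where "C = 2 * (M * (x powr (1 - 2 * \<alpha>) / (1 - 2 * \<alpha>)))"
    have M: "0 \<le> M" using gM[of 0] x by force
    have Eb: "\<bar>LBINT u:{a..x}. u powr (- 2 * \<alpha>) * g u\<bar> \<le> M * (LBINT u:{a..x}. u powr (- 2 * \<alpha>))"
      if a: "0 \<le> a" "a \<le> x" for a
    proof -
      have i: "set_integrable lborel {a..x} (\<lambda>u. u powr (- 2 * \<alpha>))"
        "set_integrable lborel {a..x} (\<lambda>u. u powr (- 2 * \<alpha>) * g u)"
        using set_integrable_subset[OF powr_integral_from_0(1)[of "- 2 * \<alpha>" x], of "{a..x}"]
          set_integrable_subset[OF E_int[of x], of "{a..x}"] \<alpha> x a by auto
      have "\<bar>LBINT u:{a..x}. u powr (- 2 * \<alpha>) * g u\<bar> \<le> (LBINT u:{a..x}. \<bar>u powr (- 2 * \<alpha>) * g u\<bar>)"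
        by (rule set_integral_abs_bound)
      also have "\<dots> \<le> (LBINT u:{a..x}. M * u powr (- 2 * \<alpha>))"
      proof (rule set_integral_mono)
        fix u assume "u \<in> {a..x}"
        then have "\<bar>g u\<bar> \<le> M" using gM[of u] a by simp
        then show "\<bar>u powr (- 2 * \<alpha>) * g u\<bar> \<le> M * u powr (- 2 * \<alpha>)"
          by (simp add: abs_mult mult.commute mult_right_mono)
      qed (use i in \<open>simp_all add: set_integrable_abs\<close>)
      finally show ?thesis by simp
    qed
    have diff: "(LBINT u:{0..x}. f u) - (LBINT u:{0..a}. f u) = (LBINT u:{a..x}. f u)"
      if "set_integrable lborel {0..x} f" "0 \<le> a" "a \<le> x" for f :: "real \<Rightarrow> real" and a
    proof -
      have "(LBINT u:{0..a} \<union> {a..x}. f u) = (LBINT u:{0..a}. f u) + (LBINT u:{a..x}. f u)"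
        using that AE_lborel_singleton[of a]
        by (intro set_integral_Un_AE) (auto elim!: set_integrable_subset eventually_mono)
      moreover have "{0..a} \<union> {a..x} = {0..x}" using that by auto
      ultimately show ?thesis by simp
    qed
    \<comment> \<open>The expression is E x - E (\<rho> x) minus (1 - \<rho> powr (1 - 2 *
      \<alpha>)) * E x. Each part is at most M I d with d = 1 - \<rho> powr (1 - 2 * \<alpha>),
      which explains the factor 2 in \<open>C\<close>; and d \<le> 1 - \<rho> since \<rho> \<le>
      \<rho> powr (1 - 2 * \<alpha>).\<close>
    have bound: "\<bar>\<rho> n powr (1 - 2 * \<alpha>) * E x - E (\<rho> n * x)\<bar> \<le> C * (1 - \<rho> n)" for n
    proof -
      define y where "y = \<rho> n * x"
      have y: "0 \<le> y" "y \<le> x" using \<rho>[of n] x mult_right_mono[of "\<rho> n" 1 x] by (auto simp: y_def)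
      define I where "I = x powr (1 - 2 * \<alpha>) / (1 - 2 * \<alpha>)"
      define d where "d = 1 - \<rho> n powr (1 - 2 * \<alpha>)"
      have p: "1 - 2 * \<alpha> > 0" using \<alpha> by simp
      have "\<rho> n = \<rho> n powr 1" using \<rho>[of n] by simp
      also have "\<rho> n powr 1 \<le> \<rho> n powr (1 - 2 * \<alpha>)" using \<rho>[of n] \<alpha> by (intro powr_mono') auto
      finally have d: "d \<le> 1 - \<rho> n" by (simp add: d_def)
      have "\<rho> n powr (1 - 2 * \<alpha>) \<le> 1 powr (1 - 2 * \<alpha>)" using \<rho>[of n] \<alpha> by (intro powr_mono2) auto
      then have d0: "0 \<le> d" by (simp add: d_def)
      have I0: "0 \<le> I" using p by (simp add: I_def)
      have P: "(LBINT u:{0..z}. u powr (- 2 * \<alpha>)) = z powr (1 - 2 * \<alpha>) / (1 - 2 * \<alpha>)" if "0 \<le> z" for z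
        using powr_integral_from_0(2)[of "- 2 * \<alpha>" z] \<alpha> that by simp
      have Ex: "\<bar>E x\<bar> \<le> M * I" using Eb[of 0] x P[of x] by (simp add: E_def I_def)
      have "(LBINT u:{y..x}. u powr (- 2 * \<alpha>)) = I - y powr (1 - 2 * \<alpha>) / (1 - 2 * \<alpha>)"
        using diff[OF powr_integral_from_0(1)[of "- 2 * \<alpha>" x] y] \<alpha> x P[of x] P[of y] y by (simp add: I_def)
      also have "y powr (1 - 2 * \<alpha>) = \<rho> n powr (1 - 2 * \<alpha>) * x powr (1 - 2 * \<alpha>)"
        using \<rho>[of n] x by (simp add: y_def powr_mult)
      also have "I - \<rho> n powr (1 - 2 * \<alpha>) * x powr (1 - 2 * \<alpha>) / (1 - 2 * \<alpha>) = I * d"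
        by (simp add: I_def d_def right_diff_distrib mult.commute diff_divide_distrib)
      finally have "\<bar>E x - E y\<bar> \<le> M * (I * d)"
        using Eb[of y] y diff[OF E_int[of x] y] x by (simp add: E_def)
      moreover have "\<bar>d * E x\<bar> \<le> d * (M * I)"
        using d0 Ex by (simp add: abs_mult mult_left_mono)
      moreover have "\<rho> n powr (1 - 2 * \<alpha>) * E x - E y = (E x - E y) - d * E x"
        by (simp add: d_def algebra_simps)
      ultimately have "\<bar>\<rho> n powr (1 - 2 * \<alpha>) * E x - E y\<bar> \<le> M * (I * d) + d * (M * I)"
        by linarith
      also have "\<dots> = C * d" by (simp add: C_def I_def)
      also have "\<dots> \<le> C * (1 - \<rho> n)"
        using d M I0 by (intro mult_left_mono) (auto simp: C_def I_def[symmetric])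
      finally show ?thesis by (simp add: y_def)
    qed
    show "\<forall>\<^sub>F n in sequentially. norm ((1 / \<rho> n - 1) powr (- \<alpha>) * (\<rho> n powr (1 - 2 * \<alpha>) * E x - E (\<rho> n * x)))
        \<le> (1 / \<rho> n - 1) powr (- \<alpha>) * (C * (1 - \<rho> n))"
      using bound by (auto simp: abs_mult intro!: always_eventually mult_left_mono)
    have "(\<lambda>n. (1 / (1 - 1 / (real n + 2)) - 1) powr (- \<alpha>) * (C * (1 - (1 - 1 / (real n + 2))))) \<longlonglongrightarrow> 0"
      using \<alpha> by real_asymp
    then show "(\<lambda>n. (1 / \<rho> n - 1) powr (- \<alpha>) * (C * (1 - \<rho> n))) \<longlonglongrightarrow> 0"
      by (simp only: \<rho>_def)
  qed
  ultimately have "(\<lambda>n. \<alpha> * L n) \<longlonglongrightarrow> 0 - (1 - 2 * \<alpha>) * B * E x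
      + (LBINT u:{0..x}. (x - u) powr (- \<alpha>) * (u powr (- \<alpha>) * g u))"
    unfolding L_eq by (intro tendsto_intros)
  then have "\<alpha> * (LBINT s:{0..x}. s powr (- 2 * \<alpha>) * (LBINT v:{0..1}. F s v)) = 0 - (1 - 2 * \<alpha>) * B * E x
      + (LBINT u:{0..x}. (x - u) powr (- \<alpha>) * (u powr (- \<alpha>) * g u))"
    by (rule LIMSEQ_unique[OF tendsto_mult_left[OF L_lim]])
  then show ?thesis by (simp add: F_def B_def E_def abel_def)
qed

text \<open>This is s powr \<alpha> times the derivative of the Abel transform of order 1 - \<alpha>
  of u powr (- \<alpha>) * g u, as \<open>marchaud_integral\<close> exhibits it. The first term is
  the value for constant \<open>g\<close>: the transform of u powr (- \<alpha>) is Beta (1 -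
  \<alpha>) (1 - \<alpha>) * x powr (1 - 2 * \<alpha>). The second term measures the deviation from
  a constant.\<close>

definition volterra_preimage_gt :: "real \<Rightarrow> (real \<Rightarrow> real) \<Rightarrow> real \<Rightarrow> real" where
  "volterra_preimage_gt \<alpha> g s = s powr (- \<alpha>) * ((1 - 2 * \<alpha>) * Beta (1 - \<alpha>) (1 - \<alpha>) * g s
     + \<alpha> * (LBINT v:{0..1}. marchaud_weight \<alpha> v * (g s - g (s * v))))"

text \<open>Put \<psi> s = s powr (- \<alpha>) * q s and \<phi> u = u powr (- \<alpha>) * g u. By
  \<open>marchaud_integral\<close> the primitive of \<psi> is
  \<open>abel (1 - \<alpha>) \<phi>\<close>, and by \<open>abel_abel\<close> it is also, up to the
  factor Beta \<alpha> (1 - \<alpha>), the transform of order 1 - \<alpha> of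
  \<open>abel \<alpha> \<psi>\<close>. Injectivity of that transform identifies
  \<open>abel \<alpha> \<psi>\<close> with a multiple of \<phi>, which \<open>K_op_gt\<close> turns
  into the primitive of \<open>g\<close>.\<close>

lemma volterra_preimage_gt:
  fixes g :: "real \<Rightarrow> real"
  assumes H: "H = \<alpha> + 1 / 2" and \<alpha>: "0 < \<alpha>" "\<alpha> < 1 / 2"
    and g_meas[measurable]: "g \<in> borel_measurable borel" and gM: "\<And>u. u \<in> {0..T} \<Longrightarrow> \<bar>g u\<bar> \<le> M"
    and int1: "AE s in lborel. s \<in> {0..T} \<longrightarrow>
        set_integrable lborel {0..1} (\<lambda>v. marchaud_weight \<alpha> v * (g s - g (s * v)))"
    and int2: "set_integrable lborel {0..T}
        (\<lambda>s. (s powr (- \<alpha>) * (LBINT v:{0..1}. \<bar>marchaud_weight \<alpha> v * (g s - g (s * v))\<bar>))\<^sup>2)"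
  defines "q \<equiv> volterra_preimage_gt \<alpha> g"
  shows "q \<in> borel_measurable borel" and "q \<in> L2 T"
    and "\<And>t. t \<in> {0..T} \<Longrightarrow> K_op H q t = volterra_const H * Beta \<alpha> (1 - \<alpha>) * (LBINT u:{0..t}. g u)"
proof -
  define F where "F s v = marchaud_weight \<alpha> v * (g s - g (s * v))" for s v
  define D where "D s = (LBINT v:{0..1}. \<bar>F s v\<bar>)" for s
  define I where "I s = (LBINT v:{0..1}. F s v)" for s
  define \<kappa> where "\<kappa> = (1 - 2 * \<alpha>) * Beta (1 - \<alpha>) (1 - \<alpha>)"
  have [measurable]: "case_prod F \<in> borel_measurable (borel \<Otimes>\<^sub>M borel)" unfolding F_def by measurable
  have [measurable]: "I \<in> borel_measurable borel" "D \<in> borel_measurable borel"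
    unfolding I_def D_def by (rule borel_measurable_set_integral; measurable)+
  have q: "q s = s powr (- \<alpha>) * (\<kappa> * g s + \<alpha> * I s)" for s
    by (simp add: q_def volterra_preimage_gt_def \<kappa>_def I_def F_def)
  show q_meas[measurable]: "q \<in> borel_measurable borel" unfolding q by measurable
  have D2: "set_integrable lborel {0..T} (\<lambda>s. (s powr (- \<alpha>) * D s)\<^sup>2)"
    using int2 by (simp add: D_def F_def)
  have ID: "\<bar>I s\<bar> \<le> D s" for s unfolding I_def D_def by (rule set_integral_abs_bound)
  have q2: "set_integrable lborel {0..t} (\<lambda>s. (q s)\<^sup>2)" if t: "t \<in> {0..T}" for t
  proof (rule set_integrable_dominated)
    have "set_integrable lborel {0..t} (\<lambda>s. s powr (- 2 * \<alpha>))"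
      using \<alpha> t by (intro powr_integral_from_0) auto
    moreover have "set_integrable lborel {0..t} (\<lambda>s. (s powr (- \<alpha>) * D s)\<^sup>2)"
      using set_integrable_subset[OF D2, of "{0..t}"] t by auto
    ultimately show "set_integrable lborel {0..t} (\<lambda>s. 2 * ((\<kappa> * M)\<^sup>2 * s powr (- 2 * \<alpha>)) + 2 * (\<alpha>\<^sup>2 * (s powr (- \<alpha>) * D s)\<^sup>2))"
      by (intro set_integral_add(1) set_integrable_mult_right)
    fix s assume s: "s \<in> {0..t}"
    have "(q s)\<^sup>2 \<le> 2 * (s powr (- \<alpha>) * (\<kappa> * g s))\<^sup>2 + 2 * (s powr (- \<alpha>) * (\<alpha> * I s))\<^sup>2"
      unfolding q distrib_left by (rule square_add_le)
    also have "(s powr (- \<alpha>) * (\<kappa> * g s))\<^sup>2 \<le> (\<kappa> * M)\<^sup>2 * s powr (- 2 * \<alpha>)"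
    proof -
      have "(\<kappa> * g s)\<^sup>2 \<le> (\<kappa> * M)\<^sup>2"
        unfolding power_mult_distrib using gM[of s] s t
        by (intro mult_left_mono) (auto simp: abs_le_square_iff[symmetric])
      moreover have "(s powr (- \<alpha>) * (\<kappa> * g s))\<^sup>2 = (\<kappa> * g s)\<^sup>2 * s powr (- 2 * \<alpha>)"
        by (simp add: power_mult_distrib power2_eq_square powr_add[symmetric])
      ultimately show ?thesis by (simp add: mult_right_mono)
    qed
    also have "(s powr (- \<alpha>) * (\<alpha> * I s))\<^sup>2 \<le> \<alpha>\<^sup>2 * (s powr (- \<alpha>) * D s)\<^sup>2"
    proof -
      have "(I s)\<^sup>2 \<le> (D s)\<^sup>2" using ID[of s] by (simp add: abs_le_square_iff[symmetric])
      then have "\<alpha>\<^sup>2 * ((s powr (- \<alpha>))\<^sup>2 * (I s)\<^sup>2) \<le> \<alpha>\<^sup>2 * ((s powr (- \<alpha>))\<^sup>2 * (D s)\<^sup>2)"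
        by (intro mult_left_mono) auto
      then show ?thesis by (simp add: power_mult_distrib mult.left_commute)
    qed
    finally show "\<bar>(q s)\<^sup>2\<bar> \<le> 2 * ((\<kappa> * M)\<^sup>2 * s powr (- 2 * \<alpha>)) + 2 * (\<alpha>\<^sup>2 * (s powr (- \<alpha>) * D s)\<^sup>2)"
      by simp
  qed simp_all
  show "q \<in> L2 T"
  proof (cases "0 \<le> T")
    case True
    then show ?thesis using q2[of T] by (intro L2I) auto
  qed (intro L2I, auto)
  fix t assume t: "t \<in> {0..T}"
  define \<psi> where "\<psi> s = s powr (- \<alpha>) * q s" for s
  define \<phi> where "\<phi> u = u powr (- \<alpha>) * g u" for u
  have [measurable]: "\<psi> \<in> borel_measurable borel" unfolding \<psi>_def by measurable
  have [measurable]: "\<phi> \<in> borel_measurable borel" unfolding \<phi>_def by measurable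
  have \<psi>: "\<psi> s = \<kappa> * (s powr (- 2 * \<alpha>) * g s) + \<alpha> * (s powr (- 2 * \<alpha>) * I s)" for s
  proof -
    have "s powr (- 2 * \<alpha>) = s powr (- \<alpha>) * s powr (- \<alpha>)" by (simp add: powr_add[symmetric])
    then show ?thesis by (simp add: \<psi>_def q algebra_simps)
  qed
  have \<psi>_int: "set_integrable lborel {0..x} \<psi>" if "x \<in> {0..T}" for x
    unfolding \<psi>_def by (rule L2_powr_integrable[OF q_meas q2[OF that] \<alpha>(2)])
  have \<psi>_val: "(LBINT s:{0..x}. \<psi> s) = abel (1 - \<alpha>) \<phi> x" if x: "x \<in> {0..T}" for x
  proof (cases "x = 0")
    case True
    then show ?thesis by (simp add: abel_def set_integral_at_point \<psi>_def \<phi>_def)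
  next
    case False
    \<comment> \<open>One factor s powr (- \<alpha>) is needed to make \<open>D\<close> square
      integrable by \<open>int2\<close>; the other one is in L2 because \<alpha> < 1/2.\<close>
    have D1: "set_integrable lborel {0..x} (\<lambda>s. s powr (- 2 * \<alpha>) * D s)"
    proof -
      have "set_integrable lborel {0..x} (\<lambda>s. s powr (- \<alpha>) * (s powr (- \<alpha>) * D s))"
        using \<alpha> set_integrable_subset[OF D2, of "{0..x}"] x by (intro L2_powr_integrable) auto
      moreover have "(\<lambda>s. s powr (- 2 * \<alpha>) * D s) = (\<lambda>s. s powr (- \<alpha>) * (s powr (- \<alpha>) * D s))"
        by (simp add: fun_eq_iff mult.assoc[symmetric] powr_add[symmetric])
      ultimately show ?thesis by (simp only:)
    qed
    have I1: "set_integrable lborel {0..x} (\<lambda>s. s powr (- 2 * \<alpha>) * I s)"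
      by (rule set_integrable_dominated[OF D1]) (use ID in \<open>simp_all add: abs_mult mult_left_mono\<close>)
    have g1: "set_integrable lborel {0..x} (\<lambda>s. s powr (- 2 * \<alpha>) * g s)"
      using \<alpha> x gM by (intro powr_mult_bounded_integrable[where M = M]) auto
    have "\<alpha> * (LBINT s:{0..x}. s powr (- 2 * \<alpha>) * I s)
        = abel (1 - \<alpha>) \<phi> x - \<kappa> * (LBINT s:{0..x}. s powr (- 2 * \<alpha>) * g s)"
      unfolding I_def F_def \<phi>_def \<kappa>_def
    proof (rule marchaud_integral[OF \<alpha> _ g_meas])
      show "\<bar>g u\<bar> \<le> M" if "u \<in> {0..x}" for u using that x gM[of u] by simp
      show "AE s in lborel. s \<in> {0..x} \<longrightarrow>
        set_integrable lborel {0..1} (\<lambda>v. marchaud_weight \<alpha> v * (g s - g (s * v)))"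
        using int1 by eventually_elim (use x in auto)
      show "set_integrable lborel {0..x}
          (\<lambda>s. s powr (- 2 * \<alpha>) * (LBINT v:{0..1}. \<bar>marchaud_weight \<alpha> v * (g s - g (s * v))\<bar>))"
        using D1 unfolding D_def F_def .
    qed (use False x in auto)
    moreover have "(LBINT s:{0..x}. \<psi> s) = \<kappa> * (LBINT s:{0..x}. s powr (- 2 * \<alpha>) * g s)
        + \<alpha> * (LBINT s:{0..x}. s powr (- 2 * \<alpha>) * I s)"
      unfolding \<psi> set_integral_mult_right[symmetric]
      by (rule set_integral_add(2)) (use g1 I1 in \<open>simp_all del: mult_minus_left\<close>)
    ultimately show ?thesis by simp
  qed
  have \<phi>_int: "set_integrable lborel {0..x} \<phi>" if "x \<in> {0..T}" for x
    unfolding \<phi>_def using \<alpha> that gM by (intro powr_mult_bounded_integrable[where M = M]) auto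
  define b where "b = Beta \<alpha> (1 - \<alpha>)"
  have tT: "x \<in> {0..t} \<Longrightarrow> x \<in> {0..T}" for x using t by auto
  \<comment> \<open>Both functions have the same transform of order 1 - \<alpha>, so their
    difference vanishes almost everywhere.\<close>
  have "AE s in lborel. s \<in> {0..t} \<longrightarrow> abel \<alpha> \<psi> s - b * \<phi> s = 0"
  proof (rule AE_eq_0_if_abel_eq_0[of _ t "1 - \<alpha>"])
    show "set_integrable lborel {0..t} (\<lambda>s. abel \<alpha> \<psi> s - b * \<phi> s)"
      using t \<alpha> by (intro set_integral_diff(1) abel_integrable \<psi>_int set_integrable_mult_right \<phi>_int) auto
    show "AE x in lborel. x \<in> {0..t} \<longrightarrow> abel (1 - \<alpha>) (\<lambda>s. abel \<alpha> \<psi> s - b * \<phi> s) x = 0"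
    proof (intro AE_I2 impI)
      fix x assume "x \<in> {0..t}"
      then have x: "x \<in> {0..T}" by (rule tT)
      have ii: "set_integrable lborel {0..x} (\<lambda>s. (x - s) powr (- \<alpha>) * abel \<alpha> \<psi> s)"
        and vv: "abel (1 - \<alpha>) (abel \<alpha> \<psi>) x = b * (LBINT u:{0..x}. \<psi> u)"
        using abel_abel[of \<psi> x \<alpha>] \<psi>_int[OF x] \<alpha> by (auto simp: b_def)
      have jj: "set_integrable lborel {0..x} (\<lambda>s. (x - s) powr (- \<alpha>) * \<phi> s)"
        unfolding \<phi>_def
      proof (rule Beta_mult_bounded_integrable)
        show "\<bar>g u\<bar> \<le> M" if "u \<in> {0..x}" for u using that x gM[of u] by simp
      qed (use x \<alpha> in auto)
      have "abel (1 - \<alpha>) (\<lambda>s. abel \<alpha> \<psi> s - b * \<phi> s) x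
        = (LBINT s:{0..x}. (x - s) powr (- \<alpha>) * abel \<alpha> \<psi> s - b * ((x - s) powr (- \<alpha>) * \<phi> s))"
        unfolding abel_def[of "1 - \<alpha>"] by (simp add: algebra_simps)
      also have "\<dots> = abel (1 - \<alpha>) (abel \<alpha> \<psi>) x - b * abel (1 - \<alpha>) \<phi> x"
        unfolding abel_def[of "1 - \<alpha>"] using ii jj by (simp add: set_integral_diff(2))
      finally show "abel (1 - \<alpha>) (\<lambda>s. abel \<alpha> \<psi> s - b * \<phi> s) x = 0"
        using \<psi>_val[OF x] vv by simp
    qed
  qed (use \<alpha> in simp_all)
  then have ae: "AE s\<in>{0..t} in lborel. s powr \<alpha> * abel \<alpha> \<psi> s = b * g s"
    using AE_lborel_singleton[of 0]
  proof eventually_elim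
    case (elim s)
    show ?case
    proof
      assume s: "s \<in> {0..t}"
      have "s powr \<alpha> * s powr (- \<alpha>) = 1" using s elim(2) by (simp add: powr_add[symmetric])
      moreover have "s powr \<alpha> * (b * \<phi> s) = (s powr \<alpha> * s powr (- \<alpha>)) * (b * g s)"
        by (simp add: \<phi>_def)
      moreover have "abel \<alpha> \<psi> s = b * \<phi> s" using elim(1) s by simp
      ultimately show "s powr \<alpha> * abel \<alpha> \<psi> s = b * g s" by simp
    qed
  qed
  have "K_op H q t = volterra_const H * (LBINT u:{0..t}. u powr \<alpha> * abel \<alpha> \<psi> u)"
    unfolding \<psi>_def using t by (intro K_op_gt(2)[OF q_meas q2[OF t] H \<alpha>]) auto
  also have "(LBINT u:{0..t}. u powr \<alpha> * abel \<alpha> \<psi> u) = (LBINT u:{0..t}. b * g u)"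
    using ae by (intro set_lebesgue_integral_cong_AE) auto
  finally show "K_op H q t = volterra_const H * Beta \<alpha> (1 - \<alpha>) * (LBINT u:{0..t}. g u)"
    by (simp add: b_def)
qed

section \<open>Measurability up to null sets\<close>

text \<open>The natural filtration is not completed, while limits in probability, continuity of
  paths and the equation for \<open>X\<close> hold only almost surely. Adaptedness is therefore
  tracked through versions that are measurable for the raw filtration.\<close>

definition ae_measurable :: "'a measure \<Rightarrow> 'a measure \<Rightarrow> ('a \<Rightarrow> real) \<Rightarrow> bool" where
  "ae_measurable M F Y \<longleftrightarrow> (\<exists>Y'\<in>borel_measurable F. AE \<omega> in M. Y \<omega> = Y' \<omega>)"

lemma ae_measurableI: "Y \<in> borel_measurable F \<Longrightarrow> ae_measurable M F Y"
  unfolding ae_measurable_def by (intro bexI[of _ Y]) auto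

lemma ae_measurable_mono:
  fixes Y :: "'a \<Rightarrow> real"
  assumes "ae_measurable M F Y" and FG: "\<And>Y' :: 'a \<Rightarrow> real. Y' \<in> borel_measurable F \<Longrightarrow> Y' \<in> borel_measurable G"
  shows "ae_measurable M G Y"
proof -
  obtain Y' where "Y' \<in> borel_measurable F" "AE \<omega> in M. Y \<omega> = Y' \<omega>"
    using assms(1) unfolding ae_measurable_def by (elim bexE)
  then show ?thesis
    unfolding ae_measurable_def by (intro bexI[of _ Y'] FG)
qed

lemma ae_measurable_compose:
  assumes "ae_measurable M F Y" and [measurable]: "h \<in> borel_measurable borel"
  shows "ae_measurable M F (\<lambda>\<omega>. h (Y \<omega>))"
proof -
  obtain Y' where Y'[measurable]: "Y' \<in> borel_measurable F" and "AE \<omega> in M. Y \<omega> = Y' \<omega>"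
    using assms(1) by (auto simp: ae_measurable_def)
  then have "AE \<omega> in M. h (Y \<omega>) = h (Y' \<omega>)" by auto
  then show ?thesis by (auto simp: ae_measurable_def intro!: bexI[of _ "\<lambda>\<omega>. h (Y' \<omega>)"])
qed

lemma ae_measurable_add:
  assumes "ae_measurable M F Y" "ae_measurable M F Z"
  shows "ae_measurable M F (\<lambda>\<omega>. Y \<omega> + Z \<omega>)"
proof -
  obtain Y' where Y'[measurable]: "Y' \<in> borel_measurable F" and 1: "AE \<omega> in M. Y \<omega> = Y' \<omega>"
    using assms(1) by (auto simp: ae_measurable_def)
  obtain Z' where Z'[measurable]: "Z' \<in> borel_measurable F" and 2: "AE \<omega> in M. Z \<omega> = Z' \<omega>"
    using assms(2) by (auto simp: ae_measurable_def)
  from 1 2 have "AE \<omega> in M. Y \<omega> + Z \<omega> = Y' \<omega> + Z' \<omega>" by eventually_elim simp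
  then show ?thesis by (auto simp: ae_measurable_def intro!: bexI[of _ "\<lambda>\<omega>. Y' \<omega> + Z' \<omega>"])
qed

lemma ae_measurable_cmult:
  assumes "ae_measurable M F Y"
  shows "ae_measurable M F (\<lambda>\<omega>. c * Y \<omega>)"
  using assms by (rule ae_measurable_compose) simp

lemma ae_measurable_diff:
  assumes "ae_measurable M F Y" "ae_measurable M F Z"
  shows "ae_measurable M F (\<lambda>\<omega>. Y \<omega> - Z \<omega>)"
  using ae_measurable_add[OF assms(1) ae_measurable_cmult[OF assms(2), of "-1"]] by simp

lemma ae_measurable_sum:
  assumes "finite I" "\<And>i. i \<in> I \<Longrightarrow> ae_measurable M F (Y i)"
  shows "ae_measurable M F (\<lambda>\<omega>. \<Sum>i\<in>I. Y i \<omega>)"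
  using assms by (induction I rule: finite_induct) (auto intro: ae_measurableI ae_measurable_add)

text \<open>Countably many null sets can be discarded at once, so versions are chosen for all
  indices simultaneously. The total function \<open>lim\<close> keeps the limit of the versions
  measurable even where they diverge.\<close>

lemma ae_measurable_lim:
  assumes "\<And>k::nat. ae_measurable M F (Y k)" and lim: "AE \<omega> in M. (\<lambda>k. Y k \<omega>) \<longlonglongrightarrow> Z \<omega>"
  shows "ae_measurable M F Z"
proof -
  obtain Y' where Y': "\<And>k. Y' k \<in> borel_measurable F" "\<And>k. AE \<omega> in M. Y k \<omega> = Y' k \<omega>"
    using assms(1) unfolding ae_measurable_def by metis
  have "AE \<omega> in M. \<forall>k. Y k \<omega> = Y' k \<omega>" using Y'(2) by (simp add: AE_all_countable)
  then have "AE \<omega> in M. Z \<omega> = lim (\<lambda>k. Y' k \<omega>)"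
    using lim by eventually_elim (simp add: limI)
  moreover have "(\<lambda>\<omega>. lim (\<lambda>k. Y' k \<omega>)) \<in> borel_measurable F"
    by (rule borel_measurable_lim_metric) (rule Y'(1))
  ultimately show ?thesis by (auto simp: ae_measurable_def)
qed

lemma floor_fraction_tendsto: "(\<lambda>n. real_of_int \<lfloor>real (Suc n) * v\<rfloor> / real (Suc n)) \<longlonglongrightarrow> v"
proof (rule tendsto_sandwich)
  have l: "real_of_int \<lfloor>real (Suc n) * v\<rfloor> / real (Suc n) \<in> {v - 1 / real (Suc n)..v}" for n
  proof -
    have "real (Suc n) * v - 1 \<le> real_of_int \<lfloor>real (Suc n) * v\<rfloor>" "real_of_int \<lfloor>real (Suc n) * v\<rfloor> \<le> real (Suc n) * v"
      by linarith+
    moreover have "v - 1 / N \<le> y / N \<and> y / N \<le> v" if "N > 0" "N * v - 1 \<le> y" "y \<le> N * v" for N y :: real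
    proof -
      have "v - 1 / N = (N * v - 1) / N" "v = (N * v) / N" using that by (auto simp: diff_divide_distrib)
      then show ?thesis using that by (metis divide_right_mono less_imp_le)
    qed
    ultimately show ?thesis by (auto simp del: of_nat_Suc)
  qed
  show "\<forall>\<^sub>F n in sequentially. v - 1 / real (Suc n) \<le> real_of_int \<lfloor>real (Suc n) * v\<rfloor> / real (Suc n)"
    "\<forall>\<^sub>F n in sequentially. real_of_int \<lfloor>real (Suc n) * v\<rfloor> / real (Suc n) \<le> v"
    using l by (auto simp del: of_nat_Suc)
  show "(\<lambda>n. v - 1 / real (Suc n)) \<longlonglongrightarrow> v"
    using tendsto_diff[OF tendsto_const lim_inverse_n'[THEN LIMSEQ_Suc], of v] by simp
qed simp

text \<open>Each \<open>Z v\<close> has its own version and nothing is known jointly in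
  \<open>v\<close>, so the integral cannot be treated by Fubini. Continuity of the paths makes it
  the limit of the finite sums in which \<open>Z\<close> is frozen at the grid point below
  \<open>v\<close>; \<open>w\<close> is integrated exactly over each cell, so it may be
  singular.\<close>

lemma ae_measurable_integral:
  fixes Z :: "real \<Rightarrow> 'a \<Rightarrow> real"
  assumes w: "set_integrable lborel {0..1} w" and w_meas[measurable]: "w \<in> borel_measurable borel"
    and Z: "\<And>v. v \<in> {0..1} \<Longrightarrow> ae_measurable M F (Z v)"
    and cont: "AE \<omega> in M. continuous_on {0..1} (\<lambda>v. Z v \<omega>)"
  shows "ae_measurable M F (\<lambda>\<omega>. LBINT v:{0..1}. w v * Z v \<omega>)"
proof (rule ae_measurable_lim)
  define fl where "fl n v = real_of_int \<lfloor>real (Suc n) * v\<rfloor> / real (Suc n)" for n v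
  have [measurable]: "fl n \<in> borel_measurable borel" for n unfolding fl_def by measurable
  have fl01: "fl n v \<in> {0..1}" if "v \<in> {0..1}" for n v
  proof -
    have "0 \<le> \<lfloor>real (Suc n) * v\<rfloor>" using that by simp
    moreover have "real (Suc n) * v \<le> real (Suc n) * 1" using that by (intro mult_left_mono) auto
    then have "real_of_int \<lfloor>real (Suc n) * v\<rfloor> \<le> real (Suc n)"
      using of_int_floor_le[of "real (Suc n) * v"] by (simp only: mult_1_right)
    ultimately show ?thesis by (simp add: fl_def del: of_nat_Suc)
  qed
  define c where "c n i = (LBINT v:{0..1}. w v * (if \<lfloor>real (Suc n) * v\<rfloor> = int i then 1 else 0))" for n i
  \<comment> \<open>The index reaches \<open>Suc n\<close> because the floor takes that value at v =
    1.\<close>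
  define R where "R n \<omega> = (\<Sum>i\<le>Suc n. c n i * Z (real i / real (Suc n)) \<omega>)" for n \<omega>
  show "ae_measurable M F (R n)" for n
    unfolding R_def
    by (intro ae_measurable_sum ae_measurable_cmult Z) (auto simp: field_simps)
  have R: "R n \<omega> = (LBINT v:{0..1}. w v * Z (fl n v) \<omega>)" for n \<omega>
  proof -
    have i: "set_integrable lborel {0..1} (\<lambda>v. w v * (if \<lfloor>real (Suc n) * v\<rfloor> = int i then 1 else 0) * Z (real i / real (Suc n)) \<omega>)" for i
    proof (rule set_integrable_mult_left)
      show "set_integrable lborel {0..1} (\<lambda>v. w v * (if \<lfloor>real (Suc n) * v\<rfloor> = int i then 1 else 0))"
        by (rule set_integrable_dominated[OF set_integrable_abs[OF w]]) auto
    qed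
    have "R n \<omega> = (\<Sum>i\<le>Suc n. (LBINT v:{0..1}. w v * (if \<lfloor>real (Suc n) * v\<rfloor> = int i then 1 else 0) * Z (real i / real (Suc n)) \<omega>))"
      by (simp add: R_def c_def)
    also have "\<dots> = (LBINT v:{0..1}. (\<Sum>i\<le>Suc n. w v * (if \<lfloor>real (Suc n) * v\<rfloor> = int i then 1 else 0) * Z (real i / real (Suc n)) \<omega>))"
      unfolding set_lebesgue_integral_def scaleR_sum_right
      by (rule Bochner_Integration.integral_sum[symmetric]) (use i in \<open>simp add: set_integrable_def\<close>)
    also have "\<dots> = (LBINT v:{0..1}. w v * Z (fl n v) \<omega>)"
    proof (rule set_lebesgue_integral_cong)
      show "\<forall>v. v \<in> {0..1} \<longrightarrow> (\<Sum>i\<le>Suc n. w v * (if \<lfloor>real (Suc n) * v\<rfloor> = int i then 1 else 0) * Z (real i / real (Suc n)) \<omega>)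
          = w v * Z (fl n v) \<omega>"
      proof (intro allI impI)
        fix v :: real assume v: "v \<in> {0..1}"
        define j where "j = nat \<lfloor>real (Suc n) * v\<rfloor>"
        have j: "\<lfloor>real (Suc n) * v\<rfloor> = int j" using v by (simp add: j_def)
        have fj: "fl n v = real j / real (Suc n)" by (simp add: fl_def j del: of_nat_Suc)
        then have "real j = real (Suc n) * fl n v" by simp
        also have "\<dots> \<le> real (Suc n) * 1" using fl01[OF v, of n] by (intro mult_left_mono) auto
        finally have "j \<le> Suc n" by simp
        have "(\<Sum>i\<le>Suc n. w v * (if \<lfloor>real (Suc n) * v\<rfloor> = int i then 1 else 0) * Z (real i / real (Suc n)) \<omega>)
            = (\<Sum>i\<le>Suc n. if i = j then w v * Z (fl n v) \<omega> else 0)"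
          unfolding j fj by (intro sum.cong) auto
        then show "(\<Sum>i\<le>Suc n. w v * (if \<lfloor>real (Suc n) * v\<rfloor> = int i then 1 else 0) * Z (real i / real (Suc n)) \<omega>)
          = w v * Z (fl n v) \<omega>"
          using \<open>j \<le> Suc n\<close> by simp
      qed
    qed simp
    finally show ?thesis .
  qed
  show "AE \<omega> in M. (\<lambda>n. R n \<omega>) \<longlonglongrightarrow> (LBINT v:{0..1}. w v * Z v \<omega>)"
    using cont
  proof eventually_elim
    case (elim \<omega>)
    then have "bounded ((\<lambda>v. Z v \<omega>) ` {0..1})"
      by (intro compact_imp_bounded compact_continuous_image) auto
    then obtain C where C: "\<And>v. v \<in> {0..1} \<Longrightarrow> \<bar>Z v \<omega>\<bar> \<le> C"
      unfolding bounded_iff by (metis image_eqI real_norm_def)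
    \<comment> \<open>The path is continuous only on \<open>{0..1}\<close>; its extension by 0 is a
      Borel function on the line that can be composed with the rounding map.\<close>
    define z where "z v = indicator {0..1} v *\<^sub>R Z v \<omega>" for v
    have [measurable]: "z \<in> borel_measurable borel"
      unfolding z_def using elim by (rule borel_measurable_continuous_on_indicator[rotated]) simp
    show ?case
      unfolding R unfolding set_lebesgue_integral_def
    proof (rule integral_dominated_convergence)
      show "integrable lborel (\<lambda>v. indicator {0..1} v *\<^sub>R (\<bar>w v\<bar> * C))"
        using set_integrable_mult_left[OF set_integrable_abs[OF w], of C] by (simp add: set_integrable_def)
      have eq: "(\<lambda>v. indicator {0..1} v *\<^sub>R (w v * Z (h v) \<omega>)) = (\<lambda>v. indicator {0..1} v *\<^sub>R (w v * z (h v)))"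
        if "\<And>v. v \<in> {0..1} \<Longrightarrow> h v \<in> {0..1}" for h
        using that by (auto simp: fun_eq_iff indicator_def z_def)
      have meas: "(\<lambda>v. indicator {0..1} v *\<^sub>R (w v * Z (h v) \<omega>)) \<in> borel_measurable lborel"
        if hm: "h \<in> borel_measurable borel" and h01: "\<And>v. v \<in> {0..1} \<Longrightarrow> h v \<in> {0..1}" for h
      proof (subst eq)
        show "v \<in> {0..1} \<Longrightarrow> h v \<in> {0..1}" for v by (rule h01)
        note hm [measurable]
        show "(\<lambda>v. indicator {0..1} v *\<^sub>R (w v * z (h v))) \<in> borel_measurable lborel" by measurable
      qed
      show "(\<lambda>v. indicator {0..1} v *\<^sub>R (w v * Z v \<omega>)) \<in> borel_measurable lborel"
        using meas[of "\<lambda>v. v"] by simp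
      show "(\<lambda>v. indicator {0..1} v *\<^sub>R (w v * Z (fl n v) \<omega>)) \<in> borel_measurable lborel" for n
        using meas[of "fl n"] fl01 by simp
      show "AE v in lborel. (\<lambda>n. indicator {0..1} v *\<^sub>R (w v * Z (fl n v) \<omega>)) \<longlonglongrightarrow> indicator {0..1} v *\<^sub>R (w v * Z v \<omega>)"
      proof (rule AE_I2)
        fix v
        show "(\<lambda>n. indicator {0..1} v *\<^sub>R (w v * Z (fl n v) \<omega>)) \<longlonglongrightarrow> indicator {0..1} v *\<^sub>R (w v * Z v \<omega>)"
        proof (cases "v \<in> {0..1}")
          case True
          have "(\<lambda>n. fl n v) \<longlonglongrightarrow> v" unfolding fl_def by (rule floor_fraction_tendsto)
          then have "(\<lambda>n. Z (fl n v) \<omega>) \<longlonglongrightarrow> Z v \<omega>"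
            by (rule continuous_on_tendsto_compose[OF elim _ True]) (use fl01[OF True] in simp)
          then show ?thesis by (intro tendsto_intros)
        qed simp
      qed
      show "AE v in lborel. norm (indicator {0..1} v *\<^sub>R (w v * Z (fl n v) \<omega>)) \<le> indicator {0..1} v *\<^sub>R (\<bar>w v\<bar> * C)" for n
        using C fl01 by (auto simp: abs_mult indicator_def intro!: AE_I2 mult_left_mono)
    qed
  qed
qed

section \<open>The Wiener filtration and second moments of simple integrals\<close>

lemma space_natural_filtration [simp]: "space (natural_filtration M W t) = space M"
  unfolding natural_filtration_def by (rule space_measure_of) auto

lemma sets_natural_filtration:
  "sets (natural_filtration M W t) =
     sigma_sets (space M) {W s -` A \<inter> space M | s A. 0 \<le> s \<and> s \<le> t \<and> A \<in> sets borel}"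
  unfolding natural_filtration_def by (rule sets_measure_of) auto

lemma sets_natural_filtration_mono:
  "s \<le> t \<Longrightarrow> sets (natural_filtration M W s) \<subseteq> sets (natural_filtration M W t)"
  unfolding sets_natural_filtration by (rule sigma_sets_mono') fastforce

lemma natural_filtration_mono:
  "Y \<in> borel_measurable (natural_filtration M W s) \<Longrightarrow> s \<le> t
    \<Longrightarrow> Y \<in> borel_measurable (natural_filtration M W t)"
  by (rule measurable_from_subalg[of "natural_filtration M W t" "natural_filtration M W s"])
     (simp_all add: subalgebra_def sets_natural_filtration_mono)

lemma measurable_natural_filtration:
  assumes "0 \<le> s" "s \<le> t"
  shows "W s \<in> borel_measurable (natural_filtration M W t)"
proof (rule measurableI)
  fix A :: "real set" assume "A \<in> sets borel"
  then show "W s -` A \<inter> space (natural_filtration M W t) \<in> sets (natural_filtration M W t)"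
    using assms unfolding space_natural_filtration sets_natural_filtration by (intro sigma_sets.Basic) auto
qed simp

locale wiener_space = prob_space M for M :: "'a measure" +
  fixes W :: "real \<Rightarrow> 'a \<Rightarrow> real"
  assumes wiener: "wiener_process M W"
begin

abbreviation "F \<equiv> natural_filtration M W"

lemma measurable_W [measurable]: "0 \<le> t \<Longrightarrow> W t \<in> borel_measurable M"
  using wiener by (auto simp: wiener_process_def)

lemma subalgebra_F: "subalgebra M (F t)"
proof -
  have "sets (F t) \<subseteq> sets M"
    unfolding sets_natural_filtration
  proof (rule sets.sigma_sets_subset)
    show "{W s -` A \<inter> space M |s A. 0 \<le> s \<and> s \<le> t \<and> A \<in> sets borel} \<subseteq> events"
      using measurable_sets[OF measurable_W] by auto
  qed
  then show ?thesis by (simp add: subalgebra_def)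
qed

lemma measurable_F_M: "Y \<in> borel_measurable (F t) \<Longrightarrow> Y \<in> borel_measurable M"
  by (rule measurable_from_subalg[OF subalgebra_F])

lemma increment_moments:
  assumes "0 \<le> s" "s < t"
  defines "D \<equiv> \<lambda>\<omega>. W t \<omega> - W s \<omega>"
  shows "integrable M D" and "expectation D = 0"
    and "integrable M (\<lambda>\<omega>. (D \<omega>)\<^sup>2)" and "expectation (\<lambda>\<omega>. (D \<omega>)\<^sup>2) = t - s"
proof -
  have D: "distributed M lborel D (normal_density 0 (sqrt (t - s)))"
    using wiener assms by (auto simp: wiener_process_def)
  show "integrable M D"
    using integrable_normal_moment[of "sqrt (t - s)" 0 1] assms(2)
    by (intro distributed_integrable_var[OF D]) auto
  show E: "expectation D = 0"
    by (rule normal_distributed_expectation[OF _ D]) (use assms(2) in simp)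
  show "integrable M (\<lambda>\<omega>. (D \<omega>)\<^sup>2)"
    using distributed_integrable[OF D, of "\<lambda>x. x\<^sup>2"] integrable_normal_moment[of "sqrt (t - s)" 0 2] assms(2) by simp
  show "expectation (\<lambda>\<omega>. (D \<omega>)\<^sup>2) = t - s"
    using normal_distributed_variance[OF _ D] E assms by simp
qed

lemma increment_indep:
  assumes "0 \<le> s" "s < t" and Z: "Z \<in> borel_measurable (F s)"
  shows "indep_var borel Z borel (\<lambda>\<omega>. W t \<omega> - W s \<omega>)"
proof -
  define D where "D = (\<lambda>\<omega>. W t \<omega> - W s \<omega>)"
  have ind: "indep_set (sets (F s)) {D -` A \<inter> space M | A. A \<in> sets borel}"
    using wiener assms by (auto simp: wiener_process_def D_def)
  have sig: "sigma_sets (space M) {Y -` A \<inter> space M | A. A \<in> sets borel} = {Y -` A \<inter> space M | A. A \<in> sets borel}"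
    for Y :: "'a \<Rightarrow> real"
    using sets_vimage_algebra2[of Y "space M" borel] sets_vimage_algebra[of "space M" Y borel] by simp
  have "{Z -` A \<inter> space M | A. A \<in> sets borel} \<subseteq> sets (F s)"
    using measurable_sets[OF Z] by auto
  then have "indep_set {Z -` A \<inter> space M | A. A \<in> sets borel} {D -` A \<inter> space M | A. A \<in> sets borel}"
    using ind unfolding indep_sets2_eq by blast
  moreover have "D \<in> borel_measurable M" unfolding D_def using assms by (auto intro!: borel_measurable_diff measurable_W)
  moreover have "Z \<in> borel_measurable M" using Z by (rule measurable_F_M)
  ultimately show ?thesis unfolding indep_var_eq sig D_def by simp
qed

text \<open>The Ito isometry, one increment at a time. The cross term has mean 0, because
  \<open>S m\<close> times the next coefficient is known at time \<open>\<tau> m\<close> and is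
  independent of the following increment.\<close>

lemma simple_sum_moment:
  fixes \<psi> :: "nat \<Rightarrow> 'a \<Rightarrow> real"
  assumes \<tau>: "0 \<le> \<tau> 0" "mono_on {..n} \<tau>"
    and \<psi>: "\<And>i. i < n \<Longrightarrow> \<psi> i \<in> borel_measurable (F (\<tau> i))"
    and C: "\<And>i \<omega>. i < n \<Longrightarrow> \<omega> \<in> space M \<Longrightarrow> \<bar>\<psi> i \<omega>\<bar> \<le> C i"
  defines "S \<equiv> \<lambda>m \<omega>. \<Sum>i<m. \<psi> i \<omega> * (W (\<tau> (Suc i)) \<omega> - W (\<tau> i) \<omega>)"
    and "Q \<equiv> \<lambda>m \<omega>. \<Sum>i<m. (\<psi> i \<omega>)\<^sup>2 * (\<tau> (Suc i) - \<tau> i)"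
  assumes "m \<le> n"
  shows "S m \<in> borel_measurable (F (\<tau> m)) \<and> integrable M (\<lambda>\<omega>. (S m \<omega>)\<^sup>2) \<and> integrable M (Q m)
    \<and> expectation (\<lambda>\<omega>. (S m \<omega>)\<^sup>2) = expectation (Q m)"
  using \<open>m \<le> n\<close>
proof (induction m)
  case 0
  then show ?case by (simp add: S_def Q_def)
next
  case (Suc m)
  then have m: "m < n" and IH1: "S m \<in> borel_measurable (F (\<tau> m))"
    and IH2: "integrable M (\<lambda>\<omega>. (S m \<omega>)\<^sup>2)" and IH3: "integrable M (Q m)"
    and IH4: "expectation (\<lambda>\<omega>. (S m \<omega>)\<^sup>2) = expectation (Q m)" by auto
  have \<tau>0: "0 \<le> \<tau> m" using mono_onD[OF \<tau>(2), of 0 m] \<tau>(1) m by auto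
  have \<tau>S: "\<tau> m \<le> \<tau> (Suc m)" using mono_onD[OF \<tau>(2), of m "Suc m"] m by auto
  define D where "D \<omega> = W (\<tau> (Suc m)) \<omega> - W (\<tau> m) \<omega>" for \<omega>
  have S_Suc: "S (Suc m) \<omega> = S m \<omega> + \<psi> m \<omega> * D \<omega>" for \<omega> by (simp add: S_def D_def)
  have Q_Suc: "Q (Suc m) \<omega> = Q m \<omega> + (\<psi> m \<omega>)\<^sup>2 * (\<tau> (Suc m) - \<tau> m)" for \<omega> by (simp add: Q_def)
  have meas: "S (Suc m) \<in> borel_measurable (F (\<tau> (Suc m)))"
    unfolding S_Suc D_def
    using natural_filtration_mono[OF IH1 \<tau>S] natural_filtration_mono[OF \<psi>[OF m] \<tau>S]
      measurable_natural_filtration[of "\<tau> m" "\<tau> (Suc m)" W M]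
      measurable_natural_filtration[of "\<tau> (Suc m)" "\<tau> (Suc m)" W M] \<tau>0 \<tau>S
    by (intro borel_measurable_add borel_measurable_times borel_measurable_diff) auto
  note [measurable] = measurable_F_M[OF IH1] measurable_F_M[OF \<psi>[OF m]]
  have C0: "0 \<le> C m" using C[OF m] not_empty by force
  have \<psi>2: "integrable M (\<lambda>\<omega>. (\<psi> m \<omega>)\<^sup>2)"
  proof (rule integrable_const_bound[where B = "(C m)\<^sup>2"])
    show "AE \<omega> in M. norm ((\<psi> m \<omega>)\<^sup>2) \<le> (C m)\<^sup>2"
      using C[OF m] C0 by (auto intro!: AE_I2 simp: abs_le_square_iff[symmetric])
  qed measurable
  then have intQ: "integrable M (Q (Suc m))"
    unfolding Q_Suc using IH3 by (intro Bochner_Integration.integrable_add integrable_mult_left)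
  \<comment> \<open>Grid points may coincide, and the normal law of an increment is available only
    for s < t; an increment over an empty interval contributes nothing.\<close>
  show ?case
  proof (cases "\<tau> m = \<tau> (Suc m)")
    case True
    then have "S (Suc m) = S m" "Q (Suc m) = Q m" by (auto simp: fun_eq_iff S_Suc Q_Suc D_def)
    with meas IH2 IH3 IH4 show ?thesis by simp
  next
    case False
    then have lt: "\<tau> m < \<tau> (Suc m)" using \<tau>S by simp
    note D = increment_moments[OF \<tau>0 lt, folded D_def]
    note [measurable] = borel_measurable_integrable[OF D(1)[folded D_def[abs_def]]]
    have S\<psi>: "integrable M (\<lambda>\<omega>. S m \<omega> * \<psi> m \<omega>)"
    proof (rule Bochner_Integration.integrable_bound)
      show "integrable M (\<lambda>\<omega>. (S m \<omega>)\<^sup>2 + (\<psi> m \<omega>)\<^sup>2)" using IH2 \<psi>2 by simp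
      show "AE \<omega> in M. norm (S m \<omega> * \<psi> m \<omega>) \<le> norm ((S m \<omega>)\<^sup>2 + (\<psi> m \<omega>)\<^sup>2)"
        using abs_mult_le_squares by (auto intro!: AE_I2)
    qed measurable
    have i1: "indep_var borel (\<lambda>\<omega>. S m \<omega> * \<psi> m \<omega>) borel D"
      unfolding D_def[abs_def] using IH1 \<psi>[OF m] by (intro increment_indep[OF \<tau>0 lt] borel_measurable_times)
    have i0: "indep_var borel (\<psi> m) borel D"
      unfolding D_def[abs_def] using \<psi>[OF m] by (intro increment_indep[OF \<tau>0 lt])
    have i2: "indep_var borel (\<lambda>\<omega>. (\<psi> m \<omega>)\<^sup>2) borel (\<lambda>\<omega>. (D \<omega>)\<^sup>2)"
      using indep_var_compose[OF i0, of "\<lambda>x. x\<^sup>2" borel "\<lambda>x. x\<^sup>2" borel] by (simp add: comp_def)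
    have D': "integrable M D" "expectation D = 0" using D by (simp_all add: D_def[abs_def])
    have m1: "integrable M (\<lambda>\<omega>. (S m \<omega> * \<psi> m \<omega>) * D \<omega>)" "expectation (\<lambda>\<omega>. (S m \<omega> * \<psi> m \<omega>) * D \<omega>) = 0"
      using indep_var_integrable[OF i1 S\<psi> D'(1)] indep_var_lebesgue_integral[OF i1 S\<psi> D'(1)] D'(2) by auto
    have m2: "integrable M (\<lambda>\<omega>. (\<psi> m \<omega>)\<^sup>2 * (D \<omega>)\<^sup>2)"
      "expectation (\<lambda>\<omega>. (\<psi> m \<omega>)\<^sup>2 * (D \<omega>)\<^sup>2) = expectation (\<lambda>\<omega>. (\<psi> m \<omega>)\<^sup>2) * (\<tau> (Suc m) - \<tau> m)"
      using indep_var_integrable[OF i2 \<psi>2 D(3)] indep_var_lebesgue_integral[OF i2 \<psi>2 D(3)] D(4) by auto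
    have sq: "(S (Suc m) \<omega>)\<^sup>2 = (S m \<omega>)\<^sup>2 + 2 * ((S m \<omega> * \<psi> m \<omega>) * D \<omega>) + (\<psi> m \<omega>)\<^sup>2 * (D \<omega>)\<^sup>2" for \<omega>
      unfolding S_Suc by (simp add: power2_eq_square algebra_simps)
    have "integrable M (\<lambda>\<omega>. (S (Suc m) \<omega>)\<^sup>2)"
      unfolding sq using IH2 m1(1) m2(1) by (intro Bochner_Integration.integrable_add integrable_mult_right)
    moreover have "expectation (\<lambda>\<omega>. (S (Suc m) \<omega>)\<^sup>2) = expectation (Q (Suc m))"
      unfolding sq Q_Suc using IH2 IH3 IH4 m1 m2 \<psi>2 by simp
    ultimately show ?thesis using meas intQ by simp
  qed
qed

end

text \<open>Dominated convergence for the indicators of the events. It passes from almost sure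
  statements along a sequence to convergence of probabilities.\<close>

lemma (in prob_space) AE_imp_prob_tendsto_0:
  assumes [measurable]: "\<And>k. {\<omega> \<in> space M. P k \<omega>} \<in> events"
    and ev: "AE \<omega> in M. eventually (\<lambda>k. \<not> P k \<omega>) sequentially"
  shows "(\<lambda>k. prob {\<omega> \<in> space M. P k \<omega>}) \<longlonglongrightarrow> 0"
proof -
  define A where "A k = {\<omega> \<in> space M. P k \<omega>}" for k
  have [measurable]: "A k \<in> events" for k unfolding A_def by measurable
  have "(\<lambda>k. \<integral>\<omega>. indicator (A k) \<omega> \<partial>M) \<longlonglongrightarrow> (\<integral>\<omega>. (0::real) \<partial>M)"
  proof (rule integral_dominated_convergence)
    show "integrable M (\<lambda>_. 1 :: real)" by simp
    show "AE \<omega> in M. (\<lambda>k. indicator (A k) \<omega>) \<longlonglongrightarrow> (0::real)"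
      using ev
    proof eventually_elim
      case (elim \<omega>)
      then show ?case
        by (intro tendsto_eventually) (auto elim!: eventually_mono simp: A_def)
    qed
    show "AE \<omega> in M. norm (indicator (A k) \<omega> :: real) \<le> 1" for k by (auto simp: indicator_def)
  qed auto
  then show ?thesis by (simp add: A_def)
qed

lemma simple_process_square:
  assumes "mono_on {..n} \<tau>"
  shows "(simple_process n \<tau> \<xi> s \<omega>)\<^sup>2 = (\<Sum>i<n. (\<xi> i \<omega>)\<^sup>2 * indicator {\<tau> i<..\<tau> (Suc i)} s)"
proof -
  define a where "a i = \<xi> i \<omega> * indicator {\<tau> i<..\<tau> (Suc i)} s" for i
  have a: "a i * a j = 0" if "i < j" "j < n" for i j
  proof -
    have "\<tau> (Suc i) \<le> \<tau> j" using mono_onD[OF assms, of "Suc i" j] that by auto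
    then show ?thesis by (auto simp: a_def indicator_def)
  qed
  have "(simple_process n \<tau> \<xi> s \<omega>)\<^sup>2 = (\<Sum>i<n. \<Sum>j<n. a i * a j)"
    unfolding simple_process_def a_def[symmetric] power2_eq_square sum_product ..
  also have "\<dots> = (\<Sum>i<n. \<Sum>j<n. if j = i then a i * a i else 0)"
  proof (intro sum.cong refl)
    fix i j assume "i \<in> {..<n}" "j \<in> {..<n}"
    then show "a i * a j = (if j = i then a i * a i else 0)"
      using a[of i j] a[of j i] by (cases i j rule: linorder_cases) (auto simp: mult.commute)
  qed
  also have "\<dots> = (\<Sum>i<n. (\<xi> i \<omega>)\<^sup>2 * indicator {\<tau> i<..\<tau> (Suc i)} s)"
  proof (rule sum.cong[OF refl])
    fix i assume "i \<in> {..<n}"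
    then have "(\<Sum>j<n. if j = i then a i * a i else 0) = a i * a i" by simp
    also have "\<dots> = (\<xi> i \<omega>)\<^sup>2 * indicator {\<tau> i<..\<tau> (Suc i)} s"
      by (cases "s \<in> {\<tau> i<..\<tau> (Suc i)}") (simp_all add: a_def power2_eq_square)
    finally show "(\<Sum>j<n. if j = i then a i * a i else 0) = (\<xi> i \<omega>)\<^sup>2 * indicator {\<tau> i<..\<tau> (Suc i)} s" .
  qed
  finally show ?thesis .
qed

lemma simple_process_energy:
  assumes \<tau>: "0 \<le> \<tau> 0" "mono_on {..n} \<tau>" "\<tau> n \<le> t"
  shows "set_integrable lborel {0..t} (\<lambda>s. (simple_process n \<tau> \<xi> s \<omega>)\<^sup>2)"
    and "(LBINT s:{0..t}. (simple_process n \<tau> \<xi> s \<omega>)\<^sup>2) = (\<Sum>i<n. (\<xi> i \<omega>)\<^sup>2 * (\<tau> (Suc i) - \<tau> i))"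
proof -
  have sub: "{\<tau> i<..\<tau> (Suc i)} \<subseteq> {0..t}" "\<tau> i \<le> \<tau> (Suc i)" if "i < n" for i
    using mono_onD[OF \<tau>(2), of 0 i] mono_onD[OF \<tau>(2), of "Suc i" n] mono_onD[OF \<tau>(2), of i "Suc i"] \<tau> that by auto
  have ind: "indicator {0..t} s *\<^sub>R ((\<xi> i \<omega>)\<^sup>2 * indicator {\<tau> i<..\<tau> (Suc i)} s)
      = (\<xi> i \<omega>)\<^sup>2 * indicator {\<tau> i<..\<tau> (Suc i)} s" if "i < n" for i s
    using sub[OF that] by (auto simp: indicator_def)
  have hb: "has_bochner_integral lborel (\<lambda>s. (\<xi> i \<omega>)\<^sup>2 * indicator {\<tau> i<..\<tau> (Suc i)} s) ((\<xi> i \<omega>)\<^sup>2 * (\<tau> (Suc i) - \<tau> i))"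
    if "i < n" for i
    using sub(2)[OF that] has_bochner_integral_real_indicator[of "{\<tau> i<..\<tau> (Suc i)}" lborel]
    by (intro has_bochner_integral_mult_right) (auto simp: measure_def)
  have eq: "(\<lambda>s. indicator {0..t} s *\<^sub>R (simple_process n \<tau> \<xi> s \<omega>)\<^sup>2)
      = (\<lambda>s. \<Sum>i<n. (\<xi> i \<omega>)\<^sup>2 * indicator {\<tau> i<..\<tau> (Suc i)} s)"
    unfolding simple_process_square[OF \<tau>(2)] scaleR_sum_right using ind by (intro ext sum.cong) auto
  have "has_bochner_integral lborel (\<lambda>s. indicator {0..t} s *\<^sub>R (simple_process n \<tau> \<xi> s \<omega>)\<^sup>2)
      (\<Sum>i<n. (\<xi> i \<omega>)\<^sup>2 * (\<tau> (Suc i) - \<tau> i))"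
    unfolding eq by (rule has_bochner_integral_sum) (use hb in auto)
  then show "set_integrable lborel {0..t} (\<lambda>s. (simple_process n \<tau> \<xi> s \<omega>)\<^sup>2)"
    and "(LBINT s:{0..t}. (simple_process n \<tau> \<xi> s \<omega>)\<^sup>2) = (\<Sum>i<n. (\<xi> i \<omega>)\<^sup>2 * (\<tau> (Suc i) - \<tau> i))"
    by (auto simp: set_integrable_def set_lebesgue_integral_def has_bochner_integral_iff)
qed

context wiener_space
begin

lemma simple_adaptedD:
  assumes "simple_adapted M W t n \<tau> \<xi>"
  shows "0 \<le> \<tau> 0" "mono_on {..n} \<tau>" "\<tau> n \<le> t"
    and "\<And>i. i < n \<Longrightarrow> \<xi> i \<in> borel_measurable (F (\<tau> i))"
    and "\<And>i. i < n \<Longrightarrow> \<xi> i \<in> borel_measurable M"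
    and "\<And>i. i \<le> n \<Longrightarrow> 0 \<le> \<tau> i"
    and "\<And>i. i < n \<Longrightarrow> \<tau> i \<le> \<tau> (Suc i)"
    and "\<And>i. i \<le> n \<Longrightarrow> \<tau> i \<le> t"
proof -
  show *: "0 \<le> \<tau> 0" "mono_on {..n} \<tau>" "\<tau> n \<le> t" "\<And>i. i < n \<Longrightarrow> \<xi> i \<in> borel_measurable (F (\<tau> i))"
    using assms by (auto simp: simple_adapted_def)
  show "\<xi> i \<in> borel_measurable M" if "i < n" for i using *(4)[OF that] by (rule measurable_F_M)
  show "0 \<le> \<tau> i" if "i \<le> n" for i using mono_onD[OF *(2), of 0 i] *(1) that by auto
  show "\<tau> i \<le> \<tau> (Suc i)" if "i < n" for i using mono_onD[OF *(2), of i "Suc i"] that by auto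
  show "\<tau> i \<le> t" if "i \<le> n" for i using mono_onD[OF *(2), of i n] *(3) that by auto
qed

lemma measurable_simple_integral:
  assumes "simple_adapted M W t n \<tau> \<xi>"
  shows "simple_integral W n \<tau> \<xi> \<in> borel_measurable (F t)"
    and "simple_integral W n \<tau> \<xi> \<in> borel_measurable M"
proof -
  note A = simple_adaptedD[OF assms]
  show "simple_integral W n \<tau> \<xi> \<in> borel_measurable (F t)"
    unfolding simple_integral_def
  proof (intro borel_measurable_sum borel_measurable_times borel_measurable_diff)
    fix i assume "i \<in> {..<n}"
    then have i: "i < n" by simp
    show "\<xi> i \<in> borel_measurable (F t)" using natural_filtration_mono[OF A(4)[OF i]] A(8)[of i] i by simp
    show "W (\<tau> i) \<in> borel_measurable (F t)" "W (\<tau> (Suc i)) \<in> borel_measurable (F t)"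
      using i A(6,8) by (auto intro!: measurable_natural_filtration)
  qed
  then show "simple_integral W n \<tau> \<xi> \<in> borel_measurable M" by (rule measurable_F_M)
qed

text \<open>Stopping the coefficients once the accumulated energy exceeds \<open>\<delta>\<close> keeps them adapted, bounds the
  second moment of the integral by \<open>\<delta>\<close>, and changes nothing on the event considered.\<close>

lemma simple_integral_prob_bound:
  assumes sa: "simple_adapted M W t n \<tau> \<xi>" and "\<epsilon> > 0" "\<delta> \<ge> 0"
  shows "prob {\<omega> \<in> space M. \<bar>simple_integral W n \<tau> \<xi> \<omega>\<bar> > \<epsilon> \<and> (\<Sum>i<n. (\<xi> i \<omega>)\<^sup>2 * (\<tau> (Suc i) - \<tau> i)) \<le> \<delta>}
    \<le> \<delta> / \<epsilon>\<^sup>2"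
proof -
  note A = simple_adaptedD[OF sa]
  define P where "P m \<omega> = (\<Sum>j<m. (\<xi> j \<omega>)\<^sup>2 * (\<tau> (Suc j) - \<tau> j))" for m \<omega>
  \<comment> \<open>The test uses the energy up to time \<open>\<tau> (Suc i)\<close>, one cell
    ahead. It is nevertheless known at time \<open>\<tau> i\<close>, because the integrand is
    constant on the cell, and looking ahead prevents the total from ever exceeding
    \<open>\<delta>\<close>.\<close>
  define \<psi> where "\<psi> i \<omega> = (if P (Suc i) \<omega> \<le> \<delta> then \<xi> i \<omega> else 0)" for i \<omega>
  have \<psi>_meas: "\<psi> i \<in> borel_measurable (F (\<tau> i))" if i: "i < n" for i
  proof -
    have "\<xi> j \<in> borel_measurable (F (\<tau> i))" if "j < Suc i" for j
    proof (rule natural_filtration_mono[OF A(4)])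
      show "j < n" using i that by simp
      show "\<tau> j \<le> \<tau> i" using mono_onD[OF A(2), of j i] i that by auto
    qed
    then have "P (Suc i) \<in> borel_measurable (F (\<tau> i))" "\<xi> i \<in> borel_measurable (F (\<tau> i))"
      unfolding P_def by (auto intro!: borel_measurable_sum borel_measurable_times borel_measurable_power)
    note [measurable] = this
    show ?thesis unfolding \<psi>_def by measurable
  qed
  have "\<forall>i. \<exists>C. i < n \<longrightarrow> (\<forall>\<omega>\<in>space M. \<bar>\<xi> i \<omega>\<bar> \<le> C)"
    using sa by (auto simp: simple_adapted_def)
  then obtain C where C: "\<And>i \<omega>. i < n \<Longrightarrow> \<omega> \<in> space M \<Longrightarrow> \<bar>\<xi> i \<omega>\<bar> \<le> C i" by metis
  have \<psi>C: "\<bar>\<psi> i \<omega>\<bar> \<le> C i" if "i < n" "\<omega> \<in> space M" for i \<omega>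
    using C[OF that] by (auto simp: \<psi>_def)
  have nn: "0 \<le> (\<xi> j \<omega>)\<^sup>2 * (\<tau> (Suc j) - \<tau> j)" if "j < n" for j \<omega> using A(7)[OF that] by simp
  have stop: "(\<Sum>i<m. (\<psi> i \<omega>)\<^sup>2 * (\<tau> (Suc i) - \<tau> i)) \<le> \<delta>" if "m \<le> n" for m \<omega>
    using that
  proof (induction m)
    case 0 then show ?case using \<open>\<delta> \<ge> 0\<close> by simp
  next
    case (Suc m)
    show ?case
    proof (cases "P (Suc m) \<omega> \<le> \<delta>")
      case True
      have "(\<Sum>i<Suc m. (\<psi> i \<omega>)\<^sup>2 * (\<tau> (Suc i) - \<tau> i)) \<le> P (Suc m) \<omega>"
        unfolding P_def
      proof (rule sum_mono)
        fix i assume "i \<in> {..<Suc m}"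
        then show "(\<psi> i \<omega>)\<^sup>2 * (\<tau> (Suc i) - \<tau> i) \<le> (\<xi> i \<omega>)\<^sup>2 * (\<tau> (Suc i) - \<tau> i)"
          using nn[of i \<omega>] Suc.prems by (auto simp: \<psi>_def)
      qed
      with True show ?thesis by simp
    next
      case False
      then show ?thesis using Suc by (simp add: \<psi>_def)
    qed
  qed
  note M = simple_sum_moment[OF A(1,2) \<psi>_meas \<psi>C order_refl]
  define S where "S \<omega> = (\<Sum>i<n. \<psi> i \<omega> * (W (\<tau> (Suc i)) \<omega> - W (\<tau> i) \<omega>))" for \<omega>
  define E where "E \<omega> = (\<Sum>i<n. (\<psi> i \<omega>)\<^sup>2 * (\<tau> (Suc i) - \<tau> i))" for \<omega>
  have S: "S \<in> borel_measurable M" "integrable M (\<lambda>\<omega>. (S \<omega>)\<^sup>2)" and E: "integrable M E"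
    and SE: "expectation (\<lambda>\<omega>. (S \<omega>)\<^sup>2) = expectation E"
    using M measurable_F_M by (auto simp: S_def[abs_def] E_def[abs_def])
  note [measurable] = S(1)
  have "expectation E \<le> expectation (\<lambda>_. \<delta>)"
    by (rule integral_mono) (use E stop[of n] in \<open>auto simp: E_def\<close>)
  then have "expectation (\<lambda>\<omega>. (S \<omega>)\<^sup>2) \<le> \<delta>" using SE by (simp add: prob_space)
  then have "expectation (\<lambda>\<omega>. (S \<omega>)\<^sup>2) / \<epsilon>\<^sup>2 \<le> \<delta> / \<epsilon>\<^sup>2" by (rule divide_right_mono) simp
  moreover have "prob {\<omega> \<in> space M. \<bar>S \<omega>\<bar> \<ge> \<epsilon>} \<le> expectation (\<lambda>\<omega>. (S \<omega>)\<^sup>2) / \<epsilon>\<^sup>2"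
    by (rule second_moment_method) (use S \<open>\<epsilon> > 0\<close> in auto)
  moreover have "prob {\<omega> \<in> space M. \<bar>simple_integral W n \<tau> \<xi> \<omega>\<bar> > \<epsilon> \<and> (\<Sum>i<n. (\<xi> i \<omega>)\<^sup>2 * (\<tau> (Suc i) - \<tau> i)) \<le> \<delta>}
    \<le> prob {\<omega> \<in> space M. \<bar>S \<omega>\<bar> \<ge> \<epsilon>}"
  proof (rule finite_measure_mono)
    show "{\<omega> \<in> space M. \<bar>simple_integral W n \<tau> \<xi> \<omega>\<bar> > \<epsilon> \<and> (\<Sum>i<n. (\<xi> i \<omega>)\<^sup>2 * (\<tau> (Suc i) - \<tau> i)) \<le> \<delta>}
      \<subseteq> {\<omega> \<in> space M. \<bar>S \<omega>\<bar> \<ge> \<epsilon>}"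
    proof safe
      fix \<omega> assume 1: "\<epsilon> < \<bar>simple_integral W n \<tau> \<xi> \<omega>\<bar>" and 2: "(\<Sum>i<n. (\<xi> i \<omega>)\<^sup>2 * (\<tau> (Suc i) - \<tau> i)) \<le> \<delta>"
      have "\<psi> i \<omega> = \<xi> i \<omega>" if "i < n" for i
      proof -
        have "P (Suc i) \<omega> \<le> P n \<omega>"
          unfolding P_def by (rule sum_mono2) (use that nn in auto)
        also have "\<dots> \<le> \<delta>" using 2 by (simp add: P_def)
        finally show ?thesis by (simp add: \<psi>_def)
      qed
      then have "S \<omega> = simple_integral W n \<tau> \<xi> \<omega>" by (simp add: S_def simple_integral_def)
      then show "\<epsilon> \<le> \<bar>S \<omega>\<bar>" using 1 by simp
    qed
  qed measurable
  ultimately show ?thesis by linarith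
qed

end

section \<open>Path distances and integrands of vanishing energy\<close>

lemma L2_diff:
  assumes "f \<in> L2 T" "g \<in> L2 T"
  shows "(\<lambda>s. f s - g s) \<in> L2 T"
proof -
  have "(\<lambda>s. indicator {0..T} s * f s - indicator {0..T} s * g s) \<in> borel_measurable borel"
    using L2_restrict(1)[OF assms(1)] L2_restrict(1)[OF assms(2)] by (rule borel_measurable_diff)
  also have "(\<lambda>s. indicator {0..T} s * f s - indicator {0..T} s * g s) = (\<lambda>s. indicator {0..T} s * (f s - g s))"
    by (simp add: right_diff_distrib)
  finally have m: "set_borel_measurable lborel {0..T} (\<lambda>s. f s - g s)"
    by (simp add: set_borel_measurable_def)
  have "set_integrable lborel {0..T} (\<lambda>s. (indicator {0..T} s * f s - indicator {0..T} s * g s)\<^sup>2)"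
    by (rule square_integrable_diff) (use L2_restrict[OF assms(1)] L2_restrict[OF assms(2)] in auto)
  then have "set_integrable lborel {0..T} (\<lambda>s. (f s - g s)\<^sup>2)"
    by (subst (asm) set_integrable_cong[OF refl refl, where f' = "\<lambda>s. (f s - g s)\<^sup>2"]) auto
  with m show ?thesis by (simp add: L2_def)
qed

lemma L2_square_integrable: "f \<in> L2 T \<Longrightarrow> set_integrable lborel {0..T} (\<lambda>s. (f s)\<^sup>2)"
  by (simp add: L2_def)

lemma L2_mono:
  assumes "f \<in> L2 T" "t \<le> T"
  shows "f \<in> L2 t"
proof -
  have "(\<lambda>s. indicator {0..t} s * (indicator {0..T} s * f s)) \<in> borel_measurable borel"
    by (rule borel_measurable_times[OF _ L2_restrict(1)[OF assms(1)]]) simp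
  also have "(\<lambda>s. indicator {0..t} s * (indicator {0..T} s * f s)) = (\<lambda>s. indicator {0..t} s * f s)"
    using assms(2) by (auto simp: fun_eq_iff indicator_def)
  finally have "set_borel_measurable lborel {0..t} f" by (simp add: set_borel_measurable_def)
  moreover have "set_integrable lborel {0..t} (\<lambda>s. (f s)\<^sup>2)"
    using set_integrable_subset[OF L2_square_integrable[OF assms(1)], of "{0..t}"] assms(2) by auto
  ultimately show ?thesis by (simp add: L2_def)
qed

lemma set_integral_square_nonneg: "0 \<le> (LBINT s:A. (f s :: real)\<^sup>2)"
  unfolding set_lebesgue_integral_def by (intro integral_nonneg_AE) auto

lemma L2_triangle:
  assumes "f \<in> L2 t" "g \<in> L2 t" "h \<in> L2 t"
  shows "(LBINT s:{0..t}. (f s - g s)\<^sup>2) \<le> 2 * (LBINT s:{0..t}. (f s - h s)\<^sup>2) + 2 * (LBINT s:{0..t}. (h s - g s)\<^sup>2)"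
proof -
  note i = L2_square_integrable[OF L2_diff]
  have "(LBINT s:{0..t}. (f s - g s)\<^sup>2) \<le> (LBINT s:{0..t}. 2 * (f s - h s)\<^sup>2 + 2 * (h s - g s)\<^sup>2)"
  proof (rule set_integral_mono)
    show "(f s - g s)\<^sup>2 \<le> 2 * (f s - h s)\<^sup>2 + 2 * (h s - g s)\<^sup>2" for s
      using square_add_le[of "f s - h s" "h s - g s"] by simp
  qed (use i assms in \<open>auto intro!: set_integral_add(1) set_integrable_mult_right\<close>)
  also have "\<dots> = 2 * (LBINT s:{0..t}. (f s - h s)\<^sup>2) + 2 * (LBINT s:{0..t}. (h s - g s)\<^sup>2)"
    using i[OF assms(1,3)] i[OF assms(3,2)] by (simp add: set_integral_add)
  finally show ?thesis .
qed

lemma borel_measurable_simple_process [measurable]: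
  "(\<lambda>s. simple_process n \<tau> \<xi> s \<omega>) \<in> borel_measurable borel"
  unfolding simple_process_def by measurable

lemma simple_process_L2:
  assumes "0 \<le> \<tau> 0" "mono_on {..n} \<tau>" "\<tau> n \<le> t"
  shows "(\<lambda>s. simple_process n \<tau> \<xi> s \<omega>) \<in> L2 t"
  using simple_process_energy(1)[OF assms] by (intro L2I) simp_all

lemma (in prob_space) converges_in_probabilityD:
  assumes "converges_in_probability M Y Z" "\<epsilon> > 0"
  shows "(\<lambda>k. prob {\<omega> \<in> space M. \<bar>Y k \<omega> - Z \<omega>\<bar> > \<epsilon>}) \<longlonglongrightarrow> 0"
  using assms by (simp add: converges_in_probability_def)

context wiener_space
begin

text \<open>Where the energy of \<open>Q\<close> vanishes, the energies of the approximating simple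
  processes tend to 0, so by \<open>simple_integral_prob_bound\<close> their integrals become small
  in probability on that event. They also converge in probability to \<open>I\<close>.\<close>

lemma ito_integral_eq_0:
  assumes ito: "has_ito_integral M W Q t I" and t: "0 \<le> t"
  shows "AE \<omega> in M. (LBINT s:{0..t}. (Q s \<omega>)\<^sup>2) = 0 \<longrightarrow> I \<omega> = 0"
proof -
  obtain n \<tau> \<xi> where sa: "\<And>k. simple_adapted M W t (n k) (\<tau> k) (\<xi> k)"
    and lim: "AE \<omega> in M. (\<lambda>k. LBINT s:{0..t}. (simple_process (n k) (\<tau> k) (\<xi> k) s \<omega> - Q s \<omega>)\<^sup>2) \<longlonglongrightarrow> 0"
    and prob: "converges_in_probability M (\<lambda>k. simple_integral W (n k) (\<tau> k) (\<xi> k)) I"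
    using ito unfolding has_ito_integral_def by auto
  have I[measurable]: "I \<in> borel_measurable M" and Q: "AE \<omega> in M. (\<lambda>s. Q s \<omega>) \<in> L2 t"
    using ito by (auto simp: has_ito_integral_def)
  define J where "J k = simple_integral W (n k) (\<tau> k) (\<xi> k)" for k
  define D where "D k \<omega> = (\<Sum>i<n k. (\<xi> k i \<omega>)\<^sup>2 * (\<tau> k (Suc i) - \<tau> k i))" for k \<omega>
  note A = simple_adaptedD[OF sa]
  have [measurable]: "J k \<in> borel_measurable M" for k
    unfolding J_def by (rule measurable_simple_integral(2)[OF sa])
  have [measurable]: "D k \<in> borel_measurable M" for k
    unfolding D_def using A(5) by (intro borel_measurable_sum borel_measurable_times borel_measurable_power) auto
  \<comment> \<open>The set where the integral of the squared path of \<open>Q\<close> is 0 need not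
    be an event. It is replaced by the event that the measurable energies \<open>D k\<close> become
    arbitrarily small, written with countable quantifiers.\<close>
  define G where "G \<omega> \<longleftrightarrow> (\<forall>m. \<exists>K. \<forall>k\<ge>K. D k \<omega> \<le> 1 / real (Suc m))" for \<omega>
  have [measurable]: "Measurable.pred M G" unfolding G_def by measurable
  have G: "AE \<omega> in M. (LBINT s:{0..t}. (Q s \<omega>)\<^sup>2) = 0 \<longrightarrow> G \<omega>"
    using lim Q
  proof eventually_elim
    case (elim \<omega>)
    show ?case
    proof
      assume V: "(LBINT s:{0..t}. (Q s \<omega>)\<^sup>2) = 0"
      have z: "(\<lambda>s. 0) \<in> L2 t" by (rule L2I) (simp_all add: set_integrable_def)
      have Dle: "D k \<omega> \<le> 2 * (LBINT s:{0..t}. (simple_process (n k) (\<tau> k) (\<xi> k) s \<omega> - Q s \<omega>)\<^sup>2)" for k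
        using L2_triangle[OF simple_process_L2[OF A(1-3)] z elim(2), of k "\<xi> k" \<omega>] V
          simple_process_energy(2)[OF A(1-3), of k "\<xi> k" \<omega>] by (simp add: D_def)
      have l: "(\<lambda>k. 2 * (LBINT s:{0..t}. (simple_process (n k) (\<tau> k) (\<xi> k) s \<omega> - Q s \<omega>)\<^sup>2)) \<longlonglongrightarrow> 2 * 0"
        using elim(1) by (intro tendsto_intros)
      have "\<exists>K. \<forall>k\<ge>K. D k \<omega> \<le> 1 / real (Suc m)" for m
      proof -
        have "\<forall>\<^sub>F k in sequentially. D k \<omega> \<le> 1 / real (Suc m)"
          using order_tendstoD(2)[OF l, of "1 / real (Suc m)"]
        proof (rule eventually_mono)
          show "D k \<omega> \<le> 1 / real (Suc m)"
            if "2 * (LBINT s:{0..t}. (simple_process (n k) (\<tau> k) (\<xi> k) s \<omega> - Q s \<omega>)\<^sup>2) < 1 / real (Suc m)" for k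
            using Dle[of k] that by linarith
        qed simp
        then show ?thesis unfolding eventually_sequentially .
      qed
      then show "G \<omega>" by (simp add: G_def)
    qed
  qed
  \<comment> \<open>If \<bar>I\<bar> > 2 * \<epsilon> on \<open>G\<close>, then the simple integral
    is farther than \<epsilon> from \<open>I\<close>, or it exceeds \<epsilon> with energy at most
    \<delta>, or the energy still exceeds \<delta>. The first and the third probability vanish as k
    grows; afterwards \<delta> is free to tend to 0.\<close>
  have small: "prob {\<omega> \<in> space M. \<bar>I \<omega>\<bar> > 2 * \<epsilon> \<and> G \<omega>} \<le> \<delta> / \<epsilon>\<^sup>2" if e0: "\<epsilon> > 0" and d0: "\<delta> > 0" for \<epsilon> \<delta>
  proof -
    define a where "a k = prob {\<omega> \<in> space M. \<bar>J k \<omega> - I \<omega>\<bar> > \<epsilon>}" for k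
    define c where "c k = prob {\<omega> \<in> space M. G \<omega> \<and> D k \<omega> > \<delta>}" for k
    have bound: "prob {\<omega> \<in> space M. \<bar>I \<omega>\<bar> > 2 * \<epsilon> \<and> G \<omega>} \<le> a k + (\<delta> / \<epsilon>\<^sup>2 + c k)" for k
    proof -
      let ?A = "{\<omega> \<in> space M. \<bar>J k \<omega> - I \<omega>\<bar> > \<epsilon>}"
      let ?B = "{\<omega> \<in> space M. \<bar>J k \<omega>\<bar> > \<epsilon> \<and> D k \<omega> \<le> \<delta>}"
      let ?C = "{\<omega> \<in> space M. G \<omega> \<and> D k \<omega> > \<delta>}"
      have "prob {\<omega> \<in> space M. \<bar>I \<omega>\<bar> > 2 * \<epsilon> \<and> G \<omega>} \<le> prob (?A \<union> (?B \<union> ?C))"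
        by (rule finite_measure_mono) (auto, measurable)
      also have "\<dots> \<le> prob ?A + prob (?B \<union> ?C)" by (rule measure_Un_le) measurable
      also have "prob (?B \<union> ?C) \<le> prob ?B + prob ?C" by (rule measure_Un_le) measurable
      also have "prob ?B \<le> \<delta> / \<epsilon>\<^sup>2"
        unfolding J_def D_def using simple_integral_prob_bound[OF sa e0, of \<delta>] d0 by simp
      finally show ?thesis by (simp add: a_def c_def)
    qed
    have "a \<longlonglongrightarrow> 0"
      unfolding a_def J_def by (rule converges_in_probabilityD[OF prob e0])
    moreover have "c \<longlonglongrightarrow> 0"
      unfolding c_def
    proof (rule AE_imp_prob_tendsto_0)
      obtain m where m: "1 / real (Suc m) < \<delta>" using d0 by (rule nat_approx_posE)
      show "AE \<omega> in M. \<forall>\<^sub>F k in sequentially. \<not> (G \<omega> \<and> D k \<omega> > \<delta>)"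
      proof (rule AE_I2)
        fix \<omega>
        show "\<forall>\<^sub>F k in sequentially. \<not> (G \<omega> \<and> D k \<omega> > \<delta>)"
        proof (cases "G \<omega>")
          case True
          then obtain K where "\<And>k. k \<ge> K \<Longrightarrow> D k \<omega> \<le> 1 / real (Suc m)" unfolding G_def by blast
          then have "\<And>k. k \<ge> K \<Longrightarrow> \<not> D k \<omega> > \<delta>" using m by force
          then show ?thesis unfolding eventually_sequentially by blast
        qed simp
      qed
    qed measurable
    ultimately have "(\<lambda>k. a k + (\<delta> / \<epsilon>\<^sup>2 + c k)) \<longlonglongrightarrow> 0 + (\<delta> / \<epsilon>\<^sup>2 + 0)"
      by (intro tendsto_intros)
    then show ?thesis using bound by (intro LIMSEQ_le_const) auto
  qed
  have zero: "prob {\<omega> \<in> space M. \<bar>I \<omega>\<bar> > 2 * \<epsilon> \<and> G \<omega>} = 0" if "\<epsilon> > 0" for \<epsilon>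
  proof (rule antisym)
    show "prob {\<omega> \<in> space M. \<bar>I \<omega>\<bar> > 2 * \<epsilon> \<and> G \<omega>} \<le> 0"
    proof (rule field_le_epsilon)
      fix e :: real assume "e > 0"
      then show "prob {\<omega> \<in> space M. \<bar>I \<omega>\<bar> > 2 * \<epsilon> \<and> G \<omega>} \<le> 0 + e"
        using small[OF that, of "e * \<epsilon>\<^sup>2"] that by simp
    qed
  qed simp
  have "AE \<omega> in M. \<forall>m. \<not> (\<bar>I \<omega>\<bar> > 2 * (1 / real (Suc m)) \<and> G \<omega>)"
    unfolding AE_all_countable
  proof
    fix m
    have "{\<omega> \<in> space M. \<bar>I \<omega>\<bar> > 2 * (1 / real (Suc m)) \<and> G \<omega>} \<in> null_sets M"
      using zero[of "1 / real (Suc m)"] by (intro null_setsI) (simp_all add: emeasure_eq_measure)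
    then show "AE \<omega> in M. \<not> (\<bar>I \<omega>\<bar> > 2 * (1 / real (Suc m)) \<and> G \<omega>)"
      using AE_iff_null_sets by (auto simp: AE_iff_null)
  qed
  with G show ?thesis
  proof eventually_elim
    case (elim \<omega>)
    show ?case
    proof
      assume "(LBINT s:{0..t}. (Q s \<omega>)\<^sup>2) = 0"
      then have "G \<omega>" using elim by simp
      then have le: "\<bar>I \<omega>\<bar> \<le> 2 * (1 / real (Suc m))" for m using elim(2) by (meson not_le_imp_less)
      show "I \<omega> = 0"
      proof (rule ccontr)
        assume "I \<omega> \<noteq> 0"
        then have "\<bar>I \<omega>\<bar> / 2 > 0" by simp
        then obtain m where "1 / real (Suc m) < \<bar>I \<omega>\<bar> / 2" by (rule nat_approx_posE)
        then show False using le[of m] by linarith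
      qed
    qed
  qed
qed

end

section \<open>Existence of Ito integrals\<close>

text \<open>The grids with N and L cells have the grid with N * L cells as a common refinement, so
  differences of grid processes remain grid processes without merging arbitrary partitions.\<close>

definition uniform_grid :: "real \<Rightarrow> nat \<Rightarrow> nat \<Rightarrow> real" where
  "uniform_grid t N i = t * (real i / real N)"

lemma uniform_grid_mono: "0 \<le> t \<Longrightarrow> i \<le> j \<Longrightarrow> uniform_grid t N i \<le> uniform_grid t N j"
  unfolding uniform_grid_def by (intro mult_left_mono divide_right_mono) auto

lemma uniform_grid_0 [simp]: "uniform_grid t N 0 = 0"
  by (simp add: uniform_grid_def)

lemma uniform_grid_end: "N > 0 \<Longrightarrow> uniform_grid t N N = t"
  by (simp add: uniform_grid_def)

lemma uniform_grid_refine: "L > 0 \<Longrightarrow> uniform_grid t (N * L) (i * L) = uniform_grid t N i"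
  by (simp add: uniform_grid_def)

text \<open>Increments telescope within each coarse cell. The function \<open>h\<close> is arbitrary
  because the identity serves twice: \<open>h\<close> as a path of \<open>W\<close> refines
  integrals, and \<open>h\<close> as the step function of s \<le> x refines the processes
  themselves.\<close>

lemma sum_refine_grid:
  fixes h x :: "_ \<Rightarrow> real"
  assumes "L > 0"
  shows "(\<Sum>j<N * L. x (j div L) * (h (uniform_grid t (N * L) (Suc j)) - h (uniform_grid t (N * L) j)))
    = (\<Sum>i<N. x i * (h (uniform_grid t N (Suc i)) - h (uniform_grid t N i)))"
proof -
  define H where "H j = h (uniform_grid t (N * L) j)" for j
  have "(\<Sum>j<N * L. x (j div L) * (H (Suc j) - H j)) = (\<Sum>i<N. \<Sum>j=i * L..<i * L + L. x (j div L) * (H (Suc j) - H j))"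
    by (rule sum.nat_group[symmetric])
  also have "\<dots> = (\<Sum>i<N. x i * (H (Suc i * L) - H (i * L)))"
  proof (rule sum.cong[OF refl])
    fix i
    have "(\<Sum>j=i * L..<i * L + L. x (j div L) * (H (Suc j) - H j)) = (\<Sum>j=i * L..<i * L + L. x i * (H (Suc j) - H j))"
    proof (rule sum.cong[OF refl])
      fix j assume j: "j \<in> {i * L..<i * L + L}"
      have "j div L = i" by (rule div_nat_eqI) (use j in \<open>auto simp: mult.commute\<close>)
      then show "x (j div L) * (H (Suc j) - H j) = x i * (H (Suc j) - H j)" by simp
    qed
    also have "\<dots> = x i * (H (i * L + L) - H (i * L))"
      unfolding sum_distrib_left[symmetric] by (subst sum_Suc_diff') auto
    finally show "(\<Sum>j=i * L..<i * L + L. x (j div L) * (H (Suc j) - H j)) = x i * (H (Suc i * L) - H (i * L))"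
      by (simp add: add.commute)
  qed
  also have "\<dots> = (\<Sum>i<N. x i * (h (uniform_grid t N (Suc i)) - h (uniform_grid t N i)))"
    unfolding H_def uniform_grid_refine[OF assms] ..
  finally show ?thesis by (simp add: H_def)
qed

lemma simple_process_grid:
  assumes "0 \<le> t"
  shows "simple_process N (uniform_grid t N) \<xi> s \<omega> =
    (\<Sum>i<N. \<xi> i \<omega> * (of_bool (s \<le> uniform_grid t N (Suc i)) - of_bool (s \<le> uniform_grid t N i)))"
  unfolding simple_process_def
proof (rule sum.cong[OF refl])
  fix i
  have "uniform_grid t N i \<le> uniform_grid t N (Suc i)" using assms by (rule uniform_grid_mono) simp
  then show "\<xi> i \<omega> * indicator {uniform_grid t N i<..uniform_grid t N (Suc i)} s
    = \<xi> i \<omega> * (of_bool (s \<le> uniform_grid t N (Suc i)) - of_bool (s \<le> uniform_grid t N i))"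
    by (auto simp: indicator_def)
qed

context wiener_space
begin

definition grid_adapted :: "real \<Rightarrow> nat \<Rightarrow> (nat \<Rightarrow> 'a \<Rightarrow> real) \<Rightarrow> bool" where
  "grid_adapted t N \<xi> \<longleftrightarrow> N > 0 \<and> simple_adapted M W t N (uniform_grid t N) \<xi>"

abbreviation "grid_process t N \<equiv> simple_process N (uniform_grid t N)"
abbreviation "grid_integral t N \<equiv> simple_integral W N (uniform_grid t N)"

lemma grid_adaptedI:
  assumes "0 \<le> t" "N > 0" "\<And>i. i < N \<Longrightarrow> \<xi> i \<in> borel_measurable (F (uniform_grid t N i))"
    and "\<And>i. i < N \<Longrightarrow> \<exists>C. \<forall>\<omega>\<in>space M. \<bar>\<xi> i \<omega>\<bar> \<le> C"
  shows "grid_adapted t N \<xi>"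
  using assms by (auto simp: grid_adapted_def simple_adapted_def uniform_grid_end uniform_grid_mono
      intro!: mono_onI)

text \<open>Cell j of the common refinement lies in cell \<open>j div L\<close> of the first grid
  and in cell \<open>j div N\<close> of the second. The coarse cells start no later than the fine
  one, so their coefficients remain adapted.\<close>

lemma grid_adapted_diff:
  assumes t: "0 \<le> t" and \<xi>: "grid_adapted t N \<xi>" and \<eta>: "grid_adapted t L \<eta>"
  defines "\<zeta> \<equiv> \<lambda>j \<omega>. \<xi> (j div L) \<omega> - \<eta> (j div N) \<omega>"
  shows "grid_adapted t (N * L) \<zeta>"
    and "grid_process t (N * L) \<zeta> s \<omega> = grid_process t N \<xi> s \<omega> - grid_process t L \<eta> s \<omega>"
    and "grid_integral t (N * L) \<zeta> \<omega> = grid_integral t N \<xi> \<omega> - grid_integral t L \<eta> \<omega>"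
proof -
  have N: "N > 0" and L: "L > 0" using \<xi> \<eta> by (auto simp: grid_adapted_def)
  have \<xi>m: "i < N \<Longrightarrow> \<xi> i \<in> borel_measurable (F (uniform_grid t N i))" "i < N \<Longrightarrow> \<exists>C. \<forall>\<omega>\<in>space M. \<bar>\<xi> i \<omega>\<bar> \<le> C" for i
    using \<xi> by (auto simp: grid_adapted_def simple_adapted_def)
  have \<eta>m: "i < L \<Longrightarrow> \<eta> i \<in> borel_measurable (F (uniform_grid t L i))" "i < L \<Longrightarrow> \<exists>C. \<forall>\<omega>\<in>space M. \<bar>\<eta> i \<omega>\<bar> \<le> C" for i
    using \<eta> by (auto simp: grid_adapted_def simple_adapted_def)
  show "grid_adapted t (N * L) \<zeta>"
  proof (rule grid_adaptedI[OF t])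
    show "0 < N * L" using N L by simp
    fix j assume j: "j < N * L"
    have dN: "j div L < N" using j L by (simp add: less_mult_imp_div_less)
    have dL: "j div N < L" using j N by (simp add: less_mult_imp_div_less mult.commute)
    have "uniform_grid t N (j div L) = uniform_grid t (N * L) (j div L * L)"
      by (rule uniform_grid_refine[OF L, symmetric])
    also have "\<dots> \<le> uniform_grid t (N * L) j" by (rule uniform_grid_mono[OF t]) simp
    finally have m1: "\<xi> (j div L) \<in> borel_measurable (F (uniform_grid t (N * L) j))"
      using natural_filtration_mono[OF \<xi>m(1)[OF dN]] by blast
    have "uniform_grid t L (j div N) = uniform_grid t (L * N) (j div N * N)"
      by (rule uniform_grid_refine[OF N, symmetric])
    also have "\<dots> \<le> uniform_grid t (L * N) j" by (rule uniform_grid_mono[OF t]) simp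
    finally have m2: "\<eta> (j div N) \<in> borel_measurable (F (uniform_grid t (N * L) j))"
      using natural_filtration_mono[OF \<eta>m(1)[OF dL]] by (simp add: mult.commute)
    show "\<zeta> j \<in> borel_measurable (F (uniform_grid t (N * L) j))"
      unfolding \<zeta>_def by (rule borel_measurable_diff[OF m1 m2])
    obtain C1 C2 where "\<forall>\<omega>\<in>space M. \<bar>\<xi> (j div L) \<omega>\<bar> \<le> C1" "\<forall>\<omega>\<in>space M. \<bar>\<eta> (j div N) \<omega>\<bar> \<le> C2"
      using \<xi>m(2)[OF dN] \<eta>m(2)[OF dL] by blast
    then have "\<forall>\<omega>\<in>space M. \<bar>\<zeta> j \<omega>\<bar> \<le> C1 + C2" unfolding \<zeta>_def by fastforce
    then show "\<exists>C. \<forall>\<omega>\<in>space M. \<bar>\<zeta> j \<omega>\<bar> \<le> C" by blast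
  qed
  have split: "(\<Sum>j<N * L. \<zeta> j \<omega> * (h (uniform_grid t (N * L) (Suc j)) - h (uniform_grid t (N * L) j)))
     = (\<Sum>i<N. \<xi> i \<omega> * (h (uniform_grid t N (Suc i)) - h (uniform_grid t N i)))
       - (\<Sum>i<L. \<eta> i \<omega> * (h (uniform_grid t L (Suc i)) - h (uniform_grid t L i)))" for h :: "real \<Rightarrow> real"
    using sum_refine_grid[OF L, of "\<lambda>i. \<xi> i \<omega>" h t N] sum_refine_grid[OF N, of "\<lambda>i. \<eta> i \<omega>" h t L]
    by (simp add: \<zeta>_def left_diff_distrib sum_subtractf mult.commute[of L N])
  show "grid_process t (N * L) \<zeta> s \<omega> = grid_process t N \<xi> s \<omega> - grid_process t L \<eta> s \<omega>"
    unfolding simple_process_grid[OF t] using split[of "\<lambda>x. of_bool (s \<le> x)"] by simp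
  show "grid_integral t (N * L) \<zeta> \<omega> = grid_integral t N \<xi> \<omega> - grid_integral t L \<eta> \<omega>"
    unfolding simple_integral_def using split[of "\<lambda>x. W x \<omega>"] by simp
qed

lemma grid_process_L2:
  assumes "grid_adapted t N \<xi>"
  shows "(\<lambda>s. grid_process t N \<xi> s \<omega>) \<in> L2 t"
  using assms simple_adaptedD(1-3)[of t N "uniform_grid t N" \<xi>]
  by (intro simple_process_L2) (auto simp: grid_adapted_def)

lemma energy_measurable:
  assumes "grid_adapted t N \<xi>"
  shows "(\<lambda>\<omega>. LBINT s:{0..t}. (grid_process t N \<xi> s \<omega>)\<^sup>2) \<in> borel_measurable M"
proof -
  have sa: "simple_adapted M W t N (uniform_grid t N) \<xi>" using assms by (simp add: grid_adapted_def)
  show ?thesis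
    unfolding simple_process_energy(2)[OF simple_adaptedD(1-3)[OF sa]]
    using simple_adaptedD(5)[OF sa] by (intro borel_measurable_sum borel_measurable_times borel_measurable_power) auto
qed

lemma grid_integral_prob_bound:
  assumes "grid_adapted t N \<xi>" "\<epsilon> > 0" "\<delta> \<ge> 0"
  shows "prob {\<omega> \<in> space M. \<bar>grid_integral t N \<xi> \<omega>\<bar> > \<epsilon> \<and> (LBINT s:{0..t}. (grid_process t N \<xi> s \<omega>)\<^sup>2) \<le> \<delta>}
    \<le> \<delta> / \<epsilon>\<^sup>2"
proof -
  have sa: "simple_adapted M W t N (uniform_grid t N) \<xi>" using assms by (simp add: grid_adapted_def)
  show ?thesis
    unfolding simple_process_energy(2)[OF simple_adaptedD(1-3)[OF sa]]
    by (rule simple_integral_prob_bound[OF sa assms(2,3)])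
qed

text \<open>Pathwise L2 convergence makes the energies of differences small with high probability,
  and \<open>grid_integral_prob_bound\<close> turns this into the Cauchy property of the integrals
  in probability. Borel-Cantelli extracts an almost surely convergent subsequence, and this
  subsequence is the witness in \<open>has_ito_integral\<close>.\<close>

lemma has_ito_integral_exists:
  assumes t: "0 \<le> t" and ga: "\<And>k. grid_adapted t (N k) (\<xi> k)"
    and Q: "AE \<omega> in M. (\<lambda>s. Q s \<omega>) \<in> L2 t"
    and lim: "AE \<omega> in M. (\<lambda>k. LBINT s:{0..t}. (grid_process t (N k) (\<xi> k) s \<omega> - Q s \<omega>)\<^sup>2) \<longlonglongrightarrow> 0"
  shows "\<exists>I. has_ito_integral M W Q t I"
proof -
  define J where "J k = grid_integral t (N k) (\<xi> k)" for k
  define D where "D k l \<omega> = (LBINT s:{0..t}. (grid_process t (N k) (\<xi> k) s \<omega> - grid_process t (N l) (\<xi> l) s \<omega>)\<^sup>2)" for k l \<omega>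
  have sa: "simple_adapted M W t (N k) (uniform_grid t (N k)) (\<xi> k)" for k
    using ga by (simp add: grid_adapted_def)
  have [measurable]: "J k \<in> borel_measurable M" for k
    unfolding J_def by (rule measurable_simple_integral(2)[OF sa])
  have D_eq: "D k l \<omega> = (LBINT s:{0..t}. (grid_process t (N k * N l) (\<lambda>j \<omega>. \<xi> k (j div N l) \<omega> - \<xi> l (j div N k) \<omega>) s \<omega>)\<^sup>2)" for k l \<omega>
    unfolding D_def grid_adapted_diff(2)[OF t ga ga] ..
  have [measurable]: "D k l \<in> borel_measurable M" for k l
    using energy_measurable[OF grid_adapted_diff(1)[OF t ga ga, of k l]] by (simp add: D_eq[abs_def])
  have JD: "prob {\<omega> \<in> space M. \<bar>J k \<omega> - J l \<omega>\<bar> > \<epsilon> \<and> D k l \<omega> \<le> \<delta>} \<le> \<delta> / \<epsilon>\<^sup>2"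
    if "\<epsilon> > 0" "\<delta> \<ge> 0" for k l \<epsilon> \<delta>
    using grid_integral_prob_bound[OF grid_adapted_diff(1)[OF t ga ga, of k l] that]
    unfolding grid_adapted_diff(3)[OF t ga ga] D_eq[symmetric] J_def .
  have cauchy: "\<exists>K. \<forall>k\<ge>K. \<forall>l\<ge>K. prob {\<omega> \<in> space M. \<bar>J k \<omega> - J l \<omega>\<bar> > e} \<le> e" if "e > 0" for e
  proof -
    \<comment> \<open>Chosen so that the bound \<delta> / e^2 equals e / 2; the other half of
      \<open>e\<close> is spent on the event that some energy exceeds \<delta>.\<close>
    define \<delta> where "\<delta> = e ^ 3 / 2"
    have \<delta>: "\<delta> > 0" "\<delta> / e\<^sup>2 = e / 2" using that by (simp_all add: \<delta>_def power2_eq_square power3_eq_cube)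
    have "(\<lambda>K. prob {\<omega> \<in> space M. \<exists>k\<ge>K. \<exists>l\<ge>K. D k l \<omega> > \<delta>}) \<longlonglongrightarrow> 0"
    proof (rule AE_imp_prob_tendsto_0)
      show "AE \<omega> in M. \<forall>\<^sub>F K in sequentially. \<not> (\<exists>k\<ge>K. \<exists>l\<ge>K. D k l \<omega> > \<delta>)"
        using lim Q
      proof eventually_elim
        case (elim \<omega>)
        define d where "d k = (LBINT s:{0..t}. (grid_process t (N k) (\<xi> k) s \<omega> - Q s \<omega>)\<^sup>2)" for k
        have Dd: "D k l \<omega> \<le> 2 * d k + 2 * d l" for k l
        proof -
          have "(LBINT s:{0..t}. (Q s \<omega> - grid_process t (N l) (\<xi> l) s \<omega>)\<^sup>2) = d l"
            by (simp add: d_def power2_commute)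
          then show ?thesis
            using L2_triangle[OF grid_process_L2[OF ga] grid_process_L2[OF ga] elim(2), of k \<omega> l \<omega>]
            by (simp add: D_def d_def)
        qed
        have "d \<longlonglongrightarrow> 0" using elim(1) by (simp add: d_def[abs_def])
        then have "\<forall>\<^sub>F k in sequentially. d k < \<delta> / 4" using \<delta>(1) by (intro order_tendstoD) auto
        then obtain K where K: "\<And>k. k \<ge> K \<Longrightarrow> d k < \<delta> / 4" unfolding eventually_sequentially by blast
        have "\<not> (\<exists>k\<ge>K'. \<exists>l\<ge>K'. D k l \<omega> > \<delta>)" if "K' \<ge> K" for K'
        proof safe
          fix k l assume "K' \<le> k" "K' \<le> l" "\<delta> < D k l \<omega>"
          then show False using Dd[of k l] K[of k] K[of l] that by linarith
        qed
        then show ?case unfolding eventually_sequentially by blast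
      qed
    qed measurable
    then have "\<forall>\<^sub>F K in sequentially. prob {\<omega> \<in> space M. \<exists>k\<ge>K. \<exists>l\<ge>K. D k l \<omega> > \<delta>} < e / 2"
      using that by (intro order_tendstoD) auto
    then obtain K where K: "prob {\<omega> \<in> space M. \<exists>k\<ge>K. \<exists>l\<ge>K. D k l \<omega> > \<delta>} < e / 2"
      unfolding eventually_sequentially by blast
    have "prob {\<omega> \<in> space M. \<bar>J k \<omega> - J l \<omega>\<bar> > e} \<le> e" if kl: "k \<ge> K" "l \<ge> K" for k l
    proof -
      let ?A = "{\<omega> \<in> space M. \<bar>J k \<omega> - J l \<omega>\<bar> > e \<and> D k l \<omega> \<le> \<delta>}"
      let ?B = "{\<omega> \<in> space M. \<exists>k\<ge>K. \<exists>l\<ge>K. D k l \<omega> > \<delta>}"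
      have "prob {\<omega> \<in> space M. \<bar>J k \<omega> - J l \<omega>\<bar> > e} \<le> prob (?A \<union> ?B)"
      proof (rule finite_measure_mono)
        show "{\<omega> \<in> space M. \<bar>J k \<omega> - J l \<omega>\<bar> > e} \<subseteq> ?A \<union> ?B"
        proof
          fix \<omega> assume "\<omega> \<in> {\<omega> \<in> space M. \<bar>J k \<omega> - J l \<omega>\<bar> > e}"
          then show "\<omega> \<in> ?A \<union> ?B" using kl by (cases "D k l \<omega> \<le> \<delta>") (auto simp: not_le)
        qed
      qed measurable
      also have "\<dots> \<le> prob ?A + prob ?B" by (rule measure_Un_le) measurable
      also have "prob ?A \<le> e / 2" using JD[OF \<open>e > 0\<close>, of \<delta> k l] \<delta> by simp
      finally show ?thesis using K by linarith
    qed
    then show ?thesis by blast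
  qed
  have "\<forall>j. \<exists>K. \<forall>k\<ge>K. \<forall>l\<ge>K. prob {\<omega> \<in> space M. \<bar>J k \<omega> - J l \<omega>\<bar> > (1/2)^j} \<le> (1/2)^j"
    using cauchy by simp
  then obtain K where K: "\<And>j k l. k \<ge> K j \<Longrightarrow> l \<ge> K j \<Longrightarrow> prob {\<omega> \<in> space M. \<bar>J k \<omega> - J l \<omega>\<bar> > (1/2)^j} \<le> (1/2)^j"
    by metis
  \<comment> \<open>The sum makes \<open>r\<close> strictly increasing with both \<open>r j\<close>
    and \<open>r (Suc j)\<close> at least \<open>K j\<close>, so the estimate with index j applies
    to consecutive terms.\<close>
  define r where "r j = j + (\<Sum>i\<le>j. K i)" for j
  have rK: "r j \<ge> K j" for j by (simp add: r_def lessThan_Suc_atMost[symmetric])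
  have rS: "r (Suc j) \<ge> K j" for j
    by (simp add: r_def lessThan_Suc_atMost[symmetric])
  have "strict_mono r" unfolding strict_mono_Suc_iff by (simp add: r_def)
  define A where "A j = {\<omega> \<in> space M. \<bar>J (r (Suc j)) \<omega> - J (r j) \<omega>\<bar> > (1/2)^j}" for j
  have "AE \<omega> in M. eventually (\<lambda>j. \<omega> \<in> space M - A j) sequentially"
  proof (rule borel_cantelli_AE1)
    show "summable (\<lambda>j. prob (A j))"
    proof (rule summable_comparison_test'[where g = "\<lambda>j. (1/2)^j :: real" and N = 0])
      show "norm (prob (A j)) \<le> (1/2)^j" for j unfolding A_def using K[OF rS rK] by simp
    qed (simp add: summable_geometric)
  qed (auto simp: A_def emeasure_eq_measure)
  then have conv: "AE \<omega> in M. convergent (\<lambda>j. J (r j) \<omega>)"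
  proof eventually_elim
    case (elim \<omega>)
    have "summable (\<lambda>j. J (r (Suc j)) \<omega> - J (r j) \<omega>)"
    proof (rule summable_comparison_test_ev)
      show "\<forall>\<^sub>F j in sequentially. norm (J (r (Suc j)) \<omega> - J (r j) \<omega>) \<le> (1/2)^j"
        using elim by eventually_elim (auto simp: A_def)
    qed (simp add: summable_geometric)
    then have "convergent (\<lambda>n. \<Sum>j<n. J (r (Suc j)) \<omega> - J (r j) \<omega>)" by (simp add: summable_iff_convergent)
    then have "convergent (\<lambda>n. J (r n) \<omega> - J (r 0) \<omega>)"
      using sum_lessThan_telescope[of "\<lambda>j. J (r j) \<omega>"] by (simp del: sum_subtractf)
    then show ?case using convergent_add[OF _ convergent_const, of "\<lambda>n. J (r n) \<omega> - J (r 0) \<omega>" "J (r 0) \<omega>"] by simp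
  qed
  define I where "I \<omega> = lim (\<lambda>j. J (r j) \<omega>)" for \<omega>
  have [measurable]: "I \<in> borel_measurable M" unfolding I_def by measurable
  have I_lim: "AE \<omega> in M. (\<lambda>j. J (r j) \<omega>) \<longlonglongrightarrow> I \<omega>"
    using conv by eventually_elim (simp add: I_def convergent_LIMSEQ_iff)
  have "converges_in_probability M (\<lambda>j. J (r j)) I"
    unfolding converges_in_probability_def
  proof (intro allI impI AE_imp_prob_tendsto_0)
    fix \<epsilon> :: real assume "\<epsilon> > 0"
    show "AE \<omega> in M. \<forall>\<^sub>F j in sequentially. \<not> \<bar>J (r j) \<omega> - I \<omega>\<bar> > \<epsilon>"
      using I_lim
    proof eventually_elim
      case (elim \<omega>)
      from tendstoD[OF elim \<open>\<epsilon> > 0\<close>] show ?case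
        by eventually_elim (simp add: dist_real_def)
    qed
  qed measurable
  moreover have "AE \<omega> in M. (\<lambda>j. LBINT s:{0..t}. (grid_process t (N (r j)) (\<xi> (r j)) s \<omega> - Q s \<omega>)\<^sup>2) \<longlonglongrightarrow> 0"
    using lim
  proof eventually_elim
    case (elim \<omega>)
    from LIMSEQ_subseq_LIMSEQ[OF elim \<open>strict_mono r\<close>] show ?case by (simp add: comp_def)
  qed
  ultimately have "has_ito_integral M W Q t I"
    unfolding has_ito_integral_def
    using Q sa by (auto simp: J_def intro!: exI[of _ "\<lambda>j. N (r j)"] exI[of _ "\<lambda>j. uniform_grid t (N (r j))"] exI[of _ "\<lambda>j. \<xi> (r j)"])
  then show ?thesis by blast
qed

end

section \<open>Grid approximation of continuous adapted processes\<close>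

lemma uniform_grid_cell:
  assumes "0 < s" "s \<le> t" "N > 0"
  shows "\<exists>i<N. uniform_grid t N i < s \<and> s \<le> uniform_grid t N (Suc i)"
proof -
  define i where "i = (LEAST i. s \<le> uniform_grid t N (Suc i))"
  have N: "s \<le> uniform_grid t N (Suc (N - 1))" using assms by (simp add: uniform_grid_end)
  then have "s \<le> uniform_grid t N (Suc i)" unfolding i_def by (rule LeastI)
  moreover have "i \<le> N - 1" using N unfolding i_def by (rule Least_le)
  moreover have "uniform_grid t N i < s"
  proof (cases i)
    case 0
    then show ?thesis using assms by simp
  next
    case (Suc j)
    then have "\<not> s \<le> uniform_grid t N (Suc j)" using not_less_Least[of j "\<lambda>i. s \<le> uniform_grid t N (Suc i)"] by (simp add: i_def)
    then show ?thesis using Suc by simp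
  qed
  ultimately show ?thesis using assms(3) by (intro exI[of _ i]) auto
qed

lemma simple_process_cell:
  assumes "0 \<le> t" "i < N" "uniform_grid t N i < s" "s \<le> uniform_grid t N (Suc i)"
  shows "simple_process N (uniform_grid t N) \<xi> s \<omega> = \<xi> i \<omega>"
proof -
  have "simple_process N (uniform_grid t N) \<xi> s \<omega> = (\<Sum>j<N. if j = i then \<xi> i \<omega> else 0)"
    unfolding simple_process_def
  proof (rule sum.cong[OF refl])
    fix j assume "j \<in> {..<N}"
    show "\<xi> j \<omega> * indicator {uniform_grid t N j<..uniform_grid t N (Suc j)} s = (if j = i then \<xi> i \<omega> else 0)"
    proof (cases j i rule: linorder_cases)
      case less
      then have "uniform_grid t N (Suc j) \<le> uniform_grid t N i" using assms(1) by (intro uniform_grid_mono) auto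
      then show ?thesis using less assms by auto
    next
      case equal
      then show ?thesis using assms by simp
    next
      case greater
      then have "uniform_grid t N (Suc i) \<le> uniform_grid t N j" using assms(1) by (intro uniform_grid_mono) auto
      then show ?thesis using greater assms by auto
    qed
  qed
  then show ?thesis using assms by simp
qed

text \<open>Dominated convergence. The free function \<open>g\<close> allows two uses: with g = y
  the distances tend to 0, and with \<open>g\<close> a fixed simple path the distance to
  \<open>y\<close> becomes a limit of distances between simple paths.\<close>

lemma bounded_L2_tendsto:
  fixes f :: "nat \<Rightarrow> real \<Rightarrow> real"
  assumes f: "\<And>m. set_borel_measurable lborel {0..t} (f m)" "\<And>m s. s \<in> {0..t} \<Longrightarrow> \<bar>f m s\<bar> \<le> C"
    and g: "set_borel_measurable lborel {0..t} g" "\<And>s. s \<in> {0..t} \<Longrightarrow> \<bar>g s\<bar> \<le> C"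
    and y: "set_borel_measurable lborel {0..t} y"
    and lim: "AE s in lborel. s \<in> {0..t} \<longrightarrow> (\<lambda>m. f m s) \<longlonglongrightarrow> y s"
  shows "(\<lambda>m. LBINT s:{0..t}. (g s - f m s)\<^sup>2) \<longlonglongrightarrow> (LBINT s:{0..t}. (g s - y s)\<^sup>2)"
proof -
  have meas: "(\<lambda>s. indicator {0..t} s *\<^sub>R (g s - h s)\<^sup>2) \<in> borel_measurable lborel"
    if "set_borel_measurable lborel {0..t} h" for h
  proof -
    have "(\<lambda>s. (indicator {0..t} s *\<^sub>R g s - indicator {0..t} s *\<^sub>R h s)\<^sup>2) \<in> borel_measurable lborel"
      using g(1) that unfolding set_borel_measurable_def by (rule borel_measurable_power[OF borel_measurable_diff])
    also have "(\<lambda>s. (indicator {0..t} s *\<^sub>R g s - indicator {0..t} s *\<^sub>R h s)\<^sup>2) = (\<lambda>s. indicator {0..t} s *\<^sub>R (g s - h s)\<^sup>2)"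
      by (auto simp: indicator_def)
    finally show ?thesis .
  qed
  show ?thesis
    unfolding set_lebesgue_integral_def
  proof (rule integral_dominated_convergence)
    show "integrable lborel (\<lambda>s. indicator {0..t} s *\<^sub>R (2 * C)\<^sup>2)"
      using bounded_set_integrable[of "\<lambda>_. (2 * C)\<^sup>2" 0 t "(2 * C)\<^sup>2"] by (simp add: set_integrable_def)
    show "AE s in lborel. (\<lambda>m. indicator {0..t} s *\<^sub>R (g s - f m s)\<^sup>2) \<longlonglongrightarrow> indicator {0..t} s *\<^sub>R (g s - y s)\<^sup>2"
      using lim
    proof eventually_elim
      case (elim s)
      show ?case
      proof (cases "s \<in> {0..t}")
        case True
        then show ?thesis using elim by (intro tendsto_intros) simp
      qed simp
    qed
    show "AE s in lborel. norm (indicator {0..t} s *\<^sub>R (g s - f m s)\<^sup>2) \<le> indicator {0..t} s *\<^sub>R (2 * C)\<^sup>2" for m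
    proof (rule AE_I2)
      fix s
      show "norm (indicator {0..t} s *\<^sub>R (g s - f m s)\<^sup>2) \<le> indicator {0..t} s *\<^sub>R (2 * C)\<^sup>2"
      proof (cases "s \<in> {0..t}")
        case True
        then have "\<bar>g s - f m s\<bar> \<le> 2 * C" using f(2)[of s m] g(2)[of s] by linarith
        then have "\<bar>g s - f m s\<bar>\<^sup>2 \<le> (2 * C)\<^sup>2" by (rule power_mono) simp
        then show ?thesis using True by simp
      qed simp
    qed
  qed (use meas f y in auto)
qed

context wiener_space
begin

text \<open>The process is sampled at the left end of each cell, using versions measurable for the
  filtration. Measurability of the distance is part of the conclusion because it is not evident:
  nothing is assumed about \<open>Y\<close> jointly in time and sample point.\<close>

lemma continuous_grid_approx:
  assumes t: "0 \<le> t" and Y: "\<And>s. s \<in> {0..t} \<Longrightarrow> ae_measurable M (F s) (Y s)"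
    and cont: "AE \<omega> in M. continuous_on {0..t} (\<lambda>s. Y s \<omega>)"
  obtains \<xi> where "\<And>n. grid_adapted t (Suc n) (\<xi> n)"
    and "AE \<omega> in M. (\<lambda>n. LBINT s:{0..t}. (grid_process t (Suc n) (\<xi> n) s \<omega> - Y s \<omega>)\<^sup>2) \<longlonglongrightarrow> 0"
    and "\<And>n. ae_measurable M M (\<lambda>\<omega>. LBINT s:{0..t}. (grid_process t (Suc n) (\<xi> n) s \<omega> - Y s \<omega>)\<^sup>2)"
proof -
  have grid_in: "uniform_grid t (Suc n) i \<in> {0..t}" if "i \<le> Suc n" for n i
    using uniform_grid_mono[OF t, of 0 i "Suc n"] uniform_grid_mono[OF t that, of "Suc n"] by (simp add: uniform_grid_end)
  have "\<forall>s. \<exists>V. s \<in> {0..t} \<longrightarrow> V \<in> borel_measurable (F s) \<and> (AE \<omega> in M. Y s \<omega> = V \<omega>)"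
    using Y unfolding ae_measurable_def by blast
  then obtain V where V: "\<And>s. s \<in> {0..t} \<Longrightarrow> V s \<in> borel_measurable (F s)"
    and VY: "\<And>s. s \<in> {0..t} \<Longrightarrow> AE \<omega> in M. Y s \<omega> = V s \<omega>" by metis
  \<comment> \<open>\<open>simple_adapted\<close> demands bounded coefficients, so the samples are
    clamped at level n. A continuous path is bounded on \<open>{0..t}\<close>, hence the clamp is
    eventually inactive on it.\<close>
  define cl where "cl n x = max (- real n) (min (real n) x)" for n x
  have [measurable]: "cl n \<in> borel_measurable borel" for n unfolding cl_def by measurable
  have cl_abs: "\<bar>cl n x\<bar> \<le> \<bar>x\<bar>" "\<bar>cl n x\<bar> \<le> real n" for n x by (auto simp: cl_def)
  have cl_id: "cl n x = x" if "\<bar>x\<bar> \<le> real n" for n x using that by (auto simp: cl_def)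
  define \<xi> where "\<xi> n i \<omega> = cl n (V (uniform_grid t (Suc n) i) \<omega>)" for n i \<omega>
  have ga: "grid_adapted t (Suc n) (\<xi> n)" for n
  proof (rule grid_adaptedI[OF t])
    fix i assume "i < Suc n"
    then have [measurable]: "V (uniform_grid t (Suc n) i) \<in> borel_measurable (F (uniform_grid t (Suc n) i))"
      by (intro V grid_in) simp
    show "\<xi> n i \<in> borel_measurable (F (uniform_grid t (Suc n) i))" unfolding \<xi>_def by measurable
    show "\<exists>C. \<forall>\<omega>\<in>space M. \<bar>\<xi> n i \<omega>\<bar> \<le> C" using cl_abs(2) by (auto simp: \<xi>_def)
  qed simp
  have "AE \<omega> in M. \<forall>n. \<forall>i\<in>{..Suc n}. Y (uniform_grid t (Suc n) i) \<omega> = V (uniform_grid t (Suc n) i) \<omega>"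
    unfolding AE_all_countable
    by (intro allI AE_finite_allI) (auto intro!: VY grid_in simp del: uniform_grid_0)
  then have paths: "AE \<omega> in M. set_borel_measurable lborel {0..t} (\<lambda>s. Y s \<omega>) \<and>
      (\<exists>C. (\<forall>s\<in>{0..t}. \<bar>Y s \<omega>\<bar> \<le> C) \<and> (\<forall>n. \<forall>s\<in>{0..t}. \<bar>grid_process t (Suc n) (\<xi> n) s \<omega>\<bar> \<le> C)) \<and>
      (\<forall>s. 0 < s \<and> s \<le> t \<longrightarrow> (\<lambda>n. grid_process t (Suc n) (\<xi> n) s \<omega>) \<longlonglongrightarrow> Y s \<omega>)"
    using cont
  proof eventually_elim
    case (elim \<omega>)
    have \<xi>_eq: "\<xi> n i \<omega> = cl n (Y (uniform_grid t (Suc n) i) \<omega>)" if "i < Suc n" for n i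
      using elim(1) that unfolding \<xi>_def by force
    have "bounded ((\<lambda>s. Y s \<omega>) ` {0..t})"
      using elim(2) by (intro compact_imp_bounded compact_continuous_image) auto
    then obtain C where C: "\<And>s. s \<in> {0..t} \<Longrightarrow> \<bar>Y s \<omega>\<bar> \<le> C"
      unfolding bounded_iff by (metis image_eqI real_norm_def)
    have "0 \<le> C" using C[of 0] t by force
    have cell: "\<exists>u\<in>{0..t}. u < s \<and> s \<le> u + t / real (Suc n) \<and> grid_process t (Suc n) (\<xi> n) s \<omega> = cl n (Y u \<omega>)"
      if s: "0 < s" "s \<le> t" for s n
    proof -
      obtain i where i: "i < Suc n" "uniform_grid t (Suc n) i < s" "s \<le> uniform_grid t (Suc n) (Suc i)"
        using uniform_grid_cell[OF s, of "Suc n"] by auto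
      have "uniform_grid t (Suc n) (Suc i) = uniform_grid t (Suc n) i + t / real (Suc n)"
        by (simp add: uniform_grid_def add_divide_distrib distrib_left)
      then show ?thesis
        using i simple_process_cell[OF t i, of "\<xi> n" \<omega>] \<xi>_eq[OF i(1)] grid_in[of i n]
        by (intro bexI[of _ "uniform_grid t (Suc n) i"]) auto
    qed
    have bd: "\<bar>grid_process t (Suc n) (\<xi> n) s \<omega>\<bar> \<le> C" if "s \<in> {0..t}" for n s
    proof (cases "s = 0")
      case True
      have "grid_process t (Suc n) (\<xi> n) 0 \<omega> = 0"
        unfolding simple_process_def
      proof (rule sum.neutral, intro ballI)
        fix i
        have "0 \<le> uniform_grid t (Suc n) i" using uniform_grid_mono[OF t, of 0 i "Suc n"] by simp
        then show "\<xi> n i \<omega> * indicator {uniform_grid t (Suc n) i<..uniform_grid t (Suc n) (Suc i)} 0 = 0" by simp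
      qed
      then show ?thesis using True \<open>0 \<le> C\<close> by simp
    next
      case False
      then have "0 < s" "s \<le> t" using that by auto
      from cell[OF this, of n] obtain u where "u \<in> {0..t}" "grid_process t (Suc n) (\<xi> n) s \<omega> = cl n (Y u \<omega>)"
        by blast
      then show ?thesis using cl_abs(1)[of n "Y u \<omega>"] C[of u] by simp
    qed
    have lim: "(\<lambda>n. grid_process t (Suc n) (\<xi> n) s \<omega>) \<longlonglongrightarrow> Y s \<omega>" if s: "0 < s" "s \<le> t" for s
    proof -
      obtain u where u: "\<And>n. u n \<in> {0..t}" "\<And>n. u n < s" "\<And>n. s \<le> u n + t / real (Suc n)"
        and gu: "\<And>n. grid_process t (Suc n) (\<xi> n) s \<omega> = cl n (Y (u n) \<omega>)"
        using cell[OF s] by metis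
      have "(\<lambda>n. s - t / real (Suc n)) \<longlonglongrightarrow> s - t * 0"
        unfolding divide_inverse using LIMSEQ_inverse_real_of_nat by (intro tendsto_intros)
      then have "(\<lambda>n. s - t / real (Suc n)) \<longlonglongrightarrow> s" by simp
      then have "u \<longlonglongrightarrow> s"
      proof (rule tendsto_sandwich[rotated 2])
        show "\<forall>\<^sub>F n in sequentially. s - t / real (Suc n) \<le> u n"
          using u(3) by (intro always_eventually allI) (simp add: algebra_simps del: of_nat_Suc)
        show "\<forall>\<^sub>F n in sequentially. u n \<le> s" using u(2) by (intro always_eventually allI less_imp_le)
      qed simp
      then have "(\<lambda>n. Y (u n) \<omega>) \<longlonglongrightarrow> Y s \<omega>"
        by (rule continuous_on_tendsto_compose[OF elim(2)]) (use s u(1) in auto)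
      moreover have "\<forall>\<^sub>F n in sequentially. Y (u n) \<omega> = cl n (Y (u n) \<omega>)"
      proof -
        obtain n0 where "C \<le> real n0" using real_arch_simple by blast
        then have "Y (u n) \<omega> = cl n (Y (u n) \<omega>)" if "n \<ge> n0" for n
          using C[OF u(1), of n] that by (intro cl_id[symmetric]) linarith
        then show ?thesis unfolding eventually_sequentially by blast
      qed
      ultimately show ?thesis unfolding gu by (rule Lim_transform_eventually)
    qed
    have "set_borel_measurable lborel {0..t} (\<lambda>s. Y s \<omega>)"
      unfolding set_borel_measurable_def
      using borel_measurable_continuous_on_indicator[OF _ elim(2)] by simp
    then show ?case using C bd lim by blast
  qed
  define d where "d n \<omega> = (LBINT s:{0..t}. (grid_process t (Suc n) (\<xi> n) s \<omega> - Y s \<omega>)\<^sup>2)" for n \<omega>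
  have gm: "set_borel_measurable lborel {0..t} (\<lambda>s. grid_process t (Suc n) (\<xi> n) s \<omega>)" for n \<omega>
    unfolding set_borel_measurable_def by measurable
  have nz: "AE s in lborel. s \<noteq> (0 :: real)" by (rule AE_lborel_singleton)
  have d0: "AE \<omega> in M. (\<lambda>n. d n \<omega>) \<longlonglongrightarrow> 0"
    using paths
  proof eventually_elim
    case (elim \<omega>)
    then obtain C where C: "\<And>s. s \<in> {0..t} \<Longrightarrow> \<bar>Y s \<omega>\<bar> \<le> C" "\<And>n s. s \<in> {0..t} \<Longrightarrow> \<bar>grid_process t (Suc n) (\<xi> n) s \<omega>\<bar> \<le> C" by blast
    have "AE s in lborel. s \<in> {0..t} \<longrightarrow> (\<lambda>n. grid_process t (Suc n) (\<xi> n) s \<omega>) \<longlonglongrightarrow> Y s \<omega>"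
      using nz by eventually_elim (use elim in auto)
    moreover have ms: "set_borel_measurable lborel {0..t} (\<lambda>s. Y s \<omega>)" using elim by (rule conjunct1)
    ultimately have "(\<lambda>n. LBINT s:{0..t}. (Y s \<omega> - grid_process t (Suc n) (\<xi> n) s \<omega>)\<^sup>2) \<longlonglongrightarrow> (LBINT s:{0..t}. (Y s \<omega> - Y s \<omega>)\<^sup>2)"
      by (intro bounded_L2_tendsto[OF gm C(2) ms C(1) ms])
    then show ?case unfolding d_def by (simp add: power2_commute)
  qed
  have "ae_measurable M M (d n)" for n
  proof (rule ae_measurable_lim)
    \<comment> \<open>The distance between two grid processes is measurable, and letting the second
      grid become fine turns it into the distance to \<open>Y\<close>.\<close>
    define D where "D m \<omega> = (LBINT s:{0..t}. (grid_process t (Suc n) (\<xi> n) s \<omega> - grid_process t (Suc m) (\<xi> m) s \<omega>)\<^sup>2)" for m \<omega>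
    show "ae_measurable M M (D m)" for m
      using energy_measurable[OF grid_adapted_diff(1)[OF t ga ga, of n m]]
      unfolding grid_adapted_diff(2)[OF t ga ga] D_def by (rule ae_measurableI)
    show "AE \<omega> in M. (\<lambda>m. D m \<omega>) \<longlonglongrightarrow> d n \<omega>"
      using paths
    proof eventually_elim
      case (elim \<omega>)
      then obtain C where C: "\<And>s. s \<in> {0..t} \<Longrightarrow> \<bar>Y s \<omega>\<bar> \<le> C" "\<And>n s. s \<in> {0..t} \<Longrightarrow> \<bar>grid_process t (Suc n) (\<xi> n) s \<omega>\<bar> \<le> C" by blast
      have "AE s in lborel. s \<in> {0..t} \<longrightarrow> (\<lambda>n. grid_process t (Suc n) (\<xi> n) s \<omega>) \<longlonglongrightarrow> Y s \<omega>"
        using nz by eventually_elim (use elim in auto)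
      moreover have ms: "set_borel_measurable lborel {0..t} (\<lambda>s. Y s \<omega>)" using elim by (rule conjunct1)
      ultimately show ?case unfolding D_def d_def by (intro bounded_L2_tendsto[OF gm C(2) gm C(2) ms])
    qed
  qed
  then show ?thesis using ga d0 by (intro that[of \<xi>]) (auto simp: d_def[abs_def])
qed

text \<open>How fine a grid must be depends on the path, so a diagonal sequence cannot be chosen
  pathwise. Instead, the k-th grid is chosen so that its distance to \<open>Y k\<close> exceeds
  (1/2)^k only with probability at most (1/2)^k; by Borel-Cantelli almost every path meets only
  finitely many exceptions.\<close>

lemma has_ito_integral_of_limit:
  assumes t: "0 \<le> t" and Y: "\<And>k s. s \<in> {0..t} \<Longrightarrow> ae_measurable M (F s) (Y k s)"
    and cont: "\<And>k. AE \<omega> in M. continuous_on {0..t} (\<lambda>s. Y k s \<omega>)"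
    and Q: "AE \<omega> in M. (\<lambda>s. Q s \<omega>) \<in> L2 t"
    and lim: "AE \<omega> in M. (\<lambda>k. LBINT s:{0..t}. (Y k s \<omega> - Q s \<omega>)\<^sup>2) \<longlonglongrightarrow> 0"
  shows "\<exists>I. has_ito_integral M W Q t I"
proof -
  define d where "d \<xi> k n \<omega> = (LBINT s:{0..t}. (grid_process t (Suc n) (\<xi> n) s \<omega> - Y k s \<omega>)\<^sup>2)" for \<xi> k n \<omega>
  \<comment> \<open>A triple consists of the number of cells, the coefficients and an exceptional
    event; packing them together lets one choice serve all k.\<close>
  define P where "P k z \<longleftrightarrow> grid_adapted t (fst z) (fst (snd z)) \<and> snd (snd z) \<in> events \<and> prob (snd (snd z)) \<le> (1/2)^k \<and>
      (AE \<omega> in M. \<omega> \<notin> snd (snd z) \<longrightarrow> (LBINT s:{0..t}. (grid_process t (fst z) (fst (snd z)) s \<omega> - Y k s \<omega>)\<^sup>2) \<le> (1/2)^k)" for k z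
  have "\<exists>z. P k z" for k
  proof -
    have Yk: "\<And>s. s \<in> {0..t} \<Longrightarrow> ae_measurable M (F s) (Y k s)" by (rule Y)
    obtain \<xi> where \<xi>: "\<And>n. grid_adapted t (Suc n) (\<xi> n)" "AE \<omega> in M. (\<lambda>n. d \<xi> k n \<omega>) \<longlonglongrightarrow> 0"
      "\<And>n. ae_measurable M M (d \<xi> k n)"
      using continuous_grid_approx[OF t Yk cont[of k]] unfolding d_def by blast
    \<comment> \<open>The distances are measurable only up to null sets; the exceptional events are
      defined from measurable versions.\<close>
    obtain d' where d'[measurable]: "\<And>n. d' n \<in> borel_measurable M" and dd': "\<And>n. AE \<omega> in M. d \<xi> k n \<omega> = d' n \<omega>"
      using \<xi>(3) unfolding ae_measurable_def by metis
    have alln: "AE \<omega> in M. \<forall>n. d \<xi> k n \<omega> = d' n \<omega>" using dd' by (simp add: AE_all_countable)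
    have "(\<lambda>n. prob {\<omega> \<in> space M. d' n \<omega> > (1/2)^k}) \<longlonglongrightarrow> 0"
    proof (rule AE_imp_prob_tendsto_0)
      show "AE \<omega> in M. \<forall>\<^sub>F n in sequentially. \<not> d' n \<omega> > (1/2)^k"
        using \<xi>(2) alln
      proof eventually_elim
        case (elim \<omega>)
        then have "(\<lambda>n. d' n \<omega>) \<longlonglongrightarrow> 0" using elim by simp
        then have "\<forall>\<^sub>F n in sequentially. d' n \<omega> < (1/2)^k" by (intro order_tendstoD) auto
        then show ?case by (rule eventually_mono) simp
      qed
    qed measurable
    then have "\<forall>\<^sub>F n in sequentially. prob {\<omega> \<in> space M. d' n \<omega> > (1/2)^k} < (1/2)^k"
      by (intro order_tendstoD) auto
    then obtain n where n: "prob {\<omega> \<in> space M. d' n \<omega> > (1/2)^k} < (1/2)^k"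
      unfolding eventually_sequentially by blast
    have "AE \<omega> in M. \<omega> \<notin> {\<omega> \<in> space M. d' n \<omega> > (1/2)^k} \<longrightarrow> d \<xi> k n \<omega> \<le> (1/2)^k"
      using dd'[of n] AE_space by eventually_elim auto
    moreover have "{\<omega> \<in> space M. d' n \<omega> > (1/2)^k} \<in> events" by measurable
    moreover have "prob {\<omega> \<in> space M. d' n \<omega> > (1/2)^k} \<le> (1/2)^k" using n by simp
    ultimately show ?thesis
      using \<xi>(1)[of n] unfolding d_def P_def
      by (intro exI[of _ "(Suc n, \<xi> n, {\<omega> \<in> space M. d' n \<omega> > (1/2)^k})"]) simp
  qed
  then obtain z where z: "\<And>k. P k (z k)" by metis
  define N where "N k = fst (z k)" for k
  define \<xi> where "\<xi> k = fst (snd (z k))" for k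
  define A where "A k = snd (snd (z k))" for k
  have ga: "\<And>k. grid_adapted t (N k) (\<xi> k)" and A: "\<And>k. A k \<in> events" "\<And>k. prob (A k) \<le> (1/2)^k"
    and le: "\<And>k. AE \<omega> in M. \<omega> \<notin> A k \<longrightarrow> (LBINT s:{0..t}. (grid_process t (N k) (\<xi> k) s \<omega> - Y k s \<omega>)\<^sup>2) \<le> (1/2)^k"
    using z by (simp_all add: P_def N_def \<xi>_def A_def)
  have BC: "AE \<omega> in M. eventually (\<lambda>k. \<omega> \<in> space M - A k) sequentially"
  proof (rule borel_cantelli_AE1)
    show "summable (\<lambda>k. prob (A k))"
    proof (rule summable_comparison_test'[where g = "\<lambda>j. (1/2)^j :: real" and N = 0])
      show "norm (prob (A k)) \<le> (1/2)^k" for k using A(2)[of k] by simp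
    qed (simp add: summable_geometric)
  qed (use A in \<open>auto simp: emeasure_eq_measure\<close>)
  have le': "AE \<omega> in M. \<forall>k. \<omega> \<notin> A k \<longrightarrow> (LBINT s:{0..t}. (grid_process t (N k) (\<xi> k) s \<omega> - Y k s \<omega>)\<^sup>2) \<le> (1/2)^k"
    using le by (simp add: AE_all_countable)
  have cont': "AE \<omega> in M. \<forall>k. continuous_on {0..t} (\<lambda>s. Y k s \<omega>)" using cont by (simp add: AE_all_countable)
  have "AE \<omega> in M. (\<lambda>k. LBINT s:{0..t}. (grid_process t (N k) (\<xi> k) s \<omega> - Q s \<omega>)\<^sup>2) \<longlonglongrightarrow> 0"
    using BC le' cont' Q lim
  proof eventually_elim
    case (elim \<omega>)
    have YL2: "(\<lambda>s. Y k s \<omega>) \<in> L2 t" for k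
    proof -
      have c: "continuous_on {0..t} (\<lambda>s. Y k s \<omega>)" using elim(3) by simp
      have "set_integrable lborel {0..t} (\<lambda>s. (Y k s \<omega>)\<^sup>2)"
        unfolding set_integrable_def
        by (rule borel_integrable_compact) (auto intro!: continuous_intros c)
      moreover have "set_borel_measurable lborel {0..t} (\<lambda>s. Y k s \<omega>)"
        unfolding set_borel_measurable_def
        using borel_measurable_continuous_on_indicator[OF _ c] by simp
      ultimately show ?thesis by (simp add: L2_def)
    qed
    show ?case
    proof (rule tendsto_sandwich)
      show "\<forall>\<^sub>F k in sequentially. 0 \<le> (LBINT s:{0..t}. (grid_process t (N k) (\<xi> k) s \<omega> - Q s \<omega>)\<^sup>2)"
        by (intro always_eventually allI set_integral_square_nonneg)
      show "\<forall>\<^sub>F k in sequentially. (LBINT s:{0..t}. (grid_process t (N k) (\<xi> k) s \<omega> - Q s \<omega>)\<^sup>2)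
          \<le> 2 * (1/2)^k + 2 * (LBINT s:{0..t}. (Y k s \<omega> - Q s \<omega>)\<^sup>2)"
        using elim(1)
      proof (rule eventually_mono)
        fix k assume "\<omega> \<in> space M - A k"
        then have "(LBINT s:{0..t}. (grid_process t (N k) (\<xi> k) s \<omega> - Y k s \<omega>)\<^sup>2) \<le> (1/2)^k" using elim(2) by simp
        then show "(LBINT s:{0..t}. (grid_process t (N k) (\<xi> k) s \<omega> - Q s \<omega>)\<^sup>2)
          \<le> 2 * (1/2)^k + 2 * (LBINT s:{0..t}. (Y k s \<omega> - Q s \<omega>)\<^sup>2)"
          using L2_triangle[OF grid_process_L2[OF ga] elim(4) YL2, of k \<omega> k] by linarith
      qed
      have "(\<lambda>k. 2 * (1/2)^k + 2 * (LBINT s:{0..t}. (Y k s \<omega> - Q s \<omega>)\<^sup>2)) \<longlonglongrightarrow> 2 * 0 + 2 * 0"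
        using elim(5) by (intro tendsto_intros LIMSEQ_power_zero) auto
      then show "(\<lambda>k. 2 * (1/2)^k + 2 * (LBINT s:{0..t}. (Y k s \<omega> - Q s \<omega>)\<^sup>2)) \<longlonglongrightarrow> 0" by simp
    qed simp
  qed
  then show ?thesis by (rule has_ito_integral_exists[OF t ga Q])
qed


text \<open>The approximating simple integrals are measurable for the filtration at time
  \<open>t\<close>, and a subsequence of a sequence converging in probability converges almost
  surely.\<close>

lemma ito_integral_ae_measurable:
  assumes "has_ito_integral M W Q t I"
  shows "ae_measurable M (F t) I"
proof -
  obtain n \<tau> \<xi> where sa: "\<And>k. simple_adapted M W t (n k) (\<tau> k) (\<xi> k)"
    and prob: "converges_in_probability M (\<lambda>k. simple_integral W (n k) (\<tau> k) (\<xi> k)) I"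
    using assms unfolding has_ito_integral_def by auto
  define J where "J k = simple_integral W (n k) (\<tau> k) (\<xi> k)" for k
  have JF: "J k \<in> borel_measurable (F t)" for k
    unfolding J_def by (rule measurable_simple_integral(1)[OF sa])
  have [measurable]: "J k \<in> borel_measurable M" for k using JF by (rule measurable_F_M)
  have [measurable]: "I \<in> borel_measurable M" using assms by (simp add: has_ito_integral_def)
  have "\<exists>k. prob {\<omega> \<in> space M. \<bar>J k \<omega> - I \<omega>\<bar> > (1/2)^j} < (1/2)^j" for j :: nat
  proof -
    have "(\<lambda>k. prob {\<omega> \<in> space M. \<bar>J k \<omega> - I \<omega>\<bar> > (1/2)^j}) \<longlonglongrightarrow> 0"
      unfolding J_def by (rule converges_in_probabilityD[OF prob]) simp
    then have "\<forall>\<^sub>F k in sequentially. prob {\<omega> \<in> space M. \<bar>J k \<omega> - I \<omega>\<bar> > (1/2)^j} < (1/2)^j"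
      by (intro order_tendstoD) auto
    then show ?thesis unfolding eventually_sequentially by blast
  qed
  then obtain r where r: "\<And>j. prob {\<omega> \<in> space M. \<bar>J (r j) \<omega> - I \<omega>\<bar> > (1/2)^j} < (1/2)^j" by metis
  have "AE \<omega> in M. eventually (\<lambda>j. \<omega> \<in> space M - {\<omega> \<in> space M. \<bar>J (r j) \<omega> - I \<omega>\<bar> > (1/2)^j}) sequentially"
  proof (rule borel_cantelli_AE1)
    show "summable (\<lambda>j. prob {\<omega> \<in> space M. \<bar>J (r j) \<omega> - I \<omega>\<bar> > (1/2)^j})"
    proof (rule summable_comparison_test'[where g = "\<lambda>j. (1/2)^j :: real" and N = 0])
      show "norm (prob {\<omega> \<in> space M. \<bar>J (r j) \<omega> - I \<omega>\<bar> > (1/2)^j}) \<le> (1/2)^j" for j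
        using r[of j] by simp
    qed (simp add: summable_geometric)
  qed (auto simp: emeasure_eq_measure)
  then have "AE \<omega> in M. (\<lambda>j. J (r j) \<omega>) \<longlonglongrightarrow> I \<omega>"
  proof eventually_elim
    case (elim \<omega>)
    have "(\<lambda>j. J (r j) \<omega> - I \<omega>) \<longlonglongrightarrow> 0"
    proof (rule Lim_null_comparison)
      show "\<forall>\<^sub>F j in sequentially. norm (J (r j) \<omega> - I \<omega>) \<le> (1/2)^j"
        using elim by eventually_elim auto
      show "(\<lambda>j. (1/2)^j :: real) \<longlonglongrightarrow> 0" by (intro LIMSEQ_power_zero) simp
    qed
    then show ?case by (rule LIM_zero_cancel)
  qed
  then show ?thesis by (rule ae_measurable_lim[rotated]) (intro ae_measurableI JF)
qed

end

section \<open>Picard iterates and adaptedness of the solution\<close>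

lemma continuous_on_scale:
  fixes c :: "real \<Rightarrow> real"
  assumes "continuous_on {0..T} c" "s \<in> {0..T}"
  shows "continuous_on {0..1} (\<lambda>v. c (s * v))"
proof (rule continuous_on_compose2[OF assms(1)])
  show "(\<lambda>v. s * v) ` {0..1} \<subseteq> {0..T}"
  proof safe
    fix v :: real assume v: "v \<in> {0..1}"
    then have "s * v \<le> s * 1" using assms(2) by (intro mult_left_mono) auto
    then show "s * v \<in> {0..T}" using assms(2) v by auto
  qed
qed (intro continuous_intros)

lemma continuous_set_integrable:
  fixes c :: "real \<Rightarrow> real"
  assumes "continuous_on {a..b} c"
  shows "set_integrable lborel {a..b} c"
  unfolding set_integrable_def by (rule borel_integrable_compact[OF _ assms]) simp

lemma scaled_integral_eq:
  fixes c :: "real \<Rightarrow> real"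
  assumes "0 \<le> s"
  shows "s * (LBINT v:{0..1}. c (s * v)) = (LBINT u:{0..s}. c u)"
proof (cases "s = 0")
  case True
  then show ?thesis by (simp add: set_integral_at_point)
next
  case False
  then show ?thesis using set_integral_scale[of s 0 c] assms by simp
qed

lemma continuous_on_primitive:
  fixes c :: "real \<Rightarrow> real"
  assumes "continuous_on {0..T} c"
  shows "continuous_on {0..T} (\<lambda>s. LBINT u:{0..s}. c u)"
proof -
  have "continuous_on {0..T} (\<lambda>s. integral {0..s} c)"
    by (rule indefinite_integral_continuous_1) (rule integrable_continuous_real[OF assms])
  moreover have "integral {0..s} c = (LBINT u:{0..s}. c u)" if "s \<in> {0..T}" for s
    using that assms
    by (intro set_borel_integral_eq_integral(2)[symmetric] continuous_set_integrable)
       (auto elim: continuous_on_subset)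
  ultimately show ?thesis by (rule continuous_on_eq)
qed

text \<open>The integral over \<open>{0..s}\<close> appears as s times an integral over
  \<open>{0..1}\<close>, the form to which \<open>ae_measurable_integral\<close> applies.\<close>

primrec picard :: "(real \<Rightarrow> real) \<Rightarrow> real \<Rightarrow> (real \<Rightarrow> real) \<Rightarrow> nat \<Rightarrow> real \<Rightarrow> real" where
  "picard b \<theta> B 0 s = 0"
| "picard b \<theta> B (Suc k) s = \<theta> * (s * (LBINT v:{0..1}. b (picard b \<theta> B k (s * v)))) + B s"

lemma continuous_on_picard:
  assumes b: "continuous_on UNIV b" and B: "continuous_on {0..T} B"
  shows "continuous_on {0..T} (picard b \<theta> B k)"
proof (induction k)
  case 0
  then show ?case by simp
next
  case (Suc k)
  have "continuous_on {0..T} (\<lambda>s. b (picard b \<theta> B k s))"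
    by (rule continuous_on_compose2[OF b Suc]) simp
  then have "continuous_on {0..T} (\<lambda>s. \<theta> * (LBINT u:{0..s}. b (picard b \<theta> B k u)) + B s)"
    by (intro continuous_intros continuous_on_primitive B)
  moreover have "\<theta> * (LBINT u:{0..s}. b (picard b \<theta> B k u)) + B s = picard b \<theta> B (Suc k) s" if "s \<in> {0..T}" for s
    using scaled_integral_eq[of s "\<lambda>u. b (picard b \<theta> B k u)"] that by simp
  ultimately show ?case by (rule continuous_on_eq)
qed

text \<open>The Lipschitz bound integrates s^k to s^(k+1) / (k+1), so the error is at most
  \<open>C\<close> times the k-th term of the exponential series. This gives convergence on all of
  \<open>{0..T}\<close> without a smallness condition; \<open>C\<close> is the initial error, as the
  iteration starts at 0.\<close>

lemma picard_error:
  assumes L: "\<And>x y. \<bar>b x - b y\<bar> \<le> L * \<bar>x - y\<bar>" and b: "continuous_on UNIV b"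
    and B: "continuous_on {0..T} B" and x: "continuous_on {0..T} x"
    and eq: "\<And>t. t \<in> {0..T} \<Longrightarrow> x t = \<theta> * (LBINT s:{0..t}. b (x s)) + B t"
    and C: "\<And>s. s \<in> {0..T} \<Longrightarrow> \<bar>x s\<bar> \<le> C" and s: "s \<in> {0..T}"
  shows "\<bar>picard b \<theta> B k s - x s\<bar> \<le> C * (\<bar>\<theta>\<bar> * L * s) ^ k / fact k"
  using s
proof (induction k arbitrary: s)
  case 0
  then show ?case using C by simp
next
  case (Suc k)
  have L0: "0 \<le> L" using L[of 1 0] abs_ge_zero[of "b 1 - b 0"] by simp
  have sub: "{0..s} \<subseteq> {0..T}" using Suc.prems by auto
  have p: "set_integrable lborel {0..s} (\<lambda>u. b (picard b \<theta> B k u))"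
    by (intro continuous_set_integrable continuous_on_compose2[OF b continuous_on_subset[OF continuous_on_picard[OF b B] sub]]) simp
  have bx: "set_integrable lborel {0..s} (\<lambda>u. b (x u))"
    by (intro continuous_set_integrable continuous_on_compose2[OF b continuous_on_subset[OF x sub]]) simp
  have pw: "set_integrable lborel {0..s} (\<lambda>u. u ^ k)"
    by (intro continuous_set_integrable continuous_intros)
  have "\<bar>(LBINT u:{0..s}. b (picard b \<theta> B k u) - b (x u))\<bar> \<le> (LBINT u:{0..s}. \<bar>b (picard b \<theta> B k u) - b (x u)\<bar>)"
    by (rule set_integral_abs_bound)
  also have "\<dots> \<le> (LBINT u:{0..s}. L * (C * (\<bar>\<theta>\<bar> * L) ^ k / fact k) * u ^ k)"
  proof (rule set_integral_mono)
    fix u assume "u \<in> {0..s}"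
    then have "\<bar>picard b \<theta> B k u - x u\<bar> \<le> C * (\<bar>\<theta>\<bar> * L * u) ^ k / fact k" using Suc sub by auto
    then have "L * \<bar>picard b \<theta> B k u - x u\<bar> \<le> L * (C * (\<bar>\<theta>\<bar> * L * u) ^ k / fact k)" using L0 by (rule mult_left_mono)
    also have "\<dots> = L * (C * (\<bar>\<theta>\<bar> * L) ^ k / fact k) * u ^ k" by (simp add: power_mult_distrib)
    finally show "\<bar>b (picard b \<theta> B k u) - b (x u)\<bar> \<le> L * (C * (\<bar>\<theta>\<bar> * L) ^ k / fact k) * u ^ k"
      using L[of "picard b \<theta> B k u" "x u"] by linarith
  qed (use p bx pw in \<open>auto intro!: set_integrable_abs set_integral_diff(1)\<close>)
  also have "\<dots> = L * (C * (\<bar>\<theta>\<bar> * L) ^ k / fact k) * (LBINT u:{0..s}. u ^ k)" by simp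
  also have "(LBINT u:{0..s}. u ^ k) = s ^ Suc k / real (Suc k)"
    using integral_power[of 0 s k] Suc.prems by (simp add: set_lebesgue_integral_def mult.commute)
  finally have *: "\<bar>LBINT u:{0..s}. b (picard b \<theta> B k u) - b (x u)\<bar> \<le> L * (C * (\<bar>\<theta>\<bar> * L) ^ k / fact k) * (s ^ Suc k / real (Suc k))" .
  have "picard b \<theta> B (Suc k) s - x s = \<theta> * (LBINT u:{0..s}. b (picard b \<theta> B k u) - b (x u))"
    using scaled_integral_eq[of s "\<lambda>u. b (picard b \<theta> B k u)"] eq[OF Suc.prems] Suc.prems
    by (simp add: set_integral_diff(2)[OF p bx] right_diff_distrib)
  then have "\<bar>picard b \<theta> B (Suc k) s - x s\<bar> = \<bar>\<theta>\<bar> * \<bar>LBINT u:{0..s}. b (picard b \<theta> B k u) - b (x u)\<bar>"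
    by (simp only: abs_mult)
  also have "\<dots> \<le> \<bar>\<theta>\<bar> * (L * (C * (\<bar>\<theta>\<bar> * L) ^ k / fact k) * (s ^ Suc k / real (Suc k)))"
    by (rule mult_left_mono[OF *]) simp
  also have "\<dots> = C * (\<bar>\<theta>\<bar> * L * s) ^ Suc k / fact (Suc k)"
    by (simp add: power_mult_distrib field_simps)
  finally show ?case .
qed

lemma (in wiener_space) solution_ae_measurable:
  assumes L: "\<And>x y. \<bar>b x - b y\<bar> \<le> L * \<bar>x - y\<bar>" and b: "continuous_on UNIV b"
    and B: "\<And>s. s \<in> {0..T} \<Longrightarrow> ae_measurable M (F s) (B s)"
    and paths: "AE \<omega> in M. continuous_on {0..T} (\<lambda>s. B s \<omega>) \<and> continuous_on {0..T} (\<lambda>s. X s \<omega>) \<and>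
        (\<forall>t\<in>{0..T}. X t \<omega> = \<theta> * (LBINT s:{0..t}. b (X s \<omega>)) + B t \<omega>)"
    and s: "s \<in> {0..T}"
  shows "ae_measurable M (F s) (X s)"
proof (rule ae_measurable_lim)
  have [measurable]: "b \<in> borel_measurable borel" using b by (rule borel_measurable_continuous_onI)
  define P where "P k s \<omega> = picard b \<theta> (\<lambda>s. B s \<omega>) k s" for k s \<omega>
  \<comment> \<open>The induction is general in \<open>s\<close>, because the next iterate at time
    \<open>s\<close> uses the previous one at all times s v \<le> s.\<close>
  have "ae_measurable M (F s) (P k s)" if "s \<in> {0..T}" for k s
    using that
  proof (induction k arbitrary: s)
    case 0
    then show ?case by (auto simp: P_def[abs_def] intro: ae_measurableI)
  next
    case (Suc k)
    have "ae_measurable M (F s) (\<lambda>\<omega>. LBINT v:{0..1}. 1 * b (P k (s * v) \<omega>))"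
    proof (rule ae_measurable_integral)
      show "set_integrable lborel {0..1} (\<lambda>_ :: real. 1 :: real)" by (rule bounded_set_integrable[where M = 1]) auto
      fix v :: real assume v: "v \<in> {0..1}"
      then have sv: "s * v \<le> s * 1" using Suc.prems by (intro mult_left_mono) auto
      then have "s * v \<in> {0..T}" using v Suc.prems by auto
      then have "ae_measurable M (F (s * v)) (\<lambda>\<omega>. b (P k (s * v) \<omega>))"
        by (rule ae_measurable_compose[OF Suc.IH]) simp
      then show "ae_measurable M (F s) (\<lambda>\<omega>. b (P k (s * v) \<omega>))"
        by (rule ae_measurable_mono) (rule natural_filtration_mono, assumption, use sv in simp)
    next
      show "AE \<omega> in M. continuous_on {0..1} (\<lambda>v. b (P k (s * v) \<omega>))"
        using paths
      proof eventually_elim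
        case (elim \<omega>)
        then have "continuous_on {0..T} (\<lambda>s. B s \<omega>)" by simp
        from continuous_on_picard[OF b this, of \<theta> k]
        have "continuous_on {0..T} (\<lambda>s. b (P k s \<omega>))"
          unfolding P_def by (rule continuous_on_compose2[OF b]) simp
        then show ?case using Suc.prems by (rule continuous_on_scale)
      qed
    qed simp
    then have "ae_measurable M (F s) (\<lambda>\<omega>. \<theta> * (s * (LBINT v:{0..1}. b (P k (s * v) \<omega>))) + B s \<omega>)"
      by (intro ae_measurable_add ae_measurable_cmult B Suc.prems) simp
    then show ?case by (simp add: P_def[abs_def])
  qed
  then show "ae_measurable M (F s) (P k s)" for k using s by blast
  show "AE \<omega> in M. (\<lambda>k. P k s \<omega>) \<longlonglongrightarrow> X s \<omega>"
    using paths
  proof eventually_elim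
    case (elim \<omega>)
    then have cB: "continuous_on {0..T} (\<lambda>s. B s \<omega>)" and cX: "continuous_on {0..T} (\<lambda>s. X s \<omega>)"
      and eq: "\<And>t. t \<in> {0..T} \<Longrightarrow> X t \<omega> = \<theta> * (LBINT s:{0..t}. b (X s \<omega>)) + B t \<omega>" by auto
    have "bounded ((\<lambda>s. X s \<omega>) ` {0..T})"
      using cX by (intro compact_imp_bounded compact_continuous_image) auto
    then obtain C where C: "\<And>s. s \<in> {0..T} \<Longrightarrow> \<bar>X s \<omega>\<bar> \<le> C"
      unfolding bounded_iff by (metis image_eqI real_norm_def)
    have "(\<lambda>k. P k s \<omega> - X s \<omega>) \<longlonglongrightarrow> 0"
    proof (rule Lim_null_comparison)
      show "\<forall>\<^sub>F k in sequentially. norm (P k s \<omega> - X s \<omega>) \<le> C * ((\<bar>\<theta>\<bar> * L * s) ^ k / fact k)"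
        using picard_error[OF L b cB cX eq C s] by (simp add: P_def)
      have "(\<lambda>k. C * ((\<bar>\<theta>\<bar> * L * s) ^ k / fact k)) \<longlonglongrightarrow> C * 0"
        using summable_LIMSEQ_zero[OF summable_exp[of "\<bar>\<theta>\<bar> * L * s"]]
        by (intro tendsto_intros) (simp add: divide_inverse mult.commute)
      then show "(\<lambda>k. C * ((\<bar>\<theta>\<bar> * L * s) ^ k / fact k)) \<longlonglongrightarrow> 0" by simp
    qed
    then show ?case by (rule LIM_zero_cancel)
  qed
qed

section \<open>Sobolev energy of fractional Brownian paths\<close>

text \<open>The Tonelli argument for the energy integrates over times and sample points together.
  Continuity gives the joint measurability it needs, by sampling at the grid point below
  \<open>s\<close>.\<close>

lemma continuous_process_jointly_measurable:
  fixes Y :: "real \<Rightarrow> 'a \<Rightarrow> real"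
  assumes Y: "\<And>s. Y s \<in> borel_measurable M"
    and cont: "\<And>\<omega>. \<omega> \<in> space M \<Longrightarrow> continuous_on UNIV (\<lambda>s. Y s \<omega>)"
  shows "case_prod Y \<in> borel_measurable (borel \<Otimes>\<^sub>M M)"
proof (rule borel_measurable_LIMSEQ_real)
  define u where "u n x = Y (real_of_int \<lfloor>real (Suc n) * fst x\<rfloor> / real (Suc n)) (snd x)" for n :: nat and x :: "real \<times> 'a"
  show "(\<lambda>n. u n x) \<longlonglongrightarrow> case_prod Y x" if "x \<in> space (borel \<Otimes>\<^sub>M M)" for x
  proof -
    have "continuous_on UNIV (\<lambda>s. Y s (snd x))" using that by (intro cont) (auto simp: space_pair_measure)
    then have "(\<lambda>n. u n x) \<longlonglongrightarrow> Y (fst x) (snd x)"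
      unfolding u_def by (rule continuous_on_tendsto_compose[OF _ floor_fraction_tendsto]) auto
    then show ?thesis by (simp add: case_prod_beta)
  qed
  show "u n \<in> borel_measurable (borel \<Otimes>\<^sub>M M)" for n
    unfolding u_def
  proof (rule measurable_compose_countable[of "\<lambda>i x. Y (real_of_int i / real (Suc n)) (snd x)" _ _ "\<lambda>x. \<lfloor>real (Suc n) * fst x\<rfloor>"])
    show "(\<lambda>x. Y (real_of_int i / real (Suc n)) (snd x)) \<in> borel_measurable (borel \<Otimes>\<^sub>M M)" for i
      using Y by measurable
  qed measurable
qed

lemma fbm_measurable:
  assumes "fractional_brownian_motion M H B" "0 \<le> t"
  shows "B t \<in> borel_measurable M"
proof -
  have "\<forall>J c. finite J \<and> J \<subseteq> {0..} \<longrightarrow> gaussian_variable M (\<lambda>\<omega>. \<Sum>t\<in>J. c t * B t \<omega>)"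
    using assms(1) by (simp add: fractional_brownian_motion_def gaussian_process_def)
  from this[rule_format, of "{t}" "\<lambda>_. 1"] show ?thesis
    using assms(2) by (simp add: gaussian_variable_def)
qed

lemma fbm_increment:
  assumes "prob_space M" "fractional_brownian_motion M H B" "0 < s" "0 < u"
  shows "integrable M (\<lambda>\<omega>. (B s \<omega> - B u \<omega>)\<^sup>2)"
    and "integral\<^sup>L M (\<lambda>\<omega>. (B s \<omega> - B u \<omega>)\<^sup>2) = \<bar>s - u\<bar> powr (2 * H)"
proof -
  have cov: "integral\<^sup>L M (\<lambda>\<omega>. B t \<omega> * B s \<omega>) = 1 / 2 * (t powr (2 * H) + s powr (2 * H) - \<bar>t - s\<bar> powr (2 * H))"
    if "0 \<le> s" "0 \<le> t" for s t using assms(2) that by (simp add: fractional_brownian_motion_def)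
  note meas = fbm_measurable[OF assms(2)]
  have [measurable]: "B s \<in> borel_measurable M" "B u \<in> borel_measurable M"
    using assms(3,4) by (simp_all add: meas)
  have B2: "integrable M (\<lambda>\<omega>. (B t \<omega>)\<^sup>2)" "integral\<^sup>L M (\<lambda>\<omega>. (B t \<omega>)\<^sup>2) = t powr (2 * H)" if "0 < t" for t
  proof -
    show v: "integral\<^sup>L M (\<lambda>\<omega>. (B t \<omega>)\<^sup>2) = t powr (2 * H)"
      using cov[of t t] that by (simp add: power2_eq_square)
    \<comment> \<open>The definition of the process gives only the value of the integral. Since a
      nonintegrable function has integral 0 by convention, the nonzero value
      \<open>t powr (2 * H)\<close> forces integrability; this is why the times are taken
      positive.\<close>
    show "integrable M (\<lambda>\<omega>. (B t \<omega>)\<^sup>2)"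
      using v that not_integrable_integral_eq[of M "\<lambda>\<omega>. (B t \<omega>)\<^sup>2"] by (metis powr_eq_0_iff less_irrefl)
  qed
  have Bsu: "integrable M (\<lambda>\<omega>. B s \<omega> * B u \<omega>)"
  proof (rule Bochner_Integration.integrable_bound)
    show "integrable M (\<lambda>\<omega>. (B s \<omega>)\<^sup>2 + (B u \<omega>)\<^sup>2)" using B2 assms by simp
    show "AE \<omega> in M. norm (B s \<omega> * B u \<omega>) \<le> norm ((B s \<omega>)\<^sup>2 + (B u \<omega>)\<^sup>2)"
      using abs_mult_le_squares by (auto intro!: AE_I2)
  qed (use assms in measurable)
  have sq: "(B s \<omega> - B u \<omega>)\<^sup>2 = (B s \<omega>)\<^sup>2 - 2 * (B s \<omega> * B u \<omega>) + (B u \<omega>)\<^sup>2" for \<omega>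
    by (simp add: power2_eq_square algebra_simps)
  show "integrable M (\<lambda>\<omega>. (B s \<omega> - B u \<omega>)\<^sup>2)" unfolding sq using B2 Bsu assms by simp
  show "integral\<^sup>L M (\<lambda>\<omega>. (B s \<omega> - B u \<omega>)\<^sup>2) = \<bar>s - u\<bar> powr (2 * H)"
    unfolding sq using B2[OF assms(3)] B2[OF assms(4)] Bsu cov[of u s] assms by simp
qed

text \<open>The exponent - 2 * \<alpha> - 3/2 splits the squared Marchaud weight for the
  Cauchy-Schwarz inequality: the complementary factor v powr (- \<alpha>) * (1 - v) powr (- 1/2) is
  integrable, and multiplying by the second moment (s * (1 - v)) powr (2 * \<alpha> + 1) of a
  fractional Brownian increment again leaves (1 - v) powr (- 1/2).\<close>

definition sobolev_kernel :: "real \<Rightarrow> real \<Rightarrow> real \<Rightarrow> real" where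
  "sobolev_kernel \<alpha> s v = s powr (- 2 * \<alpha>) * (v powr (- \<alpha>) * (1 - v) powr (- 2 * \<alpha> - 3 / 2))"

lemma borel_measurable_sobolev_kernel [measurable]: "case_prod (sobolev_kernel \<alpha>) \<in> borel_measurable (borel \<Otimes>\<^sub>M borel)"
  unfolding sobolev_kernel_def by measurable

lemma sobolev_kernel_nonneg [simp]: "0 \<le> sobolev_kernel \<alpha> s v"
  by (simp add: sobolev_kernel_def)

text \<open>Finiteness for \<open>\<alpha> = H - 1 / 2\<close> needs no path regularity beyond the second moments of the increments,
  so that Kolmogorov's continuity theorem is not needed.\<close>

definition sobolev_energy :: "real \<Rightarrow> real \<Rightarrow> (real \<Rightarrow> real) \<Rightarrow> ennreal" where
  "sobolev_energy \<alpha> T g = (\<integral>\<^sup>+s. \<integral>\<^sup>+v. ennreal (indicator {0..T} s * (indicator {0..1} v *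
      (sobolev_kernel \<alpha> s v * (g s - g (s * v))\<^sup>2))) \<partial>lborel \<partial>lborel)"

lemma product_nn_integral_finite:
  fixes T c :: real
  assumes p: "set_integrable lborel {0..1} p" "\<And>v. 0 \<le> p v" and "0 \<le> c"
  shows "(\<integral>\<^sup>+s. \<integral>\<^sup>+v. ennreal (indicator {0..T} s * (indicator {0..1} v * (c * p v))) \<partial>lborel \<partial>lborel) < \<infinity>"
proof -
  have i: "integrable lborel (\<lambda>v. indicator {0..1} v * (c * p v))"
    using set_integrable_mult_right[OF p(1), of c] by (simp add: set_integrable_def)
  define K where "K = (\<integral>v. indicator {0..1} v * (c * p v) \<partial>lborel)"
  have inner: "(\<integral>\<^sup>+v. ennreal (indicator {0..T} s * (indicator {0..1} v * (c * p v))) \<partial>lborel) = ennreal K * indicator {0..T} s" for s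
  proof -
    have "(\<integral>\<^sup>+v. ennreal (indicator {0..T} s * (indicator {0..1} v * (c * p v))) \<partial>lborel)
       = ennreal (\<integral>v. indicator {0..T} s * (indicator {0..1} v * (c * p v)) \<partial>lborel)"
      using i p assms(3) by (intro nn_integral_eq_integral) (auto intro!: AE_I2)
    then show ?thesis by (auto simp: K_def indicator_def)
  qed
  have "(\<integral>\<^sup>+s. \<integral>\<^sup>+v. ennreal (indicator {0..T} s * (indicator {0..1} v * (c * p v))) \<partial>lborel \<partial>lborel)
      = ennreal K * emeasure lborel {0..T}"
    unfolding inner by (rule nn_integral_cmult_indicator) simp
  also have "\<dots> < \<infinity>" by (cases "0 \<le> T") (simp_all add: ennreal_mult_less_top)
  finally show ?thesis .
qed

text \<open>By Tonelli the expected energy is the integral of the kernel against the second moments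
  of the increments. It is finite, so the energy is finite almost surely.\<close>

lemma fbm_sobolev_energy_finite:
  assumes ps: "prob_space M" and B: "fractional_brownian_motion M H B"
    and H: "H = \<alpha> + 1 / 2" and \<alpha>: "0 < \<alpha>" "\<alpha> < 1 / 2"
  shows "AE \<omega> in M. sobolev_energy \<alpha> T (\<lambda>s. B s \<omega>) < \<infinity>"
proof -
  interpret prob_space M by (rule ps)
  interpret pair: pair_sigma_finite M lborel ..
  note meas = fbm_measurable[OF B]
  have "AE \<omega> in M. continuous_on {0..} (\<lambda>t. B t \<omega>)" using B by (simp add: fractional_brownian_motion_def)
  then obtain N where N: "N \<in> null_sets M" and cont: "{\<omega> \<in> space M. \<not> continuous_on {0..} (\<lambda>t. B t \<omega>)} \<subseteq> N"
    by (auto elim!: AE_E simp: null_sets_def)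
  \<comment> \<open>Joint measurability is obtained from a modification whose paths are all
    continuous on the whole line: constant before time 0, and 0 on a null set containing the
    exceptional paths.\<close>
  define B' where "B' s \<omega> = (if \<omega> \<in> N then 0 else B (max 0 s) \<omega>)" for s \<omega>
  have N_sets: "N \<in> sets M" using N by auto
  have B'_eq: "AE \<omega> in M. \<forall>s\<ge>0. B' s \<omega> = B s \<omega>"
    using AE_not_in[OF N] by eventually_elim (simp add: B'_def max_def)
  have B'_meas: "B' s \<in> borel_measurable M" for s
    unfolding B'_def using N_sets meas[of "max 0 s"] by (intro measurable_If) auto
  have [measurable]: "case_prod B' \<in> borel_measurable (borel \<Otimes>\<^sub>M M)"
  proof (rule continuous_process_jointly_measurable[OF B'_meas])
    fix \<omega> assume w: "\<omega> \<in> space M"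
    show "continuous_on UNIV (\<lambda>s. B' s \<omega>)"
    proof (cases "\<omega> \<in> N")
      case False
      then have "continuous_on {0..} (\<lambda>t. B t \<omega>)" using cont w by auto
      then have "continuous_on UNIV (\<lambda>s. B (max 0 s) \<omega>)"
        by (rule continuous_on_compose2) (auto intro!: continuous_intros)
      then show ?thesis using False by (simp add: B'_def)
    qed (simp add: B'_def)
  qed
  define f where "f \<omega> s v = ennreal (indicator {0..T} s * (indicator {0..1} v *
      (sobolev_kernel \<alpha> s v * (B' s \<omega> - B' (s * v) \<omega>)\<^sup>2)))" for \<omega> s v
  \<comment> \<open>After taking expectations the integrand is s * p v; the exponents are written as
    Beta parameters 1 - \<alpha> and 1/2, both positive.\<close>
  define p where "p v = v powr (1 - \<alpha> - 1) * (1 - v) powr (1 / 2 - 1)" for v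
  have p: "set_integrable lborel {0..1} p" unfolding p_def by (rule Beta_integral) (use \<alpha> in auto)
  have p0: "0 \<le> p v" for v by (simp add: p_def)
  have inner: "(\<integral>\<^sup>+\<omega>. f \<omega> s v \<partial>M) \<le> ennreal (indicator {0..T} s * (indicator {0..1} v * (T * p v)))"
    if nz: "s \<noteq> 0" "v \<noteq> 0" for s v
  proof (cases "s \<in> {0..T} \<and> v \<in> {0..1}")
    case True
    then have s: "0 < s" "s \<le> T" and v: "0 < v" "v \<le> 1" and sv: "0 < s * v" using nz by auto
    note inc = fbm_increment[OF ps B s(1) sv]
    have eq: "AE \<omega> in M. f \<omega> s v = ennreal (sobolev_kernel \<alpha> s v * (B s \<omega> - B (s * v) \<omega>)\<^sup>2)"
      using B'_eq by eventually_elim (use True s sv in \<open>simp add: f_def\<close>)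
    have "(\<integral>\<^sup>+\<omega>. f \<omega> s v \<partial>M) = (\<integral>\<^sup>+\<omega>. ennreal (sobolev_kernel \<alpha> s v * (B s \<omega> - B (s * v) \<omega>)\<^sup>2) \<partial>M)"
      by (rule nn_integral_cong_AE[OF eq])
    also have "\<dots> = ennreal (\<integral>\<omega>. sobolev_kernel \<alpha> s v * (B s \<omega> - B (s * v) \<omega>)\<^sup>2 \<partial>M)"
      using inc(1) by (intro nn_integral_eq_integral) auto
    also have "(\<integral>\<omega>. sobolev_kernel \<alpha> s v * (B s \<omega> - B (s * v) \<omega>)\<^sup>2 \<partial>M) = sobolev_kernel \<alpha> s v * \<bar>s - s * v\<bar> powr (2 * H)"
      using inc(2) by simp
    also have "\<bar>s - s * v\<bar> = s * (1 - v)" using s v by (simp add: algebra_simps)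
    also have "sobolev_kernel \<alpha> s v * (s * (1 - v)) powr (2 * H) = s * p v"
    proof -
      have "(s * (1 - v)) powr (2 * H) = s powr (2 * \<alpha> + 1) * (1 - v) powr (2 * \<alpha> + 1)"
      proof -
        have "2 * H = 2 * \<alpha> + 1" using H by simp
        then show ?thesis using s v by (simp only: powr_mult)
      qed
      then have "sobolev_kernel \<alpha> s v * (s * (1 - v)) powr (2 * H)
         = (s powr (- 2 * \<alpha>) * s powr (2 * \<alpha> + 1)) * (v powr (- \<alpha>) * ((1 - v) powr (- 2 * \<alpha> - 3 / 2) * (1 - v) powr (2 * \<alpha> + 1)))"
        by (simp add: sobolev_kernel_def)
      also have "s powr (- 2 * \<alpha>) * s powr (2 * \<alpha> + 1) = s" using s by (simp add: powr_add[symmetric])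
      also have "(1 - v) powr (- 2 * \<alpha> - 3 / 2) * (1 - v) powr (2 * \<alpha> + 1) = (1 - v) powr (1 / 2 - 1)"
        by (simp add: powr_add[symmetric])
      finally show ?thesis by (simp add: p_def)
    qed
    also have "ennreal (s * p v) \<le> ennreal (T * p v)" using s p0 by (intro ennreal_leI mult_right_mono) auto
    finally show ?thesis using True by simp
  next
    case False
    then have "f \<omega> s v = 0" for \<omega> by (auto simp: f_def)
    then show ?thesis by simp
  qed
  have nz: "AE x in lborel. x \<noteq> (0 :: real)" by (rule AE_lborel_singleton)
  have "(\<integral>\<^sup>+\<omega>. (\<integral>\<^sup>+s. \<integral>\<^sup>+v. f \<omega> s v \<partial>lborel \<partial>lborel) \<partial>M) = (\<integral>\<^sup>+s. (\<integral>\<^sup>+\<omega>. (\<integral>\<^sup>+v. f \<omega> s v \<partial>lborel) \<partial>M) \<partial>lborel)"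
    using pair.Fubini[of "\<lambda>(\<omega>, s). \<integral>\<^sup>+v. f \<omega> s v \<partial>lborel"] unfolding f_def by simp
  also have "\<dots> = (\<integral>\<^sup>+s. (\<integral>\<^sup>+v. (\<integral>\<^sup>+\<omega>. f \<omega> s v \<partial>M) \<partial>lborel) \<partial>lborel)"
  proof (rule nn_integral_cong)
    fix s :: real
    show "(\<integral>\<^sup>+\<omega>. (\<integral>\<^sup>+v. f \<omega> s v \<partial>lborel) \<partial>M) = (\<integral>\<^sup>+v. (\<integral>\<^sup>+\<omega>. f \<omega> s v \<partial>M) \<partial>lborel)"
      using pair.Fubini[of "\<lambda>(\<omega>, v). f \<omega> s v"] unfolding f_def by simp
  qed
  also have "\<dots> \<le> (\<integral>\<^sup>+s. (\<integral>\<^sup>+v. ennreal (indicator {0..T} s * (indicator {0..1} v * (T * p v))) \<partial>lborel) \<partial>lborel)"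
  proof (rule nn_integral_mono_AE)
    show "AE s in lborel. (\<integral>\<^sup>+v. (\<integral>\<^sup>+\<omega>. f \<omega> s v \<partial>M) \<partial>lborel)
        \<le> (\<integral>\<^sup>+v. ennreal (indicator {0..T} s * (indicator {0..1} v * (T * p v))) \<partial>lborel)"
      using nz
    proof eventually_elim
      case (elim s)
      show ?case
        by (rule nn_integral_mono_AE) (use nz in eventually_elim, use inner elim in blast)
    qed
  qed
  also have "\<dots> < \<infinity>"
  proof (cases "0 \<le> T")
    case True
    then show ?thesis by (intro product_nn_integral_finite p p0)
  qed simp
  finally have fin: "(\<integral>\<^sup>+\<omega>. (\<integral>\<^sup>+s. \<integral>\<^sup>+v. f \<omega> s v \<partial>lborel \<partial>lborel) \<partial>M) \<noteq> \<infinity>" by simp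
  have "AE \<omega> in M. (\<integral>\<^sup>+s. \<integral>\<^sup>+v. f \<omega> s v \<partial>lborel \<partial>lborel) \<noteq> \<infinity>"
    by (rule nn_integral_PInf_AE[OF _ fin]) (unfold f_def, measurable)
  then show ?thesis
    using B'_eq
  proof eventually_elim
    case (elim \<omega>)
    have "f \<omega> s v = ennreal (indicator {0..T} s * (indicator {0..1} v * (sobolev_kernel \<alpha> s v * (B s \<omega> - B (s * v) \<omega>)\<^sup>2)))" for s v
      using elim(2) by (auto simp: f_def indicator_def)
    then show ?case using elim(1) by (simp add: sobolev_energy_def less_top)
  qed
qed

section \<open>From Sobolev energy to Marchaud integrability\<close>

lemma set_integral_Cauchy_Schwarz:
  fixes f A q :: "real \<Rightarrow> real"
  assumes A: "set_integrable lborel S A" "\<And>v. v \<in> S \<Longrightarrow> 0 \<le> A v"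
    and q: "set_integrable lborel S q" "\<And>v. v \<in> S \<Longrightarrow> 0 \<le> q v"
    and f: "set_integrable lborel S f"
    and fAq: "\<And>v. v \<in> S \<Longrightarrow> (f v)\<^sup>2 = A v * q v"
  shows "(LBINT v:S. \<bar>f v\<bar>)\<^sup>2 \<le> (LBINT v:S. A v) * (LBINT v:S. q v)"
proof -
  define a where "a = (LBINT v:S. A v)"
  define j where "j = (LBINT v:S. q v)"
  define C where "C = (LBINT v:S. \<bar>f v\<bar>)"
  have nn: "0 \<le> a" "0 \<le> j" "0 \<le> C"
    using A(2) q(2) unfolding a_def j_def C_def set_lebesgue_integral_def
    by (auto intro!: integral_nonneg_AE AE_I2 simp: indicator_def)
  \<comment> \<open>Pointwise \<bar>f\<bar> is the geometric mean of r A and q / r, hence at most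
    half their sum. The bound is optimised below at r = C / a.\<close>
  have le: "2 * C \<le> r * a + j / r" if r: "r > 0" for r
  proof -
    have "(LBINT v:S. 2 * \<bar>f v\<bar>) \<le> (LBINT v:S. r * A v + q v / r)"
    proof (rule set_integral_mono)
      show "set_integrable lborel S (\<lambda>v. 2 * \<bar>f v\<bar>)" using f by (intro set_integrable_mult_right set_integrable_abs)
      show "set_integrable lborel S (\<lambda>v. r * A v + q v / r)"
        using A(1) q(1) by (intro set_integral_add(1) set_integrable_mult_right set_integrable_divide)
      fix v assume v: "v \<in> S"
      have "(2 * \<bar>f v\<bar>)\<^sup>2 = 4 * ((r * A v) * (q v / r))" using fAq[OF v] r by (simp add: power_mult_distrib)
      also have "\<dots> \<le> (r * A v + q v / r)\<^sup>2"
        using sum_squares_bound[of "r * A v" "q v / r"] r by (simp add: power2_sum)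
      finally have "(2 * \<bar>f v\<bar>)\<^sup>2 \<le> (r * A v + q v / r)\<^sup>2" .
      moreover have "0 \<le> r * A v + q v / r"
        using A(2)[OF v] q(2)[OF v] r by (intro add_nonneg_nonneg mult_nonneg_nonneg divide_nonneg_nonneg) simp_all
      ultimately show "2 * \<bar>f v\<bar> \<le> r * A v + q v / r" by (rule power2_le_imp_le)
    qed
    then show ?thesis using A(1) q(1) by (simp add: C_def a_def j_def set_integral_add)
  qed
  show ?thesis
  proof (cases "C = 0")
    case True
    then show ?thesis using nn by (simp add: C_def a_def j_def)
  next
    case False
    then have C: "C > 0" using nn by simp
    \<comment> \<open>If a = 0, then letting r be large contradicts C > 0; the choice r = (j + 1) /
      C is large enough.\<close>
    have "a > 0"
    proof (rule ccontr)
      assume "\<not> a > 0"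
      then have "a = 0" using nn by simp
      then have "2 * C \<le> j / ((j + 1) / C)" using le[of "(j + 1) / C"] C nn by simp
      then have "2 * C * (j + 1) \<le> j * C" using nn C by (simp add: field_simps)
      then have "C * (j + 2) \<le> 0" by (simp add: algebra_simps)
      then show False using C nn by (simp add: mult_le_0_iff)
    qed
    then have "2 * C \<le> C + j * a / C" using le[of "C / a"] C by simp
    then have "C \<le> j * a / C" by simp
    then have "C * C \<le> a * j" using C by (simp add: field_simps)
    then show ?thesis by (simp add: C_def a_def j_def power2_eq_square)
  qed
qed

text \<open>The square of the Marchaud integrand factors as A v * q s v with \<open>A\<close>
  integrable. Then \<bar>F\<bar> \<le> A + q gives integrability for almost every \<open>s\<close>,
  and Cauchy-Schwarz bounds D^2 by a constant times the inner energy integral, which is integrable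
  against s powr (- 2 * \<alpha>).\<close>

lemma sobolev_imp_marchaud_integrable:
  fixes g :: "real \<Rightarrow> real"
  assumes \<alpha>: "0 < \<alpha>" "\<alpha> < 1 / 2" and [measurable]: "g \<in> borel_measurable borel"
    and fin: "sobolev_energy \<alpha> T g < \<infinity>"
  shows "AE s in lborel. s \<in> {0..T} \<longrightarrow>
        set_integrable lborel {0..1} (\<lambda>v. marchaud_weight \<alpha> v * (g s - g (s * v)))"
    and "set_integrable lborel {0..T}
        (\<lambda>s. (s powr (- \<alpha>) * (LBINT v:{0..1}. \<bar>marchaud_weight \<alpha> v * (g s - g (s * v))\<bar>))\<^sup>2)"
proof -
  define A where "A v = v powr (- \<alpha>) * (1 - v) powr (- 1 / 2)" for v
  define q where "q s v = v powr (- \<alpha>) * (1 - v) powr (- 2 * \<alpha> - 3 / 2) * (g s - g (s * v))\<^sup>2" for s v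
  define F where "F s v = marchaud_weight \<alpha> v * (g s - g (s * v))" for s v
  have [measurable]: "case_prod q \<in> borel_measurable (borel \<Otimes>\<^sub>M borel)" "case_prod F \<in> borel_measurable (borel \<Otimes>\<^sub>M borel)"
    unfolding q_def F_def by measurable
  have q0: "0 \<le> q s v" for s v by (simp add: q_def)
  have A0: "0 \<le> A v" for v by (simp add: A_def)
  have A: "set_integrable lborel {0..1} A"
    using Beta_integral(1)[of "1 - \<alpha>" "1 / 2"] \<alpha> by (simp add: A_def[abs_def])
  have FAq: "(F s v)\<^sup>2 = A v * q s v" for s v
  proof -
    have "(v powr (- \<alpha>) * (1 - v) powr (- \<alpha> - 1))\<^sup>2
        = (v powr (- \<alpha>) * v powr (- \<alpha>)) * ((1 - v) powr (- 1 / 2) * (1 - v) powr (- 2 * \<alpha> - 3 / 2))"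
    proof -
      have "- 1 / 2 + (- 2 * \<alpha> - 3 / 2) = (- \<alpha> - 1) + (- \<alpha> - 1)" by simp
      then have "(1 - v) powr (- 1 / 2) * (1 - v) powr (- 2 * \<alpha> - 3 / 2) = (1 - v) powr (- \<alpha> - 1) * (1 - v) powr (- \<alpha> - 1)"
        by (simp only: powr_add[symmetric])
      then show ?thesis by (simp only: power2_eq_square mult_ac)
    qed
    then show ?thesis by (simp add: F_def A_def q_def marchaud_weight_def power_mult_distrib)
  qed
  have Fle: "\<bar>F s v\<bar> \<le> A v + q s v" for s v
  proof (rule power2_le_imp_le)
    have "\<bar>F s v\<bar>\<^sup>2 = A v * q s v" using FAq by simp
    also have "\<dots> \<le> (A v + q s v)\<^sup>2" using A0[of v] q0[of s v] by (simp add: power2_sum)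
    finally show "\<bar>F s v\<bar>\<^sup>2 \<le> (A v + q s v)\<^sup>2" .
  qed (use A0 q0 in simp)
  define e where "e s = (\<integral>\<^sup>+v. ennreal (indicator {0..T} s * (indicator {0..1} v * (s powr (- 2 * \<alpha>) * q s v))) \<partial>lborel)" for s
  have e_fin: "(\<integral>\<^sup>+s. e s \<partial>lborel) < \<infinity>"
    using fin by (simp add: sobolev_energy_def sobolev_kernel_def e_def q_def mult.assoc)
  have [measurable]: "e \<in> borel_measurable borel" unfolding e_def by measurable
  have "AE s in lborel. e s \<noteq> \<infinity>"
    using e_fin by (intro nn_integral_PInf_AE) auto
  \<comment> \<open>The factor s powr (- 2 * \<alpha>) can be divided out only for s \<noteq> 0,
    since \<open>0 powr x = 0\<close>.\<close>
  then have good: "AE s in lborel. s \<in> {0..T} \<longrightarrow> set_integrable lborel {0..1} (q s) \<and> e s = ennreal (s powr (- 2 * \<alpha>) * (LBINT v:{0..1}. q s v))"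
    using AE_lborel_singleton[of 0]
  proof eventually_elim
    case (elim s)
    show ?case
    proof
      assume s: "s \<in> {0..T}"
      then have e: "e s = (\<integral>\<^sup>+v. ennreal (s powr (- 2 * \<alpha>) * (indicator {0..1} v * q s v)) \<partial>lborel)"
        by (simp add: e_def mult.left_commute)
      have i: "integrable lborel (\<lambda>v. s powr (- 2 * \<alpha>) * (indicator {0..1} v * q s v))"
      proof (rule integrableI_bounded)
        have "(\<integral>\<^sup>+v. ennreal (norm (s powr (- 2 * \<alpha>) * (indicator {0..1} v * q s v))) \<partial>lborel) = e s"
          unfolding e by (intro nn_integral_cong arg_cong[where f = ennreal]) (simp add: q0)
        then show "(\<integral>\<^sup>+v. ennreal (norm (s powr (- 2 * \<alpha>) * (indicator {0..1} v * q s v))) \<partial>lborel) < \<infinity>"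
          using elim by (simp add: less_top)
      qed measurable
      then have "integrable lborel (\<lambda>v. indicator {0..1} v * q s v)" using elim by simp
      then have qi: "set_integrable lborel {0..1} (q s)" by (simp add: set_integrable_def)
      have "e s = ennreal (\<integral>v. s powr (- 2 * \<alpha>) * (indicator {0..1} v * q s v) \<partial>lborel)"
        unfolding e by (rule nn_integral_eq_integral[OF i]) (auto simp: q0)
      then show "set_integrable lborel {0..1} (q s) \<and> e s = ennreal (s powr (- 2 * \<alpha>) * (LBINT v:{0..1}. q s v))"
        using qi by (simp add: set_lebesgue_integral_def)
    qed
  qed
  have F_int: "set_integrable lborel {0..1} (F s)" if "set_integrable lborel {0..1} (q s)" for s
    by (rule set_integrable_dominated[OF set_integral_add(1)[OF A that]]) (use Fle in auto)
  show "AE s in lborel. s \<in> {0..T} \<longrightarrow>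
        set_integrable lborel {0..1} (\<lambda>v. marchaud_weight \<alpha> v * (g s - g (s * v)))"
    using good by eventually_elim (use F_int in \<open>auto simp: F_def[abs_def]\<close>)
  define a where "a = (LBINT v:{0..1}. A v)"
  define J where "J s = (LBINT v:{0..1}. q s v)" for s
  define D where "D s = (LBINT v:{0..1}. \<bar>F s v\<bar>)" for s
  have [measurable]: "J \<in> borel_measurable borel" "D \<in> borel_measurable borel"
    unfolding J_def D_def by (rule borel_measurable_set_integral; measurable)+
  have J0: "0 \<le> J s" for s unfolding J_def set_lebesgue_integral_def
    by (intro integral_nonneg_AE) (auto simp: q0)
  have "integrable lborel (\<lambda>s. indicator {0..T} s * (s powr (- 2 * \<alpha>) * J s))"
  proof (rule integrableI_bounded)
    have "(\<integral>\<^sup>+s. ennreal (norm (indicator {0..T} s * (s powr (- 2 * \<alpha>) * J s))) \<partial>lborel) \<le> (\<integral>\<^sup>+s. e s \<partial>lborel)"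
      by (rule nn_integral_mono_AE) (use good in eventually_elim, use J0 in \<open>auto simp: indicator_def J_def[symmetric]\<close>)
    then show "(\<integral>\<^sup>+s. ennreal (norm (indicator {0..T} s * (s powr (- 2 * \<alpha>) * J s))) \<partial>lborel) < \<infinity>"
      using e_fin by (rule order_le_less_trans)
  qed measurable
  then have Ji: "set_integrable lborel {0..T} (\<lambda>s. a * (s powr (- 2 * \<alpha>) * J s))"
    by (intro set_integrable_mult_right) (simp add: set_integrable_def)
  have "set_integrable lborel {0..T} (\<lambda>s. (s powr (- \<alpha>) * D s)\<^sup>2)"
  proof (rule set_integrable_bound[OF Ji])
    show "set_borel_measurable lborel {0..T} (\<lambda>s. (s powr (- \<alpha>) * D s)\<^sup>2)"
      unfolding set_borel_measurable_def by measurable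
    show "AE s in lborel. s \<in> {0..T} \<longrightarrow> norm ((s powr (- \<alpha>) * D s)\<^sup>2) \<le> norm (a * (s powr (- 2 * \<alpha>) * J s))"
      using good
    proof eventually_elim
      case (elim s)
      show ?case
      proof
        assume "s \<in> {0..T}"
        then have qi: "set_integrable lborel {0..1} (q s)" using elim by simp
        have "(D s)\<^sup>2 \<le> a * J s"
          unfolding D_def a_def J_def by (rule set_integral_Cauchy_Schwarz[OF A A0 qi q0 F_int[OF qi] FAq])
        then have "s powr (- 2 * \<alpha>) * (D s)\<^sup>2 \<le> s powr (- 2 * \<alpha>) * (a * J s)" by (rule mult_left_mono) simp
        moreover have "(s powr (- \<alpha>) * D s)\<^sup>2 = s powr (- 2 * \<alpha>) * (D s)\<^sup>2"
          by (simp add: power_mult_distrib power2_eq_square powr_add[symmetric])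
        ultimately show "norm ((s powr (- \<alpha>) * D s)\<^sup>2) \<le> norm (a * (s powr (- 2 * \<alpha>) * J s))"
          by (simp add: mult.left_commute)
      qed
    qed
  qed
  then show "set_integrable lborel {0..T}
        (\<lambda>s. (s powr (- \<alpha>) * (LBINT v:{0..1}. \<bar>marchaud_weight \<alpha> v * (g s - g (s * v))\<bar>))\<^sup>2)"
    unfolding D_def F_def .
qed

lemma sobolev_energy_cong:
  assumes "\<And>s. s \<in> {0..T} \<Longrightarrow> g s = h s"
  shows "sobolev_energy \<alpha> T g = sobolev_energy \<alpha> T h"
proof -
  have eq: "indicator {0..T} s * (indicator {0..1} v * (sobolev_kernel \<alpha> s v * (g s - g (s * v))\<^sup>2))
      = indicator {0..T} s * (indicator {0..1} v * (sobolev_kernel \<alpha> s v * (h s - h (s * v))\<^sup>2))" for s v :: real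
  proof (cases "s \<in> {0..T} \<and> v \<in> {0..1}")
    case True
    then have "s * v \<le> s * 1" by (intro mult_left_mono) auto
    then have "s * v \<in> {0..T}" using True by auto
    then show ?thesis using True assms by simp
  qed auto
  show ?thesis unfolding sobolev_energy_def eq ..
qed

text \<open>An increment of \<open>x\<close> is one of \<open>y\<close> plus a drift part of size at
  most a constant times s - u. At u = s v the square of the drift part contributes s^2 (1 - v)^2,
  which leaves (1 - v) powr (1/2 - 2 * \<alpha>) after multiplication by the kernel; this is
  integrable because \<alpha> < 1/2.\<close>

lemma sobolev_energy_drift_finite:
  fixes g c x y :: "real \<Rightarrow> real"
  assumes \<alpha>: "0 < \<alpha>" "\<alpha> < 1 / 2"
    and c: "continuous_on {0..T} c" "\<And>s. s \<in> {0..T} \<Longrightarrow> \<bar>c s\<bar> \<le> C"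
    and x: "\<And>s. s \<in> {0..T} \<Longrightarrow> x s = \<theta> * (LBINT u:{0..s}. c u) + y s"
    and g: "\<And>s u. s \<in> {0..T} \<Longrightarrow> u \<in> {0..T} \<Longrightarrow> \<bar>g s - g u\<bar> \<le> L * \<bar>x s - x u\<bar>"
    and [measurable]: "y \<in> borel_measurable borel"
    and fin: "sobolev_energy \<alpha> T y < \<infinity>"
  shows "sobolev_energy \<alpha> T g < \<infinity>"
proof (cases "0 \<le> T")
  case False
  then show ?thesis by (simp add: sobolev_energy_def)
next
  case True
  define p where "p v = v powr (1 - \<alpha> - 1) * (1 - v) powr (3 / 2 - 2 * \<alpha> - 1)" for v
  have p: "set_integrable lborel {0..1} p" unfolding p_def by (rule Beta_integral) (use \<alpha> in auto)
  have p0: "0 \<le> p v" for v by (simp add: p_def)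
  have [measurable]: "p \<in> borel_measurable borel" unfolding p_def by measurable
  define K1 where "K1 = 2 * (L * (\<theta> * C))\<^sup>2 * T powr (2 - 2 * \<alpha>)"
  define K2 where "K2 = 2 * L\<^sup>2"
  have K: "0 \<le> K1" "0 \<le> K2" by (simp_all add: K1_def K2_def)
  define e1 where "e1 s v = ennreal (indicator {0..T} s * (indicator {0..1} v * (K1 * p v)))" for s v
  define e2 where "e2 s v = ennreal (indicator {0..T} s * (indicator {0..1} v * (sobolev_kernel \<alpha> s v * (y s - y (s * v))\<^sup>2)))" for s v
  have [measurable]: "case_prod e1 \<in> borel_measurable (borel \<Otimes>\<^sub>M borel)" "case_prod e2 \<in> borel_measurable (borel \<Otimes>\<^sub>M borel)"
    unfolding e1_def e2_def by measurable
  have incr: "(g s - g u)\<^sup>2 \<le> 2 * (L * (\<theta> * C))\<^sup>2 * (s - u)\<^sup>2 + K2 * (y s - y u)\<^sup>2"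
    if su: "0 \<le> u" "u \<le> s" "s \<le> T" for s u
  proof -
    have ci: "set_integrable lborel {0..s} c"
      using su by (intro continuous_set_integrable continuous_on_subset[OF c(1)]) auto
    have "(LBINT r:{0..u} \<union> {u..s}. c r) = (LBINT r:{0..u}. c r) + (LBINT r:{u..s}. c r)"
    proof (rule set_integral_Un_AE)
      show "AE r in lborel. \<not> (r \<in> {0..u} \<and> r \<in> {u..s})"
        using AE_lborel_singleton[of u] by eventually_elim auto
    qed (use ci su in \<open>auto elim!: set_integrable_subset\<close>)
    moreover have "{0..u} \<union> {u..s} = {0..s}" using su by auto
    ultimately have diff: "x s - x u = \<theta> * (LBINT r:{u..s}. c r) + (y s - y u)"
      using x[of s] x[of u] su by (simp add: algebra_simps)
    have "\<bar>LBINT r:{u..s}. c r\<bar> \<le> (LBINT r:{u..s}. \<bar>c r\<bar>)" by (rule set_integral_abs_bound)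
    also have "\<dots> \<le> (LBINT r:{u..s}. C)"
    proof (rule set_integral_mono)
      show "set_integrable lborel {u..s} (\<lambda>r. \<bar>c r\<bar>)"
        by (intro set_integrable_abs set_integrable_subset[OF ci]) (use su in auto)
      show "set_integrable lborel {u..s} (\<lambda>_. C)" by (intro continuous_set_integrable continuous_intros)
      show "\<bar>c r\<bar> \<le> C" if "r \<in> {u..s}" for r using that su by (intro c(2)) auto
    qed
    also have "\<dots> = C * (s - u)" using su by (simp add: set_lebesgue_integral_def mult.commute)
    finally have "\<bar>\<theta> * (LBINT r:{u..s}. c r)\<bar> \<le> \<bar>\<theta>\<bar> * (C * (s - u))"
      unfolding abs_mult by (rule mult_left_mono) simp
    then have "\<bar>\<theta> * (LBINT r:{u..s}. c r)\<bar>\<^sup>2 \<le> (\<bar>\<theta>\<bar> * (C * (s - u)))\<^sup>2"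
      by (rule power_mono) simp
    then have 1: "(\<theta> * (LBINT r:{u..s}. c r))\<^sup>2 \<le> (\<theta> * C * (s - u))\<^sup>2"
      by (simp add: power_mult_distrib)
    have "\<bar>g s - g u\<bar>\<^sup>2 \<le> (L * \<bar>x s - x u\<bar>)\<^sup>2" using su by (intro power_mono g) auto
    then have "(g s - g u)\<^sup>2 \<le> L\<^sup>2 * (x s - x u)\<^sup>2" by (simp add: power_mult_distrib)
    also have "\<dots> \<le> L\<^sup>2 * (2 * (\<theta> * C * (s - u))\<^sup>2 + 2 * (y s - y u)\<^sup>2)"
    proof (rule mult_left_mono)
      show "(x s - x u)\<^sup>2 \<le> 2 * (\<theta> * C * (s - u))\<^sup>2 + 2 * (y s - y u)\<^sup>2"
        unfolding diff using 1 square_add_le[of "\<theta> * (LBINT r:{u..s}. c r)" "y s - y u"] by linarith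
    qed simp
    also have "\<dots> = 2 * (L * (\<theta> * C))\<^sup>2 * (s - u)\<^sup>2 + K2 * (y s - y u)\<^sup>2"
      by (simp add: K2_def power_mult_distrib distrib_left mult_ac)
    finally show ?thesis .
  qed
  have pointwise: "ennreal (indicator {0..T} s * (indicator {0..1} v * (sobolev_kernel \<alpha> s v * (g s - g (s * v))\<^sup>2)))
      \<le> e1 s v + ennreal K2 * e2 s v" for s v
  proof (cases "s \<in> {0..T} \<and> v \<in> {0..1}")
    case True
    then have s: "0 \<le> s" "s \<le> T" and v: "0 \<le> v" "v \<le> 1" by auto
    have sv: "0 \<le> s * v" "s * v \<le> s" using s v mult_left_mono[of v 1 s] by auto
    have "sobolev_kernel \<alpha> s v * (g s - g (s * v))\<^sup>2
        \<le> sobolev_kernel \<alpha> s v * (2 * (L * (\<theta> * C))\<^sup>2 * (s - s * v)\<^sup>2 + K2 * (y s - y (s * v))\<^sup>2)"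
      using incr[OF sv s(2)] by (intro mult_left_mono) auto
    also have "\<dots> = 2 * (L * (\<theta> * C))\<^sup>2 * (sobolev_kernel \<alpha> s v * (s - s * v)\<^sup>2) + K2 * (sobolev_kernel \<alpha> s v * (y s - y (s * v))\<^sup>2)"
      by (simp add: algebra_simps)
    also have "sobolev_kernel \<alpha> s v * (s - s * v)\<^sup>2 \<le> T powr (2 - 2 * \<alpha>) * p v"
    proof (cases "s = 0 \<or> v = 1")
      case True
      then show ?thesis using p0 by (auto simp: sobolev_kernel_def)
    next
      case False
      then have s0: "0 < s" and v1: "v < 1" using s v by auto
      have sq: "(s - s * v)\<^sup>2 = s powr 2 * (1 - v) powr 2"
        using s0 v1 by (simp add: powr_numeral power2_eq_square algebra_simps)
      have "sobolev_kernel \<alpha> s v * (s - s * v)\<^sup>2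
          = (s powr (- 2 * \<alpha>) * s powr 2) * (v powr (- \<alpha>) * ((1 - v) powr (- 2 * \<alpha> - 3 / 2) * (1 - v) powr 2))"
        unfolding sq by (simp add: sobolev_kernel_def)
      also have "s powr (- 2 * \<alpha>) * s powr 2 = s powr (2 - 2 * \<alpha>)" by (simp add: powr_add[symmetric])
      also have "(1 - v) powr (- 2 * \<alpha> - 3 / 2) * (1 - v) powr 2 = (1 - v) powr (3 / 2 - 2 * \<alpha> - 1)"
        by (simp add: powr_add[symmetric])
      also have "s powr (2 - 2 * \<alpha>) * (v powr (- \<alpha>) * (1 - v) powr (3 / 2 - 2 * \<alpha> - 1)) = s powr (2 - 2 * \<alpha>) * p v"
        by (simp add: p_def)
      also have "\<dots> \<le> T powr (2 - 2 * \<alpha>) * p v"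
        using s s0 \<alpha> p0 by (intro mult_right_mono powr_mono2) auto
      finally show ?thesis .
    qed
    finally have "sobolev_kernel \<alpha> s v * (g s - g (s * v))\<^sup>2
       \<le> K1 * p v + K2 * (sobolev_kernel \<alpha> s v * (y s - y (s * v))\<^sup>2)"
      by (simp add: K1_def mult_left_mono)
    then have "ennreal (sobolev_kernel \<alpha> s v * (g s - g (s * v))\<^sup>2)
       \<le> ennreal (K1 * p v) + ennreal K2 * ennreal (sobolev_kernel \<alpha> s v * (y s - y (s * v))\<^sup>2)"
      using K p0 by (simp add: ennreal_mult[symmetric] ennreal_plus[symmetric] ennreal_leI del: ennreal_plus)
    then show ?thesis using True by (simp add: e1_def e2_def)
  qed (auto simp: e1_def e2_def)
  have "sobolev_energy \<alpha> T g \<le> (\<integral>\<^sup>+s. \<integral>\<^sup>+v. e1 s v + ennreal K2 * e2 s v \<partial>lborel \<partial>lborel)"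
    unfolding sobolev_energy_def by (intro nn_integral_mono pointwise)
  also have "\<dots> = (\<integral>\<^sup>+s. \<integral>\<^sup>+v. e1 s v \<partial>lborel \<partial>lborel) + ennreal K2 * (\<integral>\<^sup>+s. \<integral>\<^sup>+v. e2 s v \<partial>lborel \<partial>lborel)"
    by (simp add: nn_integral_add nn_integral_cmult)
  also have "\<dots> < \<infinity>"
    using product_nn_integral_finite[OF p p0 K(1), of T] fin
    by (simp add: e1_def e2_def sobolev_energy_def ennreal_mult_less_top)
  finally show ?thesis .
qed

section \<open>Continuous adapted approximations of the preimages\<close>

lemma continuous_weighted_integral:
  fixes h :: "real \<Rightarrow> real \<Rightarrow> real"
  assumes w: "set_integrable lborel {0..1} w" and [measurable]: "w \<in> borel_measurable borel"
    and h: "\<And>v. continuous_on UNIV (\<lambda>s. h s v)" and [measurable]: "\<And>s. h s \<in> borel_measurable borel"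
    and C: "\<And>s v. \<bar>h s v\<bar> \<le> C"
  shows "continuous_on UNIV (\<lambda>s. LBINT v:{0..1}. w v * h s v)"
  unfolding continuous_on_sequentially
proof (intro allI ballI impI)
  fix x :: "nat \<Rightarrow> real" and a assume "(\<forall>n. x n \<in> UNIV) \<and> x \<longlonglongrightarrow> a"
  then have x: "x \<longlonglongrightarrow> a" by simp
  have "(\<lambda>n. LBINT v:{0..1}. w v * h (x n) v) \<longlonglongrightarrow> (LBINT v:{0..1}. w v * h a v)"
    unfolding set_lebesgue_integral_def
  proof (rule integral_dominated_convergence)
    show "integrable lborel (\<lambda>v. indicator {0..1} v *\<^sub>R (\<bar>w v\<bar> * C))"
      using set_integrable_mult_left[OF set_integrable_abs[OF w], of C] by (simp add: set_integrable_def)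
    show "AE v in lborel. (\<lambda>n. indicator {0..1} v *\<^sub>R (w v * h (x n) v)) \<longlonglongrightarrow> indicator {0..1} v *\<^sub>R (w v * h a v)"
    proof (rule AE_I2)
      fix v
      have "(\<lambda>n. h (x n) v) \<longlonglongrightarrow> h a v"
        by (rule continuous_on_tendsto_compose[OF h x]) auto
      then show "(\<lambda>n. indicator {0..1} v *\<^sub>R (w v * h (x n) v)) \<longlonglongrightarrow> indicator {0..1} v *\<^sub>R (w v * h a v)"
        by (intro tendsto_intros)
    qed
    show "AE v in lborel. norm (indicator {0..1} v *\<^sub>R (w v * h (x n) v)) \<le> indicator {0..1} v *\<^sub>R (\<bar>w v\<bar> * C)" for n
      using C by (auto simp: abs_mult indicator_def intro!: AE_I2 mult_left_mono)
  qed measurable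
  then show "((\<lambda>s. LBINT v:{0..1}. w v * h s v) \<circ> x) \<longlonglongrightarrow> (LBINT v:{0..1}. w v * h a v)"
    by (simp add: comp_def)
qed

lemma K_op_cmult: "K_op H (\<lambda>s. a * f s) t = a * K_op H f t"
  unfolding K_op_def set_integral_mult_right[symmetric] by (simp add: mult.left_commute)

lemma L2_cmult:
  assumes "f \<in> borel_measurable borel" "f \<in> L2 T"
  shows "(\<lambda>s. a * f s) \<in> L2 T"
  using assms L2_square_integrable[OF assms(2)] by (intro L2I) (simp_all add: power_mult_distrib)

text \<open>The preimage itself may be unbounded at 0, and its Marchaud integral is controlled only
  for almost every \<open>s\<close>. Bounding the outer power near 0 and cutting the weight near v =
  1 restore continuity, and the value at \<open>s\<close> still involves \<open>g\<close> only at
  times up to \<open>s\<close>.\<close>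

definition truncated_preimage_gt :: "real \<Rightarrow> nat \<Rightarrow> (real \<Rightarrow> real) \<Rightarrow> real \<Rightarrow> real" where
  "truncated_preimage_gt \<alpha> k g s = (max s (1 / (real k + 1))) powr (- \<alpha>) *
     ((1 - 2 * \<alpha>) * Beta (1 - \<alpha>) (1 - \<alpha>) * g s
      + \<alpha> * (LBINT v:{0..1}. (indicator {0..1 - 1 / (real k + 2)} v * marchaud_weight \<alpha> v) * (g s - g (s * v))))"

lemma truncation_le_1: "v \<le> 1 - 1 / (real k + 2) \<Longrightarrow> v \<le> 1"
proof -
  have "0 \<le> 1 / (real k + 2)" by simp
  then show "v \<le> 1 - 1 / (real k + 2) \<Longrightarrow> v \<le> 1" by linarith
qed

lemma truncated_weight_integrable:
  assumes "0 < \<alpha>" "\<alpha> < 1 / 2"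
  shows "set_integrable lborel {0..1} (\<lambda>v. indicator {0..1 - 1 / (real k + 2)} v * marchaud_weight \<alpha> v)"
proof -
  have "set_integrable lborel {0..1 - 1 / (real k + 2)} (marchaud_weight \<alpha>)"
    using assms by (intro marchaud_weight_integrable) (auto simp: field_simps)
  moreover have eq: "indicator {0..1} v *\<^sub>R (indicator {0..1 - 1 / (real k + 2)} v * marchaud_weight \<alpha> v)
    = indicator {0..1 - 1 / (real k + 2)} v *\<^sub>R marchaud_weight \<alpha> v" for v :: real
    by (auto simp: indicator_def dest: truncation_le_1)
  ultimately show ?thesis unfolding set_integrable_def eq by simp
qed

lemma truncated_integral_eq:
  "(LBINT v:{0..1}. (indicator {0..1 - 1 / (real k + 2)} v * marchaud_weight \<alpha> v) * h v)
    = (LBINT v:{0..(1 - 1 / (real k + 2)) * 1}. marchaud_weight \<alpha> v * h v)"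
  unfolding set_lebesgue_integral_def
  by (intro Bochner_Integration.integral_cong) (auto simp: indicator_def dest: truncation_le_1)

lemma continuous_truncated_preimage_gt:
  assumes \<alpha>: "0 < \<alpha>" "\<alpha> < 1 / 2" and g: "continuous_on UNIV g" and C: "\<And>s. \<bar>g s\<bar> \<le> C"
  shows "continuous_on UNIV (truncated_preimage_gt \<alpha> k g)"
proof -
  have [measurable]: "g \<in> borel_measurable borel" using g by (rule borel_measurable_continuous_onI)
  have "continuous_on UNIV (\<lambda>s. LBINT v:{0..1}. (indicator {0..1 - 1 / (real k + 2)} v * marchaud_weight \<alpha> v) * (g s - g (s * v)))"
  proof (rule continuous_weighted_integral)
    show "\<bar>g s - g (s * v)\<bar> \<le> 2 * C" for s v using C[of s] C[of "s * v"] by linarith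
    show "continuous_on UNIV (\<lambda>s. g s - g (s * v))" for v
      by (intro continuous_intros continuous_on_compose2[OF g]) auto
  qed (use truncated_weight_integrable[OF \<alpha>] in auto)
  moreover have "max s (1 / (real k + 1)) \<noteq> 0" for s
  proof -
    have "0 < 1 / (real k + 1)" by simp
    then show ?thesis by linarith
  qed
  ultimately show ?thesis
    unfolding truncated_preimage_gt_def[abs_def]
    by (intro continuous_intros g) auto
qed

lemma truncated_preimage_gt_tendsto:
  fixes g :: "real \<Rightarrow> real"
  assumes \<alpha>: "0 < \<alpha>" "\<alpha> < 1 / 2" and [measurable]: "g \<in> borel_measurable borel" and C: "\<And>s. \<bar>g s\<bar> \<le> C"
    and int1: "AE s in lborel. s \<in> {0..T} \<longrightarrow>
        set_integrable lborel {0..1} (\<lambda>v. marchaud_weight \<alpha> v * (g s - g (s * v)))"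
    and int2: "set_integrable lborel {0..T}
        (\<lambda>s. (s powr (- \<alpha>) * (LBINT v:{0..1}. \<bar>marchaud_weight \<alpha> v * (g s - g (s * v))\<bar>))\<^sup>2)"
    and t: "t \<in> {0..T}"
  shows "(\<lambda>k. LBINT s:{0..t}. (truncated_preimage_gt \<alpha> k g s - volterra_preimage_gt \<alpha> g s)\<^sup>2) \<longlonglongrightarrow> 0"
proof -
  define \<kappa> where "\<kappa> = (1 - 2 * \<alpha>) * Beta (1 - \<alpha>) (1 - \<alpha>)"
  define F where "F s v = marchaud_weight \<alpha> v * (g s - g (s * v))" for s v
  define I where "I s = (LBINT v:{0..1}. F s v)" for s
  define D where "D s = (LBINT v:{0..1}. \<bar>F s v\<bar>)" for s
  define \<rho> where "\<rho> k = 1 - 1 / (real k + 2)" for k :: nat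
  define Ik where "Ik k s = (LBINT v:{0..\<rho> k * 1}. F s v)" for k s
  define m where "m k s = (max s (1 / (real k + 1))) powr (- \<alpha>)" for k :: nat and s :: real
  have \<rho>: "\<And>k. 0 \<le> \<rho> k" "\<And>k. \<rho> k \<le> 1" by (auto simp: \<rho>_def field_simps)
  have "(\<lambda>k. 1 - 1 / (real k + 2)) \<longlonglongrightarrow> 1" by real_asymp
  then have \<rho>_lim: "\<rho> \<longlonglongrightarrow> 1" by (simp add: \<rho>_def[abs_def])
  have [measurable]: "case_prod F \<in> borel_measurable (borel \<Otimes>\<^sub>M borel)" unfolding F_def by measurable
  have [measurable]: "I \<in> borel_measurable borel" "D \<in> borel_measurable borel" "Ik k \<in> borel_measurable borel" for k
    unfolding I_def D_def Ik_def by (rule borel_measurable_set_integral; measurable)+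
  have Y: "truncated_preimage_gt \<alpha> k g s = m k s * (\<kappa> * g s + \<alpha> * Ik k s)" for k s
    unfolding truncated_preimage_gt_def truncated_integral_eq by (simp add: m_def \<kappa>_def Ik_def \<rho>_def F_def)
  have Q: "volterra_preimage_gt \<alpha> g s = s powr (- \<alpha>) * (\<kappa> * g s + \<alpha> * I s)" for s
    by (simp add: volterra_preimage_gt_def \<kappa>_def I_def F_def)
  have [measurable]: "m k \<in> borel_measurable borel" for k unfolding m_def by measurable
  have \<kappa>0: "0 \<le> \<kappa>" using \<alpha> Beta_pos[of "1 - \<alpha>" "1 - \<alpha>"] by (simp add: \<kappa>_def)
  \<comment> \<open>For s > 0 both truncations only decrease absolute values, m k s \<le> s powr (-
    \<alpha>) and \<bar>Ik k s\<bar> \<le> D s, so \<open>G\<close> bounds the truncated and the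
    limiting function alike and their squared difference is at most 4 G^2.\<close>
  define G where "G s = s powr (- \<alpha>) * (\<kappa> * C) + \<alpha> * (s powr (- \<alpha>) * D s)" for s
  have G2: "set_integrable lborel {0..t} (\<lambda>s. 4 * (G s)\<^sup>2)"
  proof (rule set_integrable_dominated)
    have a: "set_integrable lborel {0..t} (\<lambda>s. s powr (- 2 * \<alpha>))"
      using \<alpha> t by (intro powr_integral_from_0) auto
    have b: "set_integrable lborel {0..t} (\<lambda>s. (s powr (- \<alpha>) * D s)\<^sup>2)"
      using set_integrable_subset[OF int2, of "{0..t}"] t by (simp add: D_def F_def)
    show "set_integrable lborel {0..t} (\<lambda>s. 8 * ((\<kappa> * C)\<^sup>2 * s powr (- 2 * \<alpha>)) + 8 * (\<alpha>\<^sup>2 * (s powr (- \<alpha>) * D s)\<^sup>2))"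
      by (intro set_integral_add(1) set_integrable_mult_right a b)
    fix s
    have "(s powr (- \<alpha>) * (\<kappa> * C))\<^sup>2 = (\<kappa> * C)\<^sup>2 * s powr (- 2 * \<alpha>)"
      by (simp add: power_mult_distrib power2_eq_square powr_add[symmetric])
    moreover have "(\<alpha> * (s powr (- \<alpha>) * D s))\<^sup>2 = \<alpha>\<^sup>2 * (s powr (- \<alpha>) * D s)\<^sup>2" by (rule power_mult_distrib)
    ultimately show "\<bar>4 * (G s)\<^sup>2\<bar> \<le> 8 * ((\<kappa> * C)\<^sup>2 * s powr (- 2 * \<alpha>)) + 8 * (\<alpha>\<^sup>2 * (s powr (- \<alpha>) * D s)\<^sup>2)"
      using square_add_le[of "s powr (- \<alpha>) * (\<kappa> * C)" "\<alpha> * (s powr (- \<alpha>) * D s)"] by (simp add: G_def)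
  qed (simp_all add: G_def)
  have bound: "\<bar>r * (\<kappa> * g s + \<alpha> * J)\<bar> \<le> G s" if "0 \<le> r" "r \<le> s powr (- \<alpha>)" "\<bar>J\<bar> \<le> D s" for r J s
  proof -
    have "\<bar>\<kappa> * g s + \<alpha> * J\<bar> \<le> \<bar>\<kappa> * g s\<bar> + \<bar>\<alpha> * J\<bar>" by (rule abs_triangle_ineq)
    also have "\<dots> \<le> \<kappa> * C + \<alpha> * D s"
      using \<kappa>0 \<alpha> C that(3) by (intro add_mono) (simp_all add: abs_mult mult_left_mono)
    finally have "\<bar>\<kappa> * g s + \<alpha> * J\<bar> \<le> \<kappa> * C + \<alpha> * D s" .
    then have "r * \<bar>\<kappa> * g s + \<alpha> * J\<bar> \<le> s powr (- \<alpha>) * (\<kappa> * C + \<alpha> * D s)"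
      using that by (intro mult_mono) auto
    also have "s powr (- \<alpha>) * (\<kappa> * C + \<alpha> * D s) = G s" by (simp add: G_def algebra_simps)
    finally show ?thesis using that(1) by (simp only: abs_mult abs_of_nonneg)
  qed
  have good: "AE s in lborel. s \<in> {0..t} \<longrightarrow> 0 < s \<and> set_integrable lborel {0..1} (F s)"
    using int1 AE_lborel_singleton[of 0]
  proof eventually_elim
    case (elim s)
    then show ?case using t by (auto simp: F_def[abs_def])
  qed
  have mk: "0 \<le> m k s" "m k s \<le> s powr (- \<alpha>)" if "0 < s" for k s
    using that \<alpha> by (auto simp: m_def intro!: powr_mono2')
  have IkD: "\<bar>Ik k s\<bar> \<le> D s" if "set_integrable lborel {0..1} (F s)" for k s
  proof -
    have i: "set_integrable lborel {0..1} (\<lambda>v. \<bar>F s v\<bar>)" using that by (rule set_integrable_abs)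
    have "\<bar>Ik k s\<bar> \<le> (LBINT v:{0..\<rho> k * 1}. \<bar>F s v\<bar>)" unfolding Ik_def by (rule set_integral_abs_bound)
    also have "\<dots> \<le> D s"
      unfolding D_def set_lebesgue_integral_def
    proof (rule integral_mono)
      show "integrable lborel (\<lambda>v. indicator {0..\<rho> k * 1} v *\<^sub>R \<bar>F s v\<bar>)"
        using set_integrable_subset[OF i, of "{0..\<rho> k * 1}"] \<rho>[of k] by (simp add: set_integrable_def)
      show "integrable lborel (\<lambda>v. indicator {0..1} v *\<^sub>R \<bar>F s v\<bar>)" using i by (simp add: set_integrable_def)
      show "indicator {0..\<rho> k * 1} v *\<^sub>R \<bar>F s v\<bar> \<le> indicator {0..1} v *\<^sub>R \<bar>F s v\<bar>" for v
        using \<rho>[of k] by (auto simp: indicator_def)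
    qed
    finally show ?thesis .
  qed
  have "(\<lambda>k. LBINT s:{0..t}. (m k s * (\<kappa> * g s + \<alpha> * Ik k s) - s powr (- \<alpha>) * (\<kappa> * g s + \<alpha> * I s))\<^sup>2) \<longlonglongrightarrow> (LBINT s:{0..t}. 0)"
    unfolding set_lebesgue_integral_def
  proof (rule integral_dominated_convergence)
    show "integrable lborel (\<lambda>s. indicator {0..t} s *\<^sub>R (4 * (G s)\<^sup>2))" using G2 by (simp add: set_integrable_def)
    show "AE s in lborel. (\<lambda>k. indicator {0..t} s *\<^sub>R (m k s * (\<kappa> * g s + \<alpha> * Ik k s) - s powr (- \<alpha>) * (\<kappa> * g s + \<alpha> * I s))\<^sup>2)
        \<longlonglongrightarrow> indicator {0..t} s *\<^sub>R 0"
      using good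
    proof eventually_elim
      case (elim s)
      show ?case
      proof (cases "s \<in> {0..t}")
        case True
        then have s: "0 < s" and Fi: "set_integrable lborel {0..1} (F s)" using elim by auto
        have "(\<lambda>k. Ik k s) \<longlonglongrightarrow> I s"
          unfolding Ik_def I_def by (rule set_integral_Icc_tendsto[OF Fi _ \<rho>_lim \<rho>]) simp
        moreover have "(\<lambda>k. m k s) \<longlonglongrightarrow> s powr (- \<alpha>)"
        proof (rule tendsto_eventually)
          have "(\<lambda>k. 1 / (real k + 1)) \<longlonglongrightarrow> 0" by real_asymp
          then have "\<forall>\<^sub>F k in sequentially. 1 / (real k + 1) < s" using s by (rule order_tendstoD(2))
          then show "\<forall>\<^sub>F k in sequentially. m k s = s powr (- \<alpha>)"
            by eventually_elim (simp add: m_def max_def)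
        qed
        ultimately have "(\<lambda>k. indicator {0..t} s *\<^sub>R (m k s * (\<kappa> * g s + \<alpha> * Ik k s) - s powr (- \<alpha>) * (\<kappa> * g s + \<alpha> * I s))\<^sup>2)
          \<longlonglongrightarrow> indicator {0..t} s *\<^sub>R (s powr (- \<alpha>) * (\<kappa> * g s + \<alpha> * I s) - s powr (- \<alpha>) * (\<kappa> * g s + \<alpha> * I s))\<^sup>2"
          by (intro tendsto_intros)
        then show ?thesis by simp
      qed simp
    qed
    show "AE s in lborel. norm (indicator {0..t} s *\<^sub>R (m k s * (\<kappa> * g s + \<alpha> * Ik k s) - s powr (- \<alpha>) * (\<kappa> * g s + \<alpha> * I s))\<^sup>2)
        \<le> indicator {0..t} s *\<^sub>R (4 * (G s)\<^sup>2)" for k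
      using good
    proof eventually_elim
      case (elim s)
      show ?case
      proof (cases "s \<in> {0..t}")
        case True
        then have s: "0 < s" and Fi: "set_integrable lborel {0..1} (F s)" using elim by auto
        have "\<bar>m k s * (\<kappa> * g s + \<alpha> * Ik k s)\<bar> \<le> G s" using mk[OF s] IkD[OF Fi] by (rule bound)
        moreover have "\<bar>s powr (- \<alpha>) * (\<kappa> * g s + \<alpha> * I s)\<bar> \<le> G s"
          by (rule bound) (simp_all add: I_def D_def set_integral_abs_bound)
        ultimately have "\<bar>m k s * (\<kappa> * g s + \<alpha> * Ik k s) - s powr (- \<alpha>) * (\<kappa> * g s + \<alpha> * I s)\<bar> \<le> 2 * G s" by linarith
        then have "\<bar>m k s * (\<kappa> * g s + \<alpha> * Ik k s) - s powr (- \<alpha>) * (\<kappa> * g s + \<alpha> * I s)\<bar>\<^sup>2 \<le> (2 * G s)\<^sup>2"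
          by (rule power_mono) simp
        then show ?thesis using True by (simp add: power_mult_distrib)
      qed simp
    qed
  qed measurable
  then show ?thesis unfolding Y Q by simp
qed

context wiener_space
begin

text \<open>The interface between the analysis of the operator and the stochastic integral: the
  three ranges of \<open>H\<close> establish it and \<open>K_op_inverse_ito\<close> consumes it.
  Adaptedness is asked of the approximations \<open>Y\<close>, not of the preimage
  \<open>q\<close>.\<close>

definition volterra_solvable :: "real \<Rightarrow> real \<Rightarrow> (real \<Rightarrow> 'a \<Rightarrow> real) \<Rightarrow> bool" where
  "volterra_solvable H T g \<longleftrightarrow> (\<exists>q Y.
     (AE \<omega> in M. q \<omega> \<in> L2 T \<and> (\<forall>t\<in>{0..T}. K_op H (q \<omega>) t = (LBINT u:{0..t}. g u \<omega>))) \<and>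
     (\<forall>k::nat. \<forall>s\<in>{0..T}. ae_measurable M (F s) (Y k s)) \<and>
     (\<forall>k. AE \<omega> in M. continuous_on {0..T} (\<lambda>s. Y k s \<omega>)) \<and>
     (\<forall>t\<in>{0..T}. AE \<omega> in M. (\<lambda>k. LBINT s:{0..t}. (Y k s \<omega> - q \<omega> s)\<^sup>2) \<longlonglongrightarrow> 0))"

lemma ae_measurable_scaled:
  assumes g: "\<And>s. s \<in> {0..T} \<Longrightarrow> ae_measurable M (F s) (g s)" and s: "s \<in> {0..T}" and v: "v \<in> {0..1}"
  shows "ae_measurable M (F s) (g (s * v))"
proof -
  have sv: "s * v \<le> s * 1" using s v by (intro mult_left_mono) auto
  then have "ae_measurable M (F (s * v)) (g (s * v))" using s v by (intro g) auto
  then show ?thesis by (rule ae_measurable_mono) (rule natural_filtration_mono, assumption, use sv in simp)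
qed

lemma volterra_solvable_half:
  assumes g: "\<And>s. s \<in> {0..T} \<Longrightarrow> ae_measurable M (F s) (g s)"
    and paths: "AE \<omega> in M. continuous_on UNIV (\<lambda>s. g s \<omega>) \<and> (\<exists>C. \<forall>s. \<bar>g s \<omega>\<bar> \<le> C)"
  shows "volterra_solvable (1 / 2) T g"
  unfolding volterra_solvable_def
proof (intro exI[of _ "\<lambda>\<omega> s. g s \<omega>"] exI[of _ "\<lambda>_. g"] conjI allI ballI)
  show "AE \<omega> in M. (\<lambda>s. g s \<omega>) \<in> L2 T \<and> (\<forall>t\<in>{0..T}. K_op (1 / 2) (\<lambda>s. g s \<omega>) t = (LBINT u:{0..t}. g u \<omega>))"
    using paths
  proof eventually_elim
    case (elim \<omega>)
    then have m: "(\<lambda>s. g s \<omega>) \<in> borel_measurable borel" by (intro borel_measurable_continuous_onI) simp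
    have "continuous_on {0..T} (\<lambda>s. (g s \<omega>)\<^sup>2)" using elim by (intro continuous_intros) (auto intro: continuous_on_subset)
    then show ?case using K_op_half(1)[OF m] by (auto intro!: L2I m continuous_set_integrable)
  qed
  show "AE \<omega> in M. continuous_on {0..T} (\<lambda>s. g s \<omega>)"
    using paths by eventually_elim (auto intro: continuous_on_subset)
qed (auto simp: g)

text \<open>Here the preimage is a continuous adapted process, so it serves as its own constant
  sequence of approximations.\<close>

lemma volterra_solvable_lt:
  assumes H: "0 < H" "H < 1 / 2"
    and g: "\<And>s. s \<in> {0..T} \<Longrightarrow> ae_measurable M (F s) (g s)"
    and paths: "AE \<omega> in M. continuous_on UNIV (\<lambda>s. g s \<omega>) \<and> (\<exists>C. \<forall>s. \<bar>g s \<omega>\<bar> \<le> C)"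
  shows "volterra_solvable H T g"
proof -
  define \<beta> where "\<beta> = 1 / 2 - H"
  have \<beta>: "H = 1 / 2 - \<beta>" "0 < \<beta>" "\<beta> < 1 / 2" using H by (auto simp: \<beta>_def)
  \<comment> \<open>The operator maps the explicit preimage to \<open>K\<close> times the primitive
    of \<open>g\<close>, so \<open>q\<close> is normalised by dividing by
    \<open>K > 0\<close>.\<close>
  define K where "K = volterra_const H * Beta \<beta> (1 - \<beta>)"
  have K: "K > 0" using volterra_const_pos[of H] Beta_pos[of \<beta> "1 - \<beta>"] H \<beta> by (simp add: K_def)
  define w where "w v = v powr \<beta> * (1 - v) powr (\<beta> - 1)" for v :: real
  have [measurable]: "w \<in> borel_measurable borel" unfolding w_def by measurable
  have w: "set_integrable lborel {0..1} w"
    using Beta_integral(1)[of "\<beta> + 1" \<beta>] \<beta> by (simp add: w_def[abs_def])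
  define q where "q \<omega> s = 1 / K * volterra_preimage_lt \<beta> (\<lambda>u. g u \<omega>) s" for \<omega> s
  have q_eq: "q \<omega> s = 1 / K * (s powr \<beta> * (LBINT v:{0..1}. w v * g (s * v) \<omega>))" for \<omega> s
    by (simp add: q_def volterra_preimage_lt_def w_def)
  show ?thesis
    unfolding volterra_solvable_def
  proof (intro exI[of _ q] exI[of _ "\<lambda>_ s \<omega>. q \<omega> s"] conjI allI ballI)
    show "AE \<omega> in M. q \<omega> \<in> L2 T \<and> (\<forall>t\<in>{0..T}. K_op H (q \<omega>) t = (LBINT u:{0..t}. g u \<omega>))"
      using paths
    proof eventually_elim
      case (elim \<omega>)
      then obtain C where C: "\<And>s. \<bar>g s \<omega>\<bar> \<le> C" by blast
      have m: "(\<lambda>s. g s \<omega>) \<in> borel_measurable borel" using elim by (intro borel_measurable_continuous_onI) simp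
      note V = volterra_preimage_lt[OF \<beta> m C]
      have "q \<omega> \<in> L2 T" unfolding q_def[abs_def] by (rule L2_cmult[OF V(1) V(3)])
      moreover have "K_op H (q \<omega>) t = (LBINT u:{0..t}. g u \<omega>)" if "t \<in> {0..T}" for t
        using V(4)[OF that, folded K_def] K unfolding q_def[abs_def] K_op_cmult by simp
      ultimately show ?case by blast
    qed
    show "AE \<omega> in M. continuous_on {0..T} (\<lambda>s. q \<omega> s)"
      using paths
    proof eventually_elim
      case (elim \<omega>)
      then obtain C where C: "\<And>s. \<bar>g s \<omega>\<bar> \<le> C" and c: "continuous_on UNIV (\<lambda>s. g s \<omega>)" by blast
      have [measurable]: "(\<lambda>s. g s \<omega>) \<in> borel_measurable borel" using c by (rule borel_measurable_continuous_onI)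
      have "continuous_on UNIV (\<lambda>s. LBINT v:{0..1}. w v * g (s * v) \<omega>)"
      proof (rule continuous_weighted_integral[OF w])
        show "continuous_on UNIV (\<lambda>s. g (s * v) \<omega>)" for v
          by (rule continuous_on_compose2[OF c]) (auto intro!: continuous_intros)
      qed (use C in auto)
      then have "continuous_on {0..T} (\<lambda>s. LBINT v:{0..1}. w v * g (s * v) \<omega>)" by (rule continuous_on_subset) simp
      moreover have "continuous_on {0..T} (\<lambda>s. s powr \<beta>)"
        using \<beta> by (intro continuous_on_powr' continuous_intros) auto
      ultimately show ?case unfolding q_eq by (intro continuous_on_mult continuous_on_const)
    qed
    fix s assume s: "s \<in> {0..T}"
    have "ae_measurable M (F s) (\<lambda>\<omega>. LBINT v:{0..1}. w v * g (s * v) \<omega>)"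
    proof (rule ae_measurable_integral[OF w])
      show "AE \<omega> in M. continuous_on {0..1} (\<lambda>v. g (s * v) \<omega>)"
        using paths
      proof eventually_elim
        case (elim \<omega>)
        show ?case by (rule continuous_on_compose2[OF conjunct1[OF elim]]) (auto intro!: continuous_intros)
      qed
    qed (use ae_measurable_scaled[OF g s] in auto)
    then show "ae_measurable M (F s) (\<lambda>\<omega>. q \<omega> s)" unfolding q_eq by (intro ae_measurable_cmult)
  qed auto
qed

lemma volterra_solvable_gt:
  assumes H: "1 / 2 < H" "H < 1"
    and g: "\<And>s. s \<in> {0..T} \<Longrightarrow> ae_measurable M (F s) (g s)"
    and paths: "AE \<omega> in M. continuous_on UNIV (\<lambda>s. g s \<omega>) \<and> (\<exists>C. \<forall>s. \<bar>g s \<omega>\<bar> \<le> C)"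
    and energy: "AE \<omega> in M. sobolev_energy (H - 1 / 2) T (\<lambda>s. g s \<omega>) < \<infinity>"
  shows "volterra_solvable H T g"
proof -
  define \<alpha> where "\<alpha> = H - 1 / 2"
  have \<alpha>: "H = \<alpha> + 1 / 2" "0 < \<alpha>" "\<alpha> < 1 / 2" using H by (auto simp: \<alpha>_def)
  define K where "K = volterra_const H * Beta \<alpha> (1 - \<alpha>)"
  have K: "K > 0" using volterra_const_pos[of H] Beta_pos[of \<alpha> "1 - \<alpha>"] H \<alpha> by (simp add: K_def)
  define q where "q \<omega> s = 1 / K * volterra_preimage_gt \<alpha> (\<lambda>u. g u \<omega>) s" for \<omega> s
  define Y where "Y k s \<omega> = 1 / K * truncated_preimage_gt \<alpha> k (\<lambda>u. g u \<omega>) s" for k s \<omega>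
  have energy': "AE \<omega> in M. sobolev_energy \<alpha> T (\<lambda>s. g s \<omega>) < \<infinity>" using energy by (simp add: \<alpha>_def)
  show ?thesis
    unfolding volterra_solvable_def
  proof (intro exI[of _ q] exI[of _ Y] conjI allI ballI)
    show "AE \<omega> in M. q \<omega> \<in> L2 T \<and> (\<forall>t\<in>{0..T}. K_op H (q \<omega>) t = (LBINT u:{0..t}. g u \<omega>))"
      using paths energy'
    proof eventually_elim
      case (elim \<omega>)
      then obtain C where C: "\<And>s. \<bar>g s \<omega>\<bar> \<le> C" by blast
      have m: "(\<lambda>s. g s \<omega>) \<in> borel_measurable borel" using elim by (intro borel_measurable_continuous_onI) simp
      note V = volterra_preimage_gt[OF \<alpha> m C sobolev_imp_marchaud_integrable[OF \<alpha>(2,3) m elim(2)]]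
      have "q \<omega> \<in> L2 T" unfolding q_def[abs_def] by (rule L2_cmult[OF V(1) V(2)])
      moreover have "K_op H (q \<omega>) t = (LBINT u:{0..t}. g u \<omega>)" if "t \<in> {0..T}" for t
        using V(3)[OF that, folded K_def] K unfolding q_def[abs_def] K_op_cmult by simp
      ultimately show ?case by blast
    qed
    show "AE \<omega> in M. continuous_on {0..T} (\<lambda>s. Y k s \<omega>)" for k
      using paths
    proof eventually_elim
      case (elim \<omega>)
      then obtain C where C: "\<And>s. \<bar>g s \<omega>\<bar> \<le> C" and c: "continuous_on UNIV (\<lambda>s. g s \<omega>)" by blast
      have "continuous_on {0..T} (truncated_preimage_gt \<alpha> k (\<lambda>u. g u \<omega>))"
        using continuous_truncated_preimage_gt[OF \<alpha>(2,3) c C] by (rule continuous_on_subset) simp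
      then show ?case unfolding Y_def by (intro continuous_intros)
    qed
    show "AE \<omega> in M. (\<lambda>k. LBINT s:{0..t}. (Y k s \<omega> - q \<omega> s)\<^sup>2) \<longlonglongrightarrow> 0" if t: "t \<in> {0..T}" for t
      using paths energy'
    proof eventually_elim
      case (elim \<omega>)
      then obtain C where C: "\<And>s. \<bar>g s \<omega>\<bar> \<le> C" by blast
      have m: "(\<lambda>s. g s \<omega>) \<in> borel_measurable borel" using elim by (intro borel_measurable_continuous_onI) simp
      note lim = truncated_preimage_gt_tendsto[OF \<alpha>(2,3) m C sobolev_imp_marchaud_integrable[OF \<alpha>(2,3) m elim(2)] t]
      have eq: "(Y k s \<omega> - q \<omega> s)\<^sup>2 = (1 / K)\<^sup>2 * (truncated_preimage_gt \<alpha> k (\<lambda>u. g u \<omega>) s - volterra_preimage_gt \<alpha> (\<lambda>u. g u \<omega>) s)\<^sup>2" for k s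
        unfolding Y_def q_def right_diff_distrib[symmetric] by (rule power_mult_distrib)
      show ?case unfolding eq set_integral_mult_right using tendsto_mult_left[OF lim, of "(1 / K)\<^sup>2"] by simp
    qed
    fix k s assume s: "s \<in> {0..T}"
    have "ae_measurable M (F s) (\<lambda>\<omega>. LBINT v:{0..1}. (indicator {0..1 - 1 / (real k + 2)} v * marchaud_weight \<alpha> v) * (g s \<omega> - g (s * v) \<omega>))"
    proof (rule ae_measurable_integral[OF truncated_weight_integrable[OF \<alpha>(2,3)]])
      show "AE \<omega> in M. continuous_on {0..1} (\<lambda>v. g s \<omega> - g (s * v) \<omega>)"
        using paths
      proof eventually_elim
        case (elim \<omega>)
        have "continuous_on {0..1} (\<lambda>v. g (s * v) \<omega>)"
          by (rule continuous_on_compose2[OF conjunct1[OF elim]]) (auto intro!: continuous_intros)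
        then show ?case by (intro continuous_intros)
      qed
      show "ae_measurable M (F s) (\<lambda>\<omega>. g s \<omega> - g (s * v) \<omega>)" if "v \<in> {0..1}" for v
        by (intro ae_measurable_diff g s ae_measurable_scaled[OF g s that])
    qed simp
    then show "ae_measurable M (F s) (Y k s)"
      unfolding Y_def[abs_def] truncated_preimage_gt_def by (intro ae_measurable_cmult ae_measurable_add g s)
  qed
qed

end

section \<open>The chosen inverse, its Ito integral and the estimator\<close>

lemma bounded_deriv_imp_Lipschitz:
  fixes b :: "real \<Rightarrow> real"
  assumes "\<forall>x. b differentiable (at x)" "bounded (range (deriv b))"
  obtains L where "\<And>x y. \<bar>b x - b y\<bar> \<le> L * \<bar>x - y\<bar>"
proof -
  obtain L where L: "\<And>x. \<bar>deriv b x\<bar> \<le> L"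
    using assms(2) unfolding bounded_iff by (metis rangeI real_norm_def)
  have "norm (b x - b y) \<le> L * norm (x - y)" for x y
  proof (rule field_differentiable_bound[of UNIV b "deriv b"])
    show "(b has_field_derivative deriv b z) (at z within UNIV)" for z
      using assms(1) by (simp add: DERIV_deriv_iff_real_differentiable)
  qed (use L in auto)
  then show ?thesis by (intro that) simp
qed

lemma K_op_inverse_eq:
  assumes "f \<in> L2 T" "\<And>t. t \<in> {0..T} \<Longrightarrow> K_op H f t = h t"
  shows "K_op_inverse H T h \<in> L2 T" and "t \<in> {0..T} \<Longrightarrow> K_op H (K_op_inverse H T h) t = h t"
proof -
  have "K_op_inverse H T h \<in> L2 T \<and> (\<forall>t\<in>{0..T}. K_op H (K_op_inverse H T h) t = h t)"
    unfolding K_op_inverse_def by (rule someI[of _ f]) (use assms in blast)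
  then show "K_op_inverse H T h \<in> L2 T" and "t \<in> {0..T} \<Longrightarrow> K_op H (K_op_inverse H T h) t = h t"
    by auto
qed

lemma L2_distance_cong_AE:
  assumes "y \<in> L2 t" "f \<in> L2 t" "g \<in> L2 t"
    and "AE s in lborel. s \<in> {0..t} \<longrightarrow> f s = g s"
  shows "(LBINT s:{0..t}. (y s - f s)\<^sup>2) = (LBINT s:{0..t}. (y s - g s)\<^sup>2)"
  unfolding set_lebesgue_integral_def
proof (rule integral_cong_AE)
  show "(\<lambda>s. indicator {0..t} s *\<^sub>R (y s - f s)\<^sup>2) \<in> borel_measurable lborel"
    "(\<lambda>s. indicator {0..t} s *\<^sub>R (y s - g s)\<^sup>2) \<in> borel_measurable lborel"
    using L2_square_integrable[OF L2_diff[OF assms(1,2)]] L2_square_integrable[OF L2_diff[OF assms(1,3)]]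
    unfolding set_integrable_def by auto
  show "AE s in lborel. indicator {0..t} s *\<^sub>R (y s - f s)\<^sup>2 = indicator {0..t} s *\<^sub>R (y s - g s)\<^sup>2"
    using assms(4) by eventually_elim (auto simp: indicator_def)
qed

lemma continuous_L2:
  assumes "continuous_on {0..t} y"
  shows "y \<in> L2 t"
proof -
  have "set_integrable lborel {0..t} (\<lambda>s. (y s)\<^sup>2)"
    by (intro continuous_set_integrable continuous_intros assms)
  moreover have "set_borel_measurable lborel {0..t} y"
    unfolding set_borel_measurable_def
    using borel_measurable_continuous_on_indicator[OF _ assms] by simp
  ultimately show ?thesis by (simp add: L2_def)
qed

context wiener_space
begin

text \<open>The existence of \<open>q \<omega>\<close> makes the choice meaningful, and uniqueness
  makes the chosen function agree with \<open>q \<omega>\<close> at almost every time. The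
  approximations \<open>Y\<close> then have the same distances to both, which is all that the
  construction of the Ito integral uses.\<close>

lemma K_op_inverse_ito:
  assumes H: "0 < H" "H < 1" and solv: "volterra_solvable H T g"
    and h: "AE \<omega> in M. \<forall>t\<in>{0..T}. h \<omega> t = (LBINT u:{0..t}. g u \<omega>)"
  shows "AE \<omega> in M. K_op_inverse H T (h \<omega>) \<in> L2 T \<and> (\<forall>t\<in>{0..T}. K_op H (K_op_inverse H T (h \<omega>)) t = h \<omega> t)"
    and "t \<in> {0..T} \<Longrightarrow> \<exists>I. has_ito_integral M W (\<lambda>s \<omega>. K_op_inverse H T (h \<omega>) s) t I"
proof -
  obtain q Y where q: "AE \<omega> in M. q \<omega> \<in> L2 T \<and> (\<forall>t\<in>{0..T}. K_op H (q \<omega>) t = (LBINT u:{0..t}. g u \<omega>))"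
    and Y: "\<And>k s. s \<in> {0..T} \<Longrightarrow> ae_measurable M (F s) (Y k s)"
    and Yc: "\<And>k. AE \<omega> in M. continuous_on {0..T} (\<lambda>s. Y k s \<omega>)"
    and lim: "\<And>t. t \<in> {0..T} \<Longrightarrow> AE \<omega> in M. (\<lambda>k::nat. LBINT s:{0..t}. (Y k s \<omega> - q \<omega> s)\<^sup>2) \<longlonglongrightarrow> 0"
    using solv unfolding volterra_solvable_def by blast
  have both: "AE \<omega> in M. K_op_inverse H T (h \<omega>) \<in> L2 T \<and> (\<forall>t\<in>{0..T}. K_op H (K_op_inverse H T (h \<omega>)) t = h \<omega> t) \<and>
      q \<omega> \<in> L2 T \<and> (AE s in lborel. s \<in> {0..T} \<longrightarrow> q \<omega> s = K_op_inverse H T (h \<omega>) s)"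
    using q h
  proof eventually_elim
    case (elim \<omega>)
    then have q2: "q \<omega> \<in> L2 T" and qK: "\<And>t. t \<in> {0..T} \<Longrightarrow> K_op H (q \<omega>) t = h \<omega> t" by auto
    have inv: "K_op_inverse H T (h \<omega>) \<in> L2 T" "\<And>t. t \<in> {0..T} \<Longrightarrow> K_op H (K_op_inverse H T (h \<omega>)) t = h \<omega> t"
      by (rule K_op_inverse_eq[OF q2], simp add: qK)+
    have "AE s in lborel. s \<in> {0..T} \<longrightarrow> q \<omega> s = K_op_inverse H T (h \<omega>) s"
    proof (rule K_op_unique[OF H q2 inv(1)])
      show "K_op H (q \<omega>) t = K_op H (K_op_inverse H T (h \<omega>)) t" if "t \<in> {0..T}" for t
        using qK[OF that] inv(2)[OF that] by simp
    qed
    then show ?case using inv q2 by blast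
  qed
  then show "AE \<omega> in M. K_op_inverse H T (h \<omega>) \<in> L2 T \<and> (\<forall>t\<in>{0..T}. K_op H (K_op_inverse H T (h \<omega>)) t = h \<omega> t)"
    by eventually_elim blast
  assume t: "t \<in> {0..T}"
  then have sub: "{0..t} \<subseteq> {0..T}" and tT: "0 \<le> t" "t \<le> T" by auto
  have Yc': "AE \<omega> in M. \<forall>k. continuous_on {0..T} (\<lambda>s. Y k s \<omega>)" using Yc by (simp add: AE_all_countable)
  show "\<exists>I. has_ito_integral M W (\<lambda>s \<omega>. K_op_inverse H T (h \<omega>) s) t I"
  proof (rule has_ito_integral_of_limit[OF tT(1)])
    show "ae_measurable M (F s) (Y k s)" if "s \<in> {0..t}" for k s using that sub by (intro Y) auto
    show "AE \<omega> in M. continuous_on {0..t} (\<lambda>s. Y k s \<omega>)" for k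
      using Yc[of k] by eventually_elim (rule continuous_on_subset[OF _ sub])
    show "AE \<omega> in M. (\<lambda>s. K_op_inverse H T (h \<omega>) s) \<in> L2 t"
      using both by eventually_elim (auto intro: L2_mono[OF _ tT(2)])
    show "AE \<omega> in M. (\<lambda>k. LBINT s:{0..t}. (Y k s \<omega> - K_op_inverse H T (h \<omega>) s)\<^sup>2) \<longlonglongrightarrow> 0"
      using both lim[OF t] Yc'
    proof eventually_elim
      case (elim \<omega>)
      have ae: "AE s in lborel. s \<in> {0..t} \<longrightarrow> q \<omega> s = K_op_inverse H T (h \<omega>) s"
        using elim(1) sub by (auto elim!: eventually_mono)
      have "(LBINT s:{0..t}. (Y k s \<omega> - q \<omega> s)\<^sup>2) = (LBINT s:{0..t}. (Y k s \<omega> - K_op_inverse H T (h \<omega>) s)\<^sup>2)" for k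
      proof (rule L2_distance_cong_AE[OF _ _ _ ae])
        have "continuous_on {0..T} (\<lambda>s. Y k s \<omega>)" using elim(3) by simp
        then show "(\<lambda>s. Y k s \<omega>) \<in> L2 t" by (intro continuous_L2 continuous_on_subset[OF _ sub])
        show "q \<omega> \<in> L2 t" "K_op_inverse H T (h \<omega>) \<in> L2 t"
          using elim(1) by (simp_all add: L2_mono[OF _ tT(2)])
      qed
      then show ?case using elim(2) by simp
    qed
  qed
qed

end

text \<open>Completing the square: the loss of likelihood at a parameter x is V / 2 times the
  squared distance of x to the estimator. For V > 0 this also gives uniqueness.\<close>

lemma log_likelihood_maximum:
  fixes q :: "real \<Rightarrow> real" and t I :: real
  defines "V \<equiv> LBINT s:{0..t}. (q s)\<^sup>2"
  assumes V: "V = 0 \<Longrightarrow> I = 0" and S: "- (I / V) \<in> S"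
  shows "maximum_likelihood_estimate S (log_likelihood I q t) (- (I / V))"
    and "V > 0 \<Longrightarrow> maximum_likelihood_estimate S (log_likelihood I q t) \<eta> \<Longrightarrow> \<eta> = - (I / V)"
proof -
  define m where "m = - (I / V)"
  have V0: "0 \<le> V" unfolding V_def by (rule set_integral_square_nonneg)
  \<comment> \<open>For V = 0 the quotient is 0 by convention and I = 0 by assumption, so the
    identity holds in both cases and the computation needs no further distinction.\<close>
  have I: "I = - m * V" using V by (cases "V = 0") (auto simp: m_def)
  have diff: "log_likelihood I q t m - log_likelihood I q t x = V / 2 * (x - m)\<^sup>2" for x
    unfolding log_likelihood_def V_def[symmetric] I by (simp add: power2_eq_square field_simps)
  have le: "log_likelihood I q t x \<le> log_likelihood I q t m" for x
  proof -
    have "0 \<le> V / 2 * (x - m)\<^sup>2" using V0 by simp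
    then show ?thesis using diff[of x] by linarith
  qed
  show "maximum_likelihood_estimate S (log_likelihood I q t) (- (I / V))"
    unfolding maximum_likelihood_estimate_def is_arg_max_def m_def[symmetric]
    using S le by (auto simp: m_def not_less)
  assume "V > 0" and "maximum_likelihood_estimate S (log_likelihood I q t) \<eta>"
  then have "log_likelihood I q t m \<le> log_likelihood I q t \<eta>"
    using S by (auto simp: maximum_likelihood_estimate_def is_arg_max_def m_def not_less)
  then have "V / 2 * (\<eta> - m)\<^sup>2 \<le> 0" using diff[of \<eta>] by simp
  then show "\<eta> = - (I / V)" using \<open>V > 0\<close> by (simp add: m_def mult_le_0_iff)
qed

text \<open>\<open>K_op_inverse\<close> is meaningful only if a preimage exists, so the first
  conjunct also states that the operator maps the path of \<open>Q\<close> back to the integrated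
  drift. \<open>I\<close> ranges over all versions of the Ito integral, and existence is stated
  separately to exclude a vacuous claim. Over \<Theta> the maximizer can differ from the formula
  when that value lies outside \<Theta>, whence the premise \<open>\<theta>\<^sub>t \<in> S\<close>.
  Uniqueness is restricted to V > 0: for V = 0 the likelihood is almost surely constant in the
  parameter.\<close>

theorem proposition1:
  fixes M :: "'a measure" and H T \<theta> :: real and \<Theta> :: "real set" and b :: "real \<Rightarrow> real"
    and W B X :: "real \<Rightarrow> 'a \<Rightarrow> real"
  assumes "prob_space M"
    and "0 < H" and "H < 1"
    and "T > 0"
    and "\<theta> \<in> \<Theta>"
    and "\<forall>x. b differentiable (at x)" and "bounded (range (deriv b))"
    and "wiener_process M W"
    and "fractional_brownian_motion M H B"
    and "\<forall>t\<ge>0. has_ito_integral M W (\<lambda>s \<omega>. volterra_kernel H t s) t (B t)"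
    and "solves_fractional_sde M T b \<theta> B X"
  shows "(AE \<omega> in M. (\<lambda>s. Q_process H T b X s \<omega>) \<in> L2 T \<and>
            (\<forall>t\<in>{0..T}. K_op H (\<lambda>s. Q_process H T b X s \<omega>) t = integrated_drift b X \<omega> t)) \<and>
         (\<forall>t\<in>{0..T}.
            (\<exists>I. has_ito_integral M W (Q_process H T b X) t I) \<and>
            (\<forall>I. has_ito_integral M W (Q_process H T b X) t I \<longrightarrow>
              (AE \<omega> in M.
                let V = (LBINT s:{0..t}. (Q_process H T b X s \<omega>)\<^sup>2);
                    F = log_likelihood (I \<omega>) (\<lambda>s. Q_process H T b X s \<omega>) t;
                    \<theta>\<^sub>t = - (I \<omega> / V)
                in \<forall>S\<in>{UNIV, \<Theta>}. \<theta>\<^sub>t \<in> S \<longrightarrow>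
                     maximum_likelihood_estimate S F \<theta>\<^sub>t \<and>
                     (V > 0 \<longrightarrow> (\<forall>\<eta>. maximum_likelihood_estimate S F \<eta> \<longrightarrow> \<eta> = \<theta>\<^sub>t)))))"
proof -
  interpret prob_space M by fact
  interpret wiener_space M W by unfold_locales fact
  obtain L where L: "\<And>x y. \<bar>b x - b y\<bar> \<le> L * \<bar>x - y\<bar>"
    using bounded_deriv_imp_Lipschitz assms(6,7) by metis
  have b: "continuous_on UNIV b"
    using assms(6) by (simp add: continuous_on_eq_continuous_at differentiable_imp_continuous_within)
  have Bc: "AE \<omega> in M. continuous_on {0..} (\<lambda>t. B t \<omega>)"
    using assms(9) by (simp add: fractional_brownian_motion_def)
  have X: "AE \<omega> in M. continuous_on {0..T} (\<lambda>t. X t \<omega>) \<and>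
      (\<forall>t\<in>{0..T}. X t \<omega> = \<theta> * (LBINT s:{0..t}. b (X s \<omega>)) + B t \<omega>)"
    using assms(11) by (auto simp: solves_fractional_sde_def)
  have paths: "AE \<omega> in M. continuous_on {0..T} (\<lambda>s. B s \<omega>) \<and> continuous_on {0..T} (\<lambda>s. X s \<omega>) \<and>
        (\<forall>t\<in>{0..T}. X t \<omega> = \<theta> * (LBINT s:{0..t}. b (X s \<omega>)) + B t \<omega>)"
    using Bc X by eventually_elim (auto elim: continuous_on_subset)
  have Bm: "ae_measurable M (F s) (B s)" if "s \<in> {0..T}" for s
    using assms(10) that by (intro ito_integral_ae_measurable) auto
  have Xm: "ae_measurable M (F s) (X s)" if "s \<in> {0..T}" for s
    by (rule solution_ae_measurable[OF L b Bm paths that])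
  \<comment> \<open>Clamping the time to \<open>{0..T}\<close> makes the paths continuous and
    bounded on the whole line, as the solvability lemmas require, without changing them on
    \<open>{0..T}\<close>.\<close>
  define g where "g s \<omega> = b (X (max 0 (min T s)) \<omega>)" for s \<omega>
  have clamp: "max 0 (min T s) = s" if "s \<in> {0..T}" for s using that by auto
  have gm: "ae_measurable M (F s) (g s)" if "s \<in> {0..T}" for s
    using ae_measurable_compose[OF Xm[OF that] borel_measurable_continuous_onI[OF b]] that
    by (simp add: g_def[abs_def] clamp)
  have g_paths: "AE \<omega> in M. continuous_on UNIV (\<lambda>s. g s \<omega>) \<and> (\<exists>C. \<forall>s. \<bar>g s \<omega>\<bar> \<le> C)"
    using X
  proof eventually_elim
    case (elim \<omega>)
    have bX: "continuous_on {0..T} (\<lambda>s. b (X s \<omega>))"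
      using elim by (intro continuous_on_compose2[OF b]) auto
    have c: "continuous_on UNIV (\<lambda>s. g s \<omega>)"
      unfolding g_def using \<open>T > 0\<close> by (intro continuous_on_compose2[OF bX] continuous_intros) auto
    have "bounded ((\<lambda>s. b (X s \<omega>)) ` {0..T})"
      using bX by (intro compact_imp_bounded compact_continuous_image) auto
    then obtain C where C: "\<And>s. s \<in> {0..T} \<Longrightarrow> \<bar>b (X s \<omega>)\<bar> \<le> C"
      unfolding bounded_iff by (metis image_eqI real_norm_def)
    have "\<bar>g s \<omega>\<bar> \<le> C" for s unfolding g_def using \<open>T > 0\<close> by (intro C) auto
    then show ?case using c by blast
  qed
  have "volterra_solvable H T g"
  proof (cases H "1 / 2 :: real" rule: linorder_cases)
    case less
    show ?thesis by (rule volterra_solvable_lt[OF assms(2) less gm g_paths])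
  next
    case equal
    show ?thesis unfolding equal by (rule volterra_solvable_half[OF gm g_paths])
  next
    case greater
    define \<alpha> where "\<alpha> = H - 1 / 2"
    have \<alpha>: "H = \<alpha> + 1 / 2" "0 < \<alpha>" "\<alpha> < 1 / 2" using greater assms(3) by (auto simp: \<alpha>_def)
    have "AE \<omega> in M. sobolev_energy \<alpha> T (\<lambda>s. g s \<omega>) < \<infinity>"
      using fbm_sobolev_energy_finite[OF assms(1,9) \<alpha>, where T = T] X Bc g_paths
    proof eventually_elim
      case (elim \<omega>)
      then obtain C where C: "\<And>s. \<bar>g s \<omega>\<bar> \<le> C" by blast
      \<comment> \<open>Freezing the path before time 0 makes it continuous, hence Borel, on the
        whole line; the energy involves only times in \<open>{0..T}\<close>.\<close>
      define y where "y s = B (max 0 s) \<omega>" for s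
      have "continuous_on UNIV y"
        unfolding y_def by (intro continuous_on_compose2[OF elim(3)] continuous_intros) auto
      then have y: "y \<in> borel_measurable borel" by (rule borel_measurable_continuous_onI)
      have "sobolev_energy \<alpha> T y = sobolev_energy \<alpha> T (\<lambda>s. B s \<omega>)"
        by (rule sobolev_energy_cong) (simp add: y_def)
      then have fin: "sobolev_energy \<alpha> T y < \<infinity>" using elim(1) by simp
      show ?case
      proof (rule sobolev_energy_drift_finite[OF \<alpha>(2,3) _ _ _ _ y fin])
        show "continuous_on {0..T} (\<lambda>s. b (X s \<omega>))"
          using elim(2) by (intro continuous_on_compose2[OF b]) auto
        show "\<bar>b (X s \<omega>)\<bar> \<le> C" if "s \<in> {0..T}" for s using C[of s] that by (simp add: g_def clamp)
        show "X s \<omega> = \<theta> * (LBINT u:{0..s}. b (X u \<omega>)) + y s" if "s \<in> {0..T}" for s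
          using elim(2) that by (simp add: y_def)
        show "\<bar>g s \<omega> - g u \<omega>\<bar> \<le> L * \<bar>X s \<omega> - X u \<omega>\<bar>" if "s \<in> {0..T}" "u \<in> {0..T}" for s u
          using L[of "X s \<omega>" "X u \<omega>"] that by (simp add: g_def clamp)
      qed
    qed
    from volterra_solvable_gt[OF greater assms(3) gm g_paths this[unfolded \<alpha>_def]]
    show ?thesis by simp
  qed
  moreover have "AE \<omega> in M. \<forall>t\<in>{0..T}. integrated_drift b X \<omega> t = (LBINT u:{0..t}. g u \<omega>)"
    by (intro AE_I2 ballI) (auto simp: integrated_drift_def g_def intro!: set_lebesgue_integral_cong)
  ultimately have Q: "AE \<omega> in M. (\<lambda>s. Q_process H T b X s \<omega>) \<in> L2 T \<and>
            (\<forall>t\<in>{0..T}. K_op H (\<lambda>s. Q_process H T b X s \<omega>) t = integrated_drift b X \<omega> t)"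
    and ito: "\<And>t. t \<in> {0..T} \<Longrightarrow> \<exists>I. has_ito_integral M W (Q_process H T b X) t I"
    using K_op_inverse_ito[OF assms(2,3), of T g "integrated_drift b X"] by (simp_all add: Q_process_def[abs_def])
  have mle: "AE \<omega> in M.
                let V = (LBINT s:{0..t}. (Q_process H T b X s \<omega>)\<^sup>2);
                    F = log_likelihood (I \<omega>) (\<lambda>s. Q_process H T b X s \<omega>) t;
                    \<theta>\<^sub>t = - (I \<omega> / V)
                in \<forall>S\<in>{UNIV, \<Theta>}. \<theta>\<^sub>t \<in> S \<longrightarrow>
                     maximum_likelihood_estimate S F \<theta>\<^sub>t \<and>
                     (V > 0 \<longrightarrow> (\<forall>\<eta>. maximum_likelihood_estimate S F \<eta> \<longrightarrow> \<eta> = \<theta>\<^sub>t))"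
    if t: "t \<in> {0..T}" and I: "has_ito_integral M W (Q_process H T b X) t I" for t I
  proof -
    have "AE \<omega> in M. (LBINT s:{0..t}. (Q_process H T b X s \<omega>)\<^sup>2) = 0 \<longrightarrow> I \<omega> = 0"
      by (rule ito_integral_eq_0[OF I]) (use t in simp)
    then show ?thesis
    proof eventually_elim
      case (elim \<omega>)
      then show ?case
        unfolding Let_def using log_likelihood_maximum[of t "\<lambda>s. Q_process H T b X s \<omega>" "I \<omega>"] by blast
    qed
  qed
  show ?thesis using Q ito mle by blast
qed

end
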